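(* Let $T$ be an o-minimal theory and let $M$ be a model of $T$. Then the global $\mathrm U^{þ}$-rank is defined and equals the usual o-minimal dimension: for every $k$ and every nonempty definable $A\subseteq M^k$, $\mathrm U^{þ}(A)=\dim(A)$. Consequently þ-independence is precisely the usual independence relation: for (real) tuples $a,b$ and a set $A$, $tp(a/Ab)$ does not þ-fork over $A$ if and only if $\dim(a/Ab)=\dim(a/A)$.
   Context: $T$ is a complete first-order theory with monster model $\mathcal C$ (saturated, of large cardinality); all sets, tuples, types and models are small and live inside $\mathcal C$. Parameters witnessing dividing are taken in $\mathcal C^{eq}$. O-minimal structures are expansions of dense linear orders without endpoints in which every definable subset of the line is a finite union of points and intervals; $\dim$ is the usual o-minimal dimension of definable sets, and $\dim(a/A)$ is the least dimension of an $A$-definable set containing $a$. A family $\{\delta(x,a')\}_{a'\in S}$ is $k$-inconsistent if $\bigwedge_{i=1}^k\delta(x,a_i)$ is inconsistent for all pairwise distinct $a_1,\dots,a_k\in S$. A formula $\delta(x,a)$ strongly divides over $A$ if $tp(a/A)$ is non-algebraic and $\{\delta(x,a')\}_{a'\models tp(a/A)}$ is $k$-inconsistent for some $k\in\mathbb N$. It þ-divides over $A$ if there is a tuple $c$ such that $\delta(x,a)$ strongly divides over $Ac$. A formula þ-forks over $A$ if it implies a finite disjunction of formulas (with parameters) each of which þ-divides over $A$. A type þ-forks over $A$ if it contains a formula which þ-forks over $A$. The $\mathrm U^{þ}$-rank of a type $p(x)$ over a set $A$ is defined inductively: (1) $\mathrm U^{þ}(p)\ge 0$ if $p$ is consistent;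 (2) $\mathrm U^{þ}(p)\ge\alpha+1$ if there are a tuple $a$ and a type $q(x,a)$ over $Aa$ such that $q\supseteq p$, $\mathrm U^{þ}(q)\ge\alpha$ and $q$ þ-forks over $A$; (3) for a limit ordinal $\lambda$, $\mathrm U^{þ}(p)\ge\lambda$ iff $\mathrm U^{þ}(p)\ge\sigma$ for all $\sigma<\lambda$. For a definable set $A$, defined over a finite set $B$, $\mathrm U^{þ}(A)$ is the maximum of $\mathrm U^{þ}(tp(a/B))$ over points $a$ (in the monster model) of $A$. *)

theory Defs
  imports Main
begin

unbundle cardinal_syntax

section \<open>First-order languages, structures, definable sets\<close>

record ('f, 'r) lang =
  fsyms :: "'f set"
  farity :: "'f \<Rightarrow> nat"
  rsyms :: "'r set"
  rarity :: "'r \<Rightarrow> nat"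

datatype 'f trm = Var nat | Fun 'f "'f trm list"

datatype ('f, 'r) fm =
    Eq "'f trm" "'f trm"
  | Pred 'r "'f trm list"
  | Neg "('f, 'r) fm"
  | Conj "('f, 'r) fm" "('f, 'r) fm"
  | Exi nat "('f, 'r) fm"

primrec wf_trm :: "('f, 'r) lang \<Rightarrow> 'f trm \<Rightarrow> bool" where
  "wf_trm L (Var i) \<longleftrightarrow> True"
| "wf_trm L (Fun f ts) \<longleftrightarrow> f \<in> fsyms L \<and> length ts = farity L f \<and> list_all (wf_trm L) ts"

primrec wf_fm :: "('f, 'r) lang \<Rightarrow> ('f, 'r) fm \<Rightarrow> bool" where
  "wf_fm L (Eq s t) \<longleftrightarrow> wf_trm L s \<and> wf_trm L t"
| "wf_fm L (Pred R ts) \<longleftrightarrow> R \<in> rsyms L \<and> length ts = rarity L R \<and> list_all (wf_trm L) ts"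
| "wf_fm L (Neg \<phi>) \<longleftrightarrow> wf_fm L \<phi>"
| "wf_fm L (Conj \<phi> \<psi>) \<longleftrightarrow> wf_fm L \<phi> \<and> wf_fm L \<psi>"
| "wf_fm L (Exi i \<phi>) \<longleftrightarrow> wf_fm L \<phi>"

primrec vars_trm :: "'f trm \<Rightarrow> nat set" where
  "vars_trm (Var i) = {i}"
| "vars_trm (Fun f ts) = \<Union> (set (map vars_trm ts))"

primrec fv :: "('f, 'r) fm \<Rightarrow> nat set" where
  "fv (Eq s t) = vars_trm s \<union> vars_trm t"
| "fv (Pred R ts) = (\<Union>t\<in>set ts. vars_trm t)"
| "fv (Neg \<phi>) = fv \<phi>"
| "fv (Conj \<phi> \<psi>) = fv \<phi> \<union> fv \<psi>"
| "fv (Exi i \<phi>) = fv \<phi> - {i}"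

record ('f, 'r, 'a) struc =
  univ :: "'a set"
  fint :: "'f \<Rightarrow> 'a list \<Rightarrow> 'a"
  rint :: "'r \<Rightarrow> 'a list \<Rightarrow> bool"

definition tuples :: "'a set \<Rightarrow> nat \<Rightarrow> 'a list set" where
  "tuples U k = {xs. length xs = k \<and> set xs \<subseteq> U}"

definition is_struc :: "('f, 'r) lang \<Rightarrow> ('f, 'r, 'a) struc \<Rightarrow> bool" where
  "is_struc L N \<longleftrightarrow> univ N \<noteq> {} \<and>
     (\<forall>f\<in>fsyms L. \<forall>xs\<in>tuples (univ N) (farity L f). fint N f xs \<in> univ N)"

primrec val :: "('f, 'r, 'a) struc \<Rightarrow> (nat \<Rightarrow> 'a) \<Rightarrow> 'f trm \<Rightarrow> 'a" where
  "val N v (Var i) = v i"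
| "val N v (Fun f ts) = fint N f (map (val N v) ts)"

primrec sat :: "('f, 'r, 'a) struc \<Rightarrow> (nat \<Rightarrow> 'a) \<Rightarrow> ('f, 'r) fm \<Rightarrow> bool" where
  "sat N v (Eq s t) \<longleftrightarrow> val N v s = val N v t"
| "sat N v (Pred R ts) \<longleftrightarrow> rint N R (map (val N v) ts)"
| "sat N v (Neg \<phi>) \<longleftrightarrow> \<not> sat N v \<phi>"
| "sat N v (Conj \<phi> \<psi>) \<longleftrightarrow> sat N v \<phi> \<and> sat N v \<psi>"
| "sat N v (Exi i \<phi>) \<longleftrightarrow> (\<exists>x\<in>univ N. sat N (v(i := x)) \<phi>)"

definition sentences :: "('f, 'r) lang \<Rightarrow> ('f, 'r) fm set" where
  "sentences L = {\<phi>. wf_fm L \<phi> \<and> fv \<phi> = {}}"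

definition is_model :: "('f, 'r) lang \<Rightarrow> ('f, 'r) fm set \<Rightarrow> ('f, 'r, 'a) struc \<Rightarrow> bool" where
  "is_model L T N \<longleftrightarrow> is_struc L N \<and> (\<forall>\<phi>\<in>T. \<forall>v. range v \<subseteq> univ N \<longrightarrow> sat N v \<phi>)"

text \<open>Quantification over all models is over structures on subsets of one type; below that type
  carries a structure of cardinality greater than that of the language, so by
  Loewenheim-Skolem this is enough to test completeness.\<close>

definition complete_theory :: "'a itself \<Rightarrow> ('f, 'r) lang \<Rightarrow> ('f, 'r) fm set \<Rightarrow> bool" where
  "complete_theory (_ :: 'a itself) L T \<longleftrightarrow> T \<subseteq> sentences L \<and>
     (\<exists>N :: ('f, 'r, 'a) struc. is_model L T N) \<and>
     (\<forall>\<phi>\<in>sentences L.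
        (\<forall>N :: ('f, 'r, 'a) struc. is_model L T N \<longrightarrow> is_model L {\<phi>} N) \<or>
        (\<forall>N :: ('f, 'r, 'a) struc. is_model L T N \<longrightarrow> is_model L {Neg \<phi>} N))"

definition elem_sub :: "('f, 'r) lang \<Rightarrow> ('f, 'r, 'a) struc \<Rightarrow> ('f, 'r, 'a) struc \<Rightarrow> bool" where
  "elem_sub L M N \<longleftrightarrow> is_struc L M \<and> is_struc L N \<and> univ M \<subseteq> univ N \<and>
     (\<forall>\<phi> v. wf_fm L \<phi> \<longrightarrow> range v \<subseteq> univ M \<longrightarrow> (sat M v \<phi> \<longleftrightarrow> sat N v \<phi>))"

text \<open>A formula \<open>\<phi>(x,e)\<close> in \<open>k\<close> object variables with parameters from \<open>A\<close> is a pair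
  \<open>(\<phi>, e)\<close>: variables \<open>0, \<dots>, k - 1\<close> are the object variables, the following
  \<open>length e\<close> variables stand for the parameters.\<close>

definition fms_over :: "('f, 'r) lang \<Rightarrow> nat \<Rightarrow> 'a set \<Rightarrow> (('f, 'r) fm \<times> 'a list) set" where
  "fms_over L k A = {(\<phi>, e). wf_fm L \<phi> \<and> fv \<phi> \<subseteq> {..<k + length e} \<and> set e \<subseteq> A}"

definition solset :: "('f, 'r, 'a) struc \<Rightarrow> nat \<Rightarrow> ('f, 'r) fm \<times> 'a list \<Rightarrow> 'a list set" where
  "solset N k \<psi> = {xs \<in> tuples (univ N) k. sat N ((!) (xs @ snd \<psi>)) (fst \<psi>)}"

definition definable_over ::
    "('f, 'r) lang \<Rightarrow> ('f, 'r, 'a) struc \<Rightarrow> 'a set \<Rightarrow> nat \<Rightarrow> 'a list set \<Rightarrow> bool" where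
  "definable_over L N A k X \<longleftrightarrow> (\<exists>\<psi>\<in>fms_over L k A. X = solset N k \<psi>)"

section \<open>The monster model\<close>

definition small :: "('f, 'r, 'a) struc \<Rightarrow> 'b set \<Rightarrow> bool" where
  "small C A \<longleftrightarrow> |A| <o |univ C|"

definition saturated :: "('f, 'r) lang \<Rightarrow> ('f, 'r, 'a) struc \<Rightarrow> bool" where
  "saturated L C \<longleftrightarrow>
     (\<forall>A p. A \<subseteq> univ C \<longrightarrow> small C A \<longrightarrow> p \<subseteq> fms_over L 1 A \<longrightarrow>
        (\<forall>F\<subseteq>p. finite F \<longrightarrow> (\<exists>x\<in>tuples (univ C) 1. \<forall>\<psi>\<in>F. x \<in> solset C 1 \<psi>)) \<longrightarrow>
        (\<exists>x\<in>tuples (univ C) 1. \<forall>\<psi>\<in>p. x \<in> solset C 1 \<psi>))"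

text \<open>The second conjunct says that the cardinality of \<open>C\<close> exceeds that of the language
  (and is uncountable), as there are always infinitely many formulas.\<close>

definition monster :: "('f, 'r) lang \<Rightarrow> ('f, 'r) fm set \<Rightarrow> ('f, 'r, 'a) struc \<Rightarrow> bool" where
  "monster L T C \<longleftrightarrow> is_model L T C \<and> |{\<phi>. wf_fm L \<phi>}| <o |univ C| \<and> saturated L C"

section \<open>O-minimality and dimension\<close>

definition less_in :: "('f, 'r, 'a) struc \<Rightarrow> 'r \<Rightarrow> 'a \<Rightarrow> 'a \<Rightarrow> bool" where
  "less_in N lt x y \<longleftrightarrow> rint N lt [x, y]"

text \<open>The open interval with endpoints in the universe, or infinite (\<open>None\<close>).\<close>

definition interval ::
    "('f, 'r, 'a) struc \<Rightarrow> 'r \<Rightarrow> 'a option \<Rightarrow> 'a option \<Rightarrow> 'a set" where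
  "interval N lt l u = {x \<in> univ N.
     (\<forall>a. l = Some a \<longrightarrow> less_in N lt a x) \<and> (\<forall>b. u = Some b \<longrightarrow> less_in N lt x b)}"

definition point_or_interval :: "('f, 'r, 'a) struc \<Rightarrow> 'r \<Rightarrow> 'a set \<Rightarrow> bool" where
  "point_or_interval N lt I \<longleftrightarrow> (\<exists>a\<in>univ N. I = {a}) \<or>
     (\<exists>l u. set_option l \<subseteq> univ N \<and> set_option u \<subseteq> univ N \<and> I = interval N lt l u)"

definition dense_linear_order_no_endpoints :: "('f, 'r, 'a) struc \<Rightarrow> 'r \<Rightarrow> bool" where
  "dense_linear_order_no_endpoints N lt \<longleftrightarrow>
     (\<forall>x\<in>univ N. \<not> less_in N lt x x) \<and>
     (\<forall>x\<in>univ N. \<forall>y\<in>univ N. \<forall>z\<in>univ N.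
        less_in N lt x y \<longrightarrow> less_in N lt y z \<longrightarrow> less_in N lt x z) \<and>
     (\<forall>x\<in>univ N. \<forall>y\<in>univ N. less_in N lt x y \<or> x = y \<or> less_in N lt y x) \<and>
     (\<forall>x\<in>univ N. \<forall>y\<in>univ N. less_in N lt x y \<longrightarrow>
        (\<exists>z\<in>univ N. less_in N lt x z \<and> less_in N lt z y)) \<and>
     (\<forall>x\<in>univ N. (\<exists>y\<in>univ N. less_in N lt y x) \<and> (\<exists>z\<in>univ N. less_in N lt x z))"

definition o_minimal :: "('f, 'r) lang \<Rightarrow> 'r \<Rightarrow> ('f, 'r, 'a) struc \<Rightarrow> bool" where
  "o_minimal L lt N \<longleftrightarrow> is_struc L N \<and> lt \<in> rsyms L \<and> rarity L lt = 2 \<and>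
     dense_linear_order_no_endpoints N lt \<and>
     (\<forall>X. definable_over L N (univ N) 1 X \<longrightarrow>
        (\<exists>F. finite F \<and> (\<forall>I\<in>F. point_or_interval N lt I) \<and> {x. [x] \<in> X} = \<Union>F))"

definition o_minimal_theory ::
    "'a itself \<Rightarrow> ('f, 'r) lang \<Rightarrow> 'r \<Rightarrow> ('f, 'r) fm set \<Rightarrow> bool" where
  "o_minimal_theory (_ :: 'a itself) L lt T \<longleftrightarrow>
     (\<forall>N :: ('f, 'r, 'a) struc. is_model L T N \<longrightarrow> o_minimal L lt N)"

text \<open>Nonempty interior in the product of \<open>d\<close> copies of the order topology: some nondegenerate
  open box is contained in \<open>Y\<close>.\<close>

definition has_interior :: "('f, 'r, 'a) struc \<Rightarrow> 'r \<Rightarrow> nat \<Rightarrow> 'a list set \<Rightarrow> bool" where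
  "has_interior N lt d Y \<longleftrightarrow> (\<exists>l\<in>tuples (univ N) d. \<exists>u\<in>tuples (univ N) d.
     (\<forall>i<d. less_in N lt (l ! i) (u ! i)) \<and>
     {x \<in> tuples (univ N) d. \<forall>i<d. less_in N lt (l ! i) (x ! i) \<and> less_in N lt (x ! i) (u ! i)} \<subseteq> Y)"

text \<open>The o-minimal dimension of a nonempty definable \<open>X\<close> in \<open>k\<close> variables: the largest \<open>d\<close> such
  that the image of \<open>X\<close> under some projection to \<open>d\<close> of the coordinates has nonempty interior.\<close>

definition odim :: "('f, 'r, 'a) struc \<Rightarrow> 'r \<Rightarrow> nat \<Rightarrow> 'a list set \<Rightarrow> nat" where
  "odim N lt k X =
     Max {d. \<exists>I\<subseteq>{..<k}. card I = d \<and> has_interior N lt d ((\<lambda>x. nths x I) ` X)}"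

definition odim_tuple ::
    "('f, 'r) lang \<Rightarrow> ('f, 'r, 'a) struc \<Rightarrow> 'r \<Rightarrow> 'a list \<Rightarrow> 'a set \<Rightarrow> nat" where
  "odim_tuple L N lt a A =
     (LEAST d. \<exists>X. definable_over L N A (length a) X \<and> a \<in> X \<and> odim N lt (length a) X = d)"

section \<open>Imaginaries\<close>

text \<open>\<open>equiv_fm L C \<epsilon> n\<close>: the formula \<open>\<epsilon>\<close> without parameters defines an equivalence relation
  on \<open>n\<close>-tuples. The many-sorted structure of imaginaries has the real sort and one sort for every
  such \<open>(\<epsilon>, n)\<close>, whose elements are the classes, tagged by their sort.\<close>

definition equiv_fm :: "('f, 'r) lang \<Rightarrow> ('f, 'r, 'a) struc \<Rightarrow> ('f, 'r) fm \<Rightarrow> nat \<Rightarrow> bool" where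
  "equiv_fm L C \<epsilon> n \<longleftrightarrow> wf_fm L \<epsilon> \<and> fv \<epsilon> \<subseteq> {..<2 * n} \<and>
     equiv (tuples (univ C) n)
       {(x, y). x \<in> tuples (univ C) n \<and> y \<in> tuples (univ C) n \<and> sat C ((!) (x @ y)) \<epsilon>}"

definition eclass :: "('f, 'r, 'a) struc \<Rightarrow> ('f, 'r) fm \<Rightarrow> nat \<Rightarrow> 'a list \<Rightarrow> 'a list set" where
  "eclass C \<epsilon> n x = {y \<in> tuples (univ C) n. sat C ((!) (x @ y)) \<epsilon>}"

datatype ('f, 'r) esort = RealSort | ImagSort "('f, 'r) fm" nat

datatype ('f, 'r, 'a) elt = Rl (the_real: 'a) | Img "('f, 'r) fm" nat "'a list set"

primrec sort_of :: "('f, 'r, 'a) elt \<Rightarrow> ('f, 'r) esort" where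
  "sort_of (Rl x) = RealSort"
| "sort_of (Img \<epsilon> n c) = ImagSort \<epsilon> n"

definition Ceq :: "('f, 'r) lang \<Rightarrow> ('f, 'r, 'a) struc \<Rightarrow> ('f, 'r, 'a) elt set" where
  "Ceq L C = Rl ` univ C \<union>
     {Img \<epsilon> n (eclass C \<epsilon> n x) | \<epsilon> n x. equiv_fm L C \<epsilon> n \<and> x \<in> tuples (univ C) n}"

definition eq_tuples ::
    "('f, 'r) lang \<Rightarrow> ('f, 'r, 'a) struc \<Rightarrow> ('f, 'r) esort list \<Rightarrow> ('f, 'r, 'a) elt list set" where
  "eq_tuples L C \<sigma> = {xs. set xs \<subseteq> Ceq L C \<and> map sort_of xs = \<sigma>}"

text \<open>Formulas of the many-sorted language of imaginaries. \<open>Base \<phi>\<close> is a formula of the original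
  language in variables of the real sort; \<open>Proj \<epsilon> n is j\<close> says that variable \<open>j\<close> is the class
  modulo \<open>\<epsilon>\<close> of the real tuple of variables \<open>is\<close>. Variables carry no sort: an atomic formula whose
  variables have values in the wrong sorts is false, and every quantifier ranges over one sort.\<close>

datatype ('f, 'r) eqfm =
    Base "('f, 'r) fm"
  | EqE nat nat
  | Proj "('f, 'r) fm" nat "nat list" nat
  | NegE "('f, 'r) eqfm"
  | ConjE "('f, 'r) eqfm" "('f, 'r) eqfm"
  | ExiE "('f, 'r) esort" nat "('f, 'r) eqfm"

primrec wf_sort :: "('f, 'r) lang \<Rightarrow> ('f, 'r, 'a) struc \<Rightarrow> ('f, 'r) esort \<Rightarrow> bool" where
  "wf_sort L C RealSort \<longleftrightarrow> True"
| "wf_sort L C (ImagSort \<epsilon> n) \<longleftrightarrow> equiv_fm L C \<epsilon> n"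

primrec wf_eqfm :: "('f, 'r) lang \<Rightarrow> ('f, 'r, 'a) struc \<Rightarrow> ('f, 'r) eqfm \<Rightarrow> bool" where
  "wf_eqfm L C (Base \<phi>) \<longleftrightarrow> wf_fm L \<phi>"
| "wf_eqfm L C (EqE i j) \<longleftrightarrow> True"
| "wf_eqfm L C (Proj \<epsilon> n is j) \<longleftrightarrow> equiv_fm L C \<epsilon> n \<and> length is = n"
| "wf_eqfm L C (NegE \<phi>) \<longleftrightarrow> wf_eqfm L C \<phi>"
| "wf_eqfm L C (ConjE \<phi> \<psi>) \<longleftrightarrow> wf_eqfm L C \<phi> \<and> wf_eqfm L C \<psi>"
| "wf_eqfm L C (ExiE s i \<phi>) \<longleftrightarrow> wf_sort L C s \<and> wf_eqfm L C \<phi>"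

primrec fv_eq :: "('f, 'r) eqfm \<Rightarrow> nat set" where
  "fv_eq (Base \<phi>) = fv \<phi>"
| "fv_eq (EqE i j) = {i, j}"
| "fv_eq (Proj \<epsilon> n is j) = insert j (set is)"
| "fv_eq (NegE \<phi>) = fv_eq \<phi>"
| "fv_eq (ConjE \<phi> \<psi>) = fv_eq \<phi> \<union> fv_eq \<psi>"
| "fv_eq (ExiE s i \<phi>) = fv_eq \<phi> - {i}"

primrec sat_eq ::
    "('f, 'r) lang \<Rightarrow> ('f, 'r, 'a) struc \<Rightarrow> (nat \<Rightarrow> ('f, 'r, 'a) elt) \<Rightarrow> ('f, 'r) eqfm \<Rightarrow> bool" where
  "sat_eq L C v (Base \<phi>) \<longleftrightarrow>
     (\<forall>i\<in>fv \<phi>. sort_of (v i) = RealSort) \<and> sat C (\<lambda>i. the_real (v i)) \<phi>"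
| "sat_eq L C v (EqE i j) \<longleftrightarrow> v i = v j"
| "sat_eq L C v (Proj \<epsilon> n is j) \<longleftrightarrow> (\<forall>i\<in>set is. sort_of (v i) = RealSort) \<and>
     v j = Img \<epsilon> n (eclass C \<epsilon> n (map (\<lambda>i. the_real (v i)) is))"
| "sat_eq L C v (NegE \<phi>) \<longleftrightarrow> \<not> sat_eq L C v \<phi>"
| "sat_eq L C v (ConjE \<phi> \<psi>) \<longleftrightarrow> sat_eq L C v \<phi> \<and> sat_eq L C v \<psi>"
| "sat_eq L C v (ExiE s i \<phi>) \<longleftrightarrow>
     (\<exists>x\<in>Ceq L C. sort_of x = s \<and> sat_eq L C (v(i := x)) \<phi>)"

section \<open>Types\<close>

type_synonym ('f, 'r, 'a) pfm = "('f, 'r) eqfm \<times> ('f, 'r, 'a) elt list"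

definition eqfms_over ::
    "('f, 'r) lang \<Rightarrow> ('f, 'r, 'a) struc \<Rightarrow> nat \<Rightarrow> ('f, 'r, 'a) elt set \<Rightarrow> ('f, 'r, 'a) pfm set" where
  "eqfms_over L C k A =
     {(\<phi>, e). wf_eqfm L C \<phi> \<and> fv_eq \<phi> \<subseteq> {..<k + length e} \<and> set e \<subseteq> A}"

definition eqholds ::
    "('f, 'r) lang \<Rightarrow> ('f, 'r, 'a) struc \<Rightarrow> ('f, 'r, 'a) pfm \<Rightarrow> ('f, 'r, 'a) elt list \<Rightarrow> bool" where
  "eqholds L C \<psi> xs \<longleftrightarrow> sat_eq L C ((!) (xs @ snd \<psi>)) (fst \<psi>)"

definition tp ::
    "('f, 'r) lang \<Rightarrow> ('f, 'r, 'a) struc \<Rightarrow> ('f, 'r, 'a) elt list \<Rightarrow> ('f, 'r, 'a) elt set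
      \<Rightarrow> ('f, 'r, 'a) pfm set" where
  "tp L C a A = {\<psi> \<in> eqfms_over L C (length a) A. eqholds L C \<psi> a}"

text \<open>In the following \<open>\<sigma>\<close> is the list of sorts of the object variables.\<close>

definition realizations ::
    "('f, 'r) lang \<Rightarrow> ('f, 'r, 'a) struc \<Rightarrow> ('f, 'r) esort list \<Rightarrow> ('f, 'r, 'a) pfm set
      \<Rightarrow> ('f, 'r, 'a) elt list set" where
  "realizations L C \<sigma> p = {x \<in> eq_tuples L C \<sigma>. \<forall>\<psi>\<in>p. eqholds L C \<psi> x}"

definition consistent ::
    "('f, 'r) lang \<Rightarrow> ('f, 'r, 'a) struc \<Rightarrow> ('f, 'r) esort list \<Rightarrow> ('f, 'r, 'a) pfm set \<Rightarrow> bool" where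
  "consistent L C \<sigma> p \<longleftrightarrow> (\<forall>F\<subseteq>p. finite F \<longrightarrow> realizations L C \<sigma> F \<noteq> {})"

definition algebraic ::
    "('f, 'r) lang \<Rightarrow> ('f, 'r, 'a) struc \<Rightarrow> ('f, 'r) esort list \<Rightarrow> ('f, 'r, 'a) pfm set \<Rightarrow> bool" where
  "algebraic L C \<sigma> p \<longleftrightarrow> (\<exists>\<psi>\<in>p. finite (realizations L C \<sigma> {\<psi>}))"

section \<open>Thorn-forking and the thorn-rank\<close>

definition k_inconsistent ::
    "('f, 'r) lang \<Rightarrow> ('f, 'r, 'a) struc \<Rightarrow> ('f, 'r) esort list \<Rightarrow> ('f, 'r) eqfm
      \<Rightarrow> ('f, 'r, 'a) elt list set \<Rightarrow> nat \<Rightarrow> bool" where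
  "k_inconsistent L C \<sigma> \<delta> S k \<longleftrightarrow>
     (\<forall>F\<subseteq>S. finite F \<longrightarrow> card F = k \<longrightarrow> realizations L C \<sigma> ((\<lambda>a. (\<delta>, a)) ` F) = {})"

definition strongly_divides ::
    "('f, 'r) lang \<Rightarrow> ('f, 'r, 'a) struc \<Rightarrow> ('f, 'r) esort list \<Rightarrow> ('f, 'r, 'a) pfm
      \<Rightarrow> ('f, 'r, 'a) elt set \<Rightarrow> bool" where
  "strongly_divides L C \<sigma> = (\<lambda>(\<delta>, a) A.
     \<not> algebraic L C (map sort_of a) (tp L C a A) \<and>
     (\<exists>k. k_inconsistent L C \<sigma> \<delta> (realizations L C (map sort_of a) (tp L C a A)) k))"

definition thorn_divides ::
    "('f, 'r) lang \<Rightarrow> ('f, 'r, 'a) struc \<Rightarrow> ('f, 'r) esort list \<Rightarrow> ('f, 'r, 'a) pfm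
      \<Rightarrow> ('f, 'r, 'a) elt set \<Rightarrow> bool" where
  "thorn_divides L C \<sigma> \<psi> A \<longleftrightarrow>
     (\<exists>c. set c \<subseteq> Ceq L C \<and> strongly_divides L C \<sigma> \<psi> (A \<union> set c))"

definition thorn_forks_fm ::
    "('f, 'r) lang \<Rightarrow> ('f, 'r, 'a) struc \<Rightarrow> ('f, 'r) esort list \<Rightarrow> ('f, 'r, 'a) pfm
      \<Rightarrow> ('f, 'r, 'a) elt set \<Rightarrow> bool" where
  "thorn_forks_fm L C \<sigma> \<psi> A \<longleftrightarrow>
     (\<exists>D. finite D \<and> D \<subseteq> eqfms_over L C (length \<sigma>) (Ceq L C) \<and>
        (\<forall>\<delta>\<in>D. thorn_divides L C \<sigma> \<delta> A) \<and>
        realizations L C \<sigma> {\<psi>} \<subseteq> (\<Union>\<delta>\<in>D. realizations L C \<sigma> {\<delta>}))"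

definition thorn_forks ::
    "('f, 'r) lang \<Rightarrow> ('f, 'r, 'a) struc \<Rightarrow> ('f, 'r) esort list \<Rightarrow> ('f, 'r, 'a) pfm set
      \<Rightarrow> ('f, 'r, 'a) elt set \<Rightarrow> bool" where
  "thorn_forks L C \<sigma> p A \<longleftrightarrow> (\<exists>\<psi>\<in>p. thorn_forks_fm L C \<sigma> \<psi> A)"

definition is_succ :: "'o::wellorder \<Rightarrow> 'o \<Rightarrow> bool" where
  "is_succ \<beta> \<alpha> \<longleftrightarrow> \<beta> < \<alpha> \<and> (\<forall>\<gamma>. \<beta> < \<gamma> \<longrightarrow> \<alpha> \<le> \<gamma>)"

definition is_limit :: "'o::wellorder \<Rightarrow> bool" where
  "is_limit \<alpha> \<longleftrightarrow> (\<exists>\<beta>. \<beta> < \<alpha>) \<and> (\<forall>\<beta>. \<not> is_succ \<beta> \<alpha>)"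

text \<open>\<open>U_ge L C \<sigma> A p \<alpha>\<close>: the thorn-rank of the type \<open>p\<close> over \<open>A\<close> is at least \<open>\<alpha>\<close>.
  The ordinals are the elements of an arbitrary well-ordered type. The parameters of the
  extension \<open>q\<close>, which witness the forking, may be imaginary.\<close>

inductive U_ge ::
    "('f, 'r) lang \<Rightarrow> ('f, 'r, 'a) struc \<Rightarrow> ('f, 'r) esort list \<Rightarrow> ('f, 'r, 'a) elt set
      \<Rightarrow> ('f, 'r, 'a) pfm set \<Rightarrow> 'o::wellorder \<Rightarrow> bool"
  for L C \<sigma> where
  zero: "consistent L C \<sigma> p \<Longrightarrow> (\<forall>\<beta>. \<alpha> \<le> \<beta>) \<Longrightarrow> U_ge L C \<sigma> A p \<alpha>"
| succ: "is_succ \<beta> \<alpha> \<Longrightarrow> set a \<subseteq> Ceq L C \<Longrightarrow> q \<subseteq> eqfms_over L C (length \<sigma>) (A \<union> set a) \<Longrightarrow>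
    p \<subseteq> q \<Longrightarrow> U_ge L C \<sigma> (A \<union> set a) q \<beta> \<Longrightarrow> thorn_forks L C \<sigma> q A \<Longrightarrow> U_ge L C \<sigma> A p \<alpha>"
| limit: "is_limit \<alpha> \<Longrightarrow> (\<forall>\<beta><\<alpha>. U_ge L C \<sigma> A p \<beta>) \<Longrightarrow> U_ge L C \<sigma> A p \<alpha>"

text \<open>The rank has the finite value \<open>n\<close>. For finite values only finite ordinals are
  relevant, hence the instance of \<open>U_ge\<close> at type \<open>nat\<close>.\<close>

definition U_rank ::
    "('f, 'r) lang \<Rightarrow> ('f, 'r, 'a) struc \<Rightarrow> ('f, 'r) esort list \<Rightarrow> ('f, 'r, 'a) elt set
      \<Rightarrow> ('f, 'r, 'a) pfm set \<Rightarrow> nat \<Rightarrow> bool" where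
  "U_rank L C \<sigma> A p n \<longleftrightarrow> U_ge L C \<sigma> A p n \<and> \<not> U_ge L C \<sigma> A p (Suc n)"

text \<open>The rank of a set \<open>X\<close> of real \<open>k\<close>-tuples of the monster model that is defined
  over the finite set \<open>B\<close> is \<open>n\<close>, the maximum of the ranks of its points over \<open>B\<close>.\<close>

definition U_rank_set ::
    "('f, 'r) lang \<Rightarrow> ('f, 'r, 'a) struc \<Rightarrow> nat \<Rightarrow> 'a set \<Rightarrow> 'a list set \<Rightarrow> nat \<Rightarrow> bool" where
  "U_rank_set L C k B X n \<longleftrightarrow>
     (\<exists>a\<in>X. U_rank L C (replicate k RealSort) (Rl ` B) (tp L C (map Rl a) (Rl ` B)) n) \<and>
     (\<forall>a\<in>X. \<exists>m\<le>n. U_rank L C (replicate k RealSort) (Rl ` B) (tp L C (map Rl a) (Rl ` B)) m)"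

end

theory Submission
  imports Defs "HOL-Library.Nat_Bijection"
begin

text \<open>The thorn-rank is computed by the rank \<open>rk\<close> of algebraic closure, which counts the
  coordinates of a tuple that are not algebraic over the parameters and the preceding coordinates.
  The key is an exchange law over imaginary parameters: if \<open>b\<close> is imaginary, algebraic over \<open>F y\<close>
  for a real \<open>y\<close>, but not over \<open>F\<close>, then \<open>y\<close> is algebraic over \<open>F b\<close>. Hence adjoining an element
  of \<open>acl(F x) - acl(F)\<close> to \<open>F\<close> makes the rank of \<open>x\<close> drop. A strongly dividing formula \<open>\<delta>(x, b)\<close>
  produces such an element, because \<open>k\<close>-inconsistency makes \<open>b\<close> algebraic over \<open>x\<close>; conversely, if
  \<open>b\<close> is such an element, the formula witnessing its algebraicity over \<open>x\<close> divides strongly. The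
  rank of a point is the least dimension of a definable set containing it, since a definable set
  has interior if and only if it contains a point with independent coordinates.\<close>

section \<open>Substitution of variables\<close>

text \<open>The obstacle is that an o-minimal theory need not eliminate imaginaries, while the
  parameters that witness thorn-dividing are imaginary; the dimension theory of real tuples does not
  reach them. Exchange between real points, obtained by counting intervals of constancy, supplies
  the endpoints that bound the fibres over an imaginary \<open>b\<close>. Only the exchanged point
  \<open>y\<close> must be real, so the rank is studied for real tuples over arbitrary parameters.

  Forking adds disjunctions to dividing. The disjunct that \<open>x\<close> satisfies may use
  parameters on which \<open>x\<close> depends; therefore \<open>x\<close> is replaced by a point of
  the same type whose rank survives all parameters involved.

  Saturation is given for one real variable and real parameters. It is lifted to tuples of all sorts
  by coding an imaginary through a real representative. Back-and-forth extension of
  \<open>same_tp\<close> takes the place of automorphisms of the monster, and definability of a HOL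
  predicate (\<open>fdf\<close>, \<open>edf\<close>, \<open>rdf\<close>) with its closure rules
  takes the place of most explicit formulas.\<close>

primrec subst_trm :: "(nat \<Rightarrow> nat) \<Rightarrow> 'f trm \<Rightarrow> 'f trm" where
  "subst_trm g (Var i) = Var (g i)"
| "subst_trm g (Fun f ts) = Fun f (map (subst_trm g) ts)"

lemma val_subst_trm: "val N v (subst_trm g t) = val N (v \<circ> g) t"
  by (induction t) (auto intro!: arg_cong[where f = "fint N _"])

lemma val_cong: "(\<And>i. i \<in> vars_trm t \<Longrightarrow> v i = w i) \<Longrightarrow> val N v t = val N w t"
proof (induction t)
  case (Fun f ts)
  have "map (val N v) ts = map (val N w) ts"
    using Fun.prems by (auto intro!: Fun.IH)
  then show ?case by (simp only: val.simps)
qed auto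

lemma wf_subst_trm: "wf_trm L (subst_trm g t) = wf_trm L t"
  by (induction t) (auto simp: list_all_iff)

lemma vars_subst_trm: "vars_trm (subst_trm g t) = g ` vars_trm t"
  by (induction t) auto

lemma finite_vars_trm [simp]: "finite (vars_trm t)"
  by (induction t) auto

lemma finite_fv [simp]: "finite (fv \<phi>)"
  by (induction \<phi>) auto

lemma finite_fv_eq [simp]: "finite (fv_eq \<phi>)"
  by (induction \<phi>) auto

text \<open>Inserting \<open>0\<close> keeps \<open>Max\<close> meaningful when \<open>X\<close> is
  empty.\<close>

definition fresh :: "nat set \<Rightarrow> nat" where
  "fresh X = Suc (Max (insert 0 X))"

lemma fresh_gt: "finite X \<Longrightarrow> x \<in> X \<Longrightarrow> x < fresh X"
  unfolding fresh_def by (simp add: le_imp_less_Suc)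

text \<open>The recursion yields a function of the renaming because a quantifier alters it: the
  bound variable goes to a number above all images of variables free in the body, which avoids
  capture even if \<open>g\<close> is not injective.\<close>

primrec subst_fm :: "('f, 'r) fm \<Rightarrow> (nat \<Rightarrow> nat) \<Rightarrow> ('f, 'r) fm" where
  "subst_fm (Eq s t) = (\<lambda>g. Eq (subst_trm g s) (subst_trm g t))"
| "subst_fm (Pred R ts) = (\<lambda>g. Pred R (map (subst_trm g) ts))"
| "subst_fm (Neg \<phi>) = (\<lambda>g. Neg (subst_fm \<phi> g))"
| "subst_fm (Conj \<phi> \<psi>) = (\<lambda>g. Conj (subst_fm \<phi> g) (subst_fm \<psi> g))"
| "subst_fm (Exi i \<phi>) = (\<lambda>g. let k = fresh (g ` fv \<phi>) in Exi k (subst_fm \<phi> (g(i := k))))"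

lemma wf_subst_fm: "wf_fm L (subst_fm \<phi> g) = wf_fm L \<phi>"
  by (induction \<phi> arbitrary: g) (auto simp: wf_subst_trm list_all_iff Let_def)

lemma sat_cong: "(\<And>i. i \<in> fv \<phi> \<Longrightarrow> v i = w i) \<Longrightarrow> sat N v \<phi> = sat N w \<phi>"
proof (induction \<phi> arbitrary: v w)
  case (Eq s t)
  then show ?case using val_cong[of s v w N] val_cong[of t v w N] by auto
next
  case (Pred R ts)
  then have "map (val N v) ts = map (val N w) ts" by (auto intro!: val_cong)
  then show ?case by (simp only: sat.simps)
next
  case (Neg \<phi>)
  then show ?case by (metis fv.simps(3) sat.simps(3))
next
  case (Conj \<phi> \<psi>)
  then show ?case by (metis UnCI fv.simps(4) sat.simps(4))
next
  case (Exi i \<phi>)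
  have "sat N (v(i := x)) \<phi> = sat N (w(i := x)) \<phi>" for x
    by (rule Exi.IH) (use Exi.prems in auto)
  then show ?case by simp
qed

lemma fv_bind: "finite X \<Longrightarrow>
    (g(i := fresh (g ` X))) ` X - {fresh (g ` X)} = g ` (X - {i})"
  using fresh_gt[of "g ` X"] by (force split: if_splits)

lemma fv_subst_fm: "fv (subst_fm \<phi> g) = g ` fv \<phi>"
proof (induction \<phi> arbitrary: g)
  case (Exi i \<phi>)
  show ?case by (simp only: subst_fm.simps Let_def fv.simps Exi fv_bind[OF finite_fv])
qed (auto simp: vars_subst_trm)

lemma fresh_upd:
  "finite X \<Longrightarrow> j \<in> X \<Longrightarrow> (v(fresh (g ` X) := x) \<circ> g(i := fresh (g ` X))) j = ((v \<circ> g)(i := x)) j"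
  using fresh_gt[of "g ` X" "g j"] by auto

lemma sat_subst_fm: "sat N v (subst_fm \<phi> g) = sat N (v \<circ> g) \<phi>"
proof (induction \<phi> arbitrary: v g)
  case (Exi i \<phi>)
  have "sat N (v(fresh (g ` fv \<phi>) := x) \<circ> g(i := fresh (g ` fv \<phi>))) \<phi>
      = sat N ((v \<circ> g)(i := x)) \<phi>" for x
    by (rule sat_cong) (rule fresh_upd, auto)
  then show ?case by (simp only: subst_fm.simps Let_def sat.simps Exi)
qed (simp_all add: val_subst_trm comp_def)

section \<open>Renaming of variables in the many-sorted language\<close>

primrec subst_eq :: "('f, 'r) eqfm \<Rightarrow> (nat \<Rightarrow> nat) \<Rightarrow> ('f, 'r) eqfm" where
  "subst_eq (Base \<phi>) = (\<lambda>g. Base (subst_fm \<phi> g))"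
| "subst_eq (EqE i j) = (\<lambda>g. EqE (g i) (g j))"
| "subst_eq (Proj \<epsilon> n is j) = (\<lambda>g. Proj \<epsilon> n (map g is) (g j))"
| "subst_eq (NegE \<phi>) = (\<lambda>g. NegE (subst_eq \<phi> g))"
| "subst_eq (ConjE \<phi> \<psi>) = (\<lambda>g. ConjE (subst_eq \<phi> g) (subst_eq \<psi> g))"
| "subst_eq (ExiE s i \<phi>) = (\<lambda>g. let k = fresh (g ` fv_eq \<phi>) in ExiE s k (subst_eq \<phi> (g(i := k))))"

lemma wf_subst_eq: "wf_eqfm L C (subst_eq \<phi> g) = wf_eqfm L C \<phi>"
  by (induction \<phi> arbitrary: g) (auto simp: wf_subst_fm Let_def)

lemma fv_subst_eq: "fv_eq (subst_eq \<phi> g) = g ` fv_eq \<phi>"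
proof (induction \<phi> arbitrary: g)
  case (ExiE s i \<phi>)
  show ?case by (simp only: subst_eq.simps Let_def fv_eq.simps ExiE fv_bind[OF finite_fv_eq])
qed (auto simp: fv_subst_fm)

lemma sat_eq_cong:
  "(\<And>i. i \<in> fv_eq \<phi> \<Longrightarrow> v i = w i) \<Longrightarrow> sat_eq L C v \<phi> = sat_eq L C w \<phi>"
proof (induction \<phi> arbitrary: v w)
  case (Base \<phi>)
  have "sat C (\<lambda>i. the_real (v i)) \<phi> = sat C (\<lambda>i. the_real (w i)) \<phi>"
    by (rule sat_cong) (use Base in auto)
  then show ?case using Base by auto
next
  case (Proj \<epsilon> n "is" j)
  have "map (\<lambda>i. the_real (v i)) is = map (\<lambda>i. the_real (w i)) is"
    using Proj by auto
  then show ?case using Proj by (auto simp del: map_eq_conv)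
next
  case (NegE \<phi>)
  then show ?case by (metis fv_eq.simps(4) sat_eq.simps(4))
next
  case (ConjE \<phi> \<psi>)
  then show ?case by (metis UnCI fv_eq.simps(5) sat_eq.simps(5))
next
  case (ExiE s i \<phi>)
  have "sat_eq L C (v(i := x)) \<phi> = sat_eq L C (w(i := x)) \<phi>" for x
    by (rule ExiE.IH) (use ExiE.prems in auto)
  then show ?case by simp
qed auto

lemma sat_subst_eq: "sat_eq L C v (subst_eq \<phi> g) = sat_eq L C (v \<circ> g) \<phi>"
proof (induction \<phi> arbitrary: v g)
  case (Base \<phi>)
  show ?case by (auto simp: sat_subst_fm fv_subst_fm comp_def)
next
  case (ExiE s i \<phi>)
  have "sat_eq L C (v(fresh (g ` fv_eq \<phi>) := x) \<circ> g(i := fresh (g ` fv_eq \<phi>))) \<phi>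
      = sat_eq L C ((v \<circ> g)(i := x)) \<phi>" for x
    by (rule sat_eq_cong) (rule fresh_upd, auto)
  then show ?case by (simp only: subst_eq.simps Let_def sat_eq.simps ExiE)
qed (simp_all add: comp_def)

section \<open>Assignments\<close>

text \<open>The parameters \<open>e\<close> of a formula occupy its first variables here, in contrast to
  \<^term>\<open>fms_over\<close>, where they come last.\<close>

definition pre :: "'b list \<Rightarrow> (nat \<Rightarrow> 'b) \<Rightarrow> nat \<Rightarrow> 'b" where
  "pre e v i = (if i < length e then e ! i else v (i - length e))"

lemma pre_Nil [simp]: "pre [] v = v"
  by (auto simp: pre_def)

lemma pre_Cons: "pre (a # e) v = case_nat a (pre e v)"
  by (auto simp: pre_def split: nat.splits)

lemma pre_append: "pre (e @ e') v = pre e (pre e' v)"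
  by (auto simp: pre_def nth_append fun_eq_iff)

lemma pre_shift [simp]: "pre e v (i + length e) = v i" "pre e v (length e + i) = v i"
  by (auto simp: pre_def)

lemma pre_nth [simp]: "i < length e \<Longrightarrow> pre e v i = e ! i"
  by (auto simp: pre_def)

lemma map_pre [simp]: "length e = n \<Longrightarrow> map (pre e v) [0..<n] = e"
  by (auto intro!: nth_equalityI)

lemma range_pre: "set e \<subseteq> X \<Longrightarrow> range v \<subseteq> X \<Longrightarrow> range (pre e v) \<subseteq> X"
  by (auto simp: pre_def)

section \<open>Definability in a class of structures\<close>

text \<open>One formula has to serve every structure in \<open>K\<close>: \<open>K = {M, C}\<close>
  gives transfer along an elementary substructure, \<open>K = {C}\<close> plain
  definability.\<close>

definition fdf :: "('f, 'r) lang \<Rightarrow> ('f, 'r, 'a) struc set \<Rightarrow>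
    (('f, 'r, 'a) struc \<Rightarrow> (nat \<Rightarrow> 'a) \<Rightarrow> bool) \<Rightarrow> bool" where
  "fdf L K P \<longleftrightarrow> (\<exists>\<phi>. wf_fm L \<phi> \<and> (\<forall>N\<in>K. \<forall>v. range v \<subseteq> univ N \<longrightarrow> P N v = sat N v \<phi>))"

lemma fdf_cong: "fdf L K P \<Longrightarrow> (\<And>N v. N \<in> K \<Longrightarrow> range v \<subseteq> univ N \<Longrightarrow> P N v = Q N v) \<Longrightarrow> fdf L K Q"
  unfolding fdf_def by metis

lemma fdf_sat: "wf_fm L \<phi> \<Longrightarrow> fdf L K (\<lambda>N v. sat N v \<phi>)"
  unfolding fdf_def by auto

lemma fdf_neg: "fdf L K P \<Longrightarrow> fdf L K (\<lambda>N v. \<not> P N v)"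
  unfolding fdf_def by (metis sat.simps(3) wf_fm.simps(3))

lemma fdf_conj: "fdf L K P \<Longrightarrow> fdf L K Q \<Longrightarrow> fdf L K (\<lambda>N v. P N v \<and> Q N v)"
  unfolding fdf_def by (metis sat.simps(4) wf_fm.simps(4))

lemma fdf_imp: "fdf L K P \<Longrightarrow> fdf L K Q \<Longrightarrow> fdf L K (\<lambda>N v. P N v \<longrightarrow> Q N v)"
  by (drule fdf_neg[of _ _ Q], drule fdf_conj, assumption, drule fdf_neg) simp

lemma fdf_ren: "fdf L K P \<Longrightarrow> fdf L K (\<lambda>N v. P N (\<lambda>i. v (g i)))"
  unfolding fdf_def
  apply clarify
  subgoal for \<phi>
    by (rule exI[of _ "subst_fm \<phi> g"]) (auto simp: wf_subst_fm sat_subst_fm comp_def image_subset_iff)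
  done

lemma fdf_eq: "fdf L K (\<lambda>N v. v i = v j)"
  unfolding fdf_def by (rule exI[of _ "Eq (Var i) (Var j)"]) auto

lemma fdf_True: "fdf L K (\<lambda>N v. True)"
  using fdf_eq[of L K 0 0] by simp

lemma fdf_False: "fdf L K (\<lambda>N v. False)"
  using fdf_neg[OF fdf_True, of L K] by simp

text \<open>The quantifier rules follow the de Bruijn convention: variable \<open>0\<close> is the bound one and the
  others are shifted. Higher-order unification then lets \<open>intro\<close> analyse predicates that are
  written with HOL binders.\<close>

lemma fdf_ex:
  assumes "fdf L K (\<lambda>N v. Q N (\<lambda>i. v (Suc i)) (v 0))"
  shows "fdf L K (\<lambda>N v. \<exists>x\<in>univ N. Q N v x)"
proof -
  obtain \<phi> where \<phi>: "wf_fm L \<phi>"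
    "\<And>N v. N \<in> K \<Longrightarrow> range v \<subseteq> univ N \<Longrightarrow> Q N (\<lambda>i. v (Suc i)) (v 0) = sat N v \<phi>"
    using assms unfolding fdf_def by blast
  define m where "m = fresh (fv \<phi>)"
  \<comment> \<open>Index \<open>0\<close> goes to the fresh \<open>m\<close> and
    \<open>Suc i\<close> back to \<open>i\<close>. A free variable \<open>Suc i\<close> has
    \<open>i < m\<close>, so the two do not collide.\<close>
  define g where "g = case_nat m id"
  have "sat N (v(m := x) \<circ> g) \<phi> = Q N v x" if "N \<in> K" "range v \<subseteq> univ N" "x \<in> univ N" for N v x
  proof -
    have "sat N (v(m := x) \<circ> g) \<phi> = sat N (case_nat x v) \<phi>"
    proof (rule sat_cong)
      fix i assume "i \<in> fv \<phi>"
      then have "i < m" by (auto simp: m_def fresh_gt)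
      then show "(v(m := x) \<circ> g) i = case_nat x v i" by (auto simp: g_def split: nat.splits)
    qed
    also have "\<dots> = Q N v x"
    proof -
      have "range (case_nat x v) \<subseteq> univ N"
        using that by (auto split: nat.splits simp: image_subset_iff)
      then show ?thesis using \<phi>(2)[of N "case_nat x v"] that by simp
    qed
    finally show ?thesis .
  qed
  then show ?thesis
    unfolding fdf_def using \<phi>(1)
    by (intro exI[of _ "Exi m (subst_fm \<phi> g)"]) (auto simp: wf_subst_fm sat_subst_fm)
qed

lemma fdf_ball: "(\<And>i::nat. i < n \<Longrightarrow> fdf L K (P i)) \<Longrightarrow> fdf L K (\<lambda>N v. \<forall>i<n. P i N v)"
proof (induction n)
  case 0
  then show ?case by (simp add: fdf_True)
next
  case (Suc n)
  show ?case by (rule fdf_cong[OF fdf_conj[OF Suc.IH Suc.prems[of n]]]) (auto simp: less_Suc_eq Suc.prems)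
qed

lemma tuples_0 [simp]: "tuples U 0 = {[]}"
  by (auto simp: tuples_def)

lemma bex_tuples_Suc: "(\<exists>xs\<in>tuples U (Suc n). P xs) = (\<exists>x\<in>U. \<exists>xs\<in>tuples U n. P (x # xs))"
proof
  assume "\<exists>xs\<in>tuples U (Suc n). P xs"
  then show "\<exists>x\<in>U. \<exists>xs\<in>tuples U n. P (x # xs)"
    unfolding tuples_def by (fastforce simp: length_Suc_conv)
next
  assume "\<exists>x\<in>U. \<exists>xs\<in>tuples U n. P (x # xs)"
  then obtain x xs where "x \<in> U" "xs \<in> tuples U n" "P (x # xs)" by blast
  then show "\<exists>xs\<in>tuples U (Suc n). P xs"
    by (intro bexI[of _ "x # xs"]) (auto simp: tuples_def)
qed

lemma fdf_exl:
  assumes "fdf L K (\<lambda>N v. Q N (\<lambda>i. v (i + n)) (map v [0..<n]))"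
  shows "fdf L K (\<lambda>N v. \<exists>xs\<in>tuples (univ N) n. Q N v xs)"
  using assms
proof (induction n arbitrary: Q)
  case 0
  then show ?case by simp
next
  case (Suc n)
  \<comment> \<open>The head is peeled off as the outer quantifier, so the \<open>n\<close> inner
    ones push it to index \<open>n\<close>; the first \<open>Suc n\<close> indices are rotated
    accordingly.\<close>
  note * = fdf_ren[OF Suc.prems, of "\<lambda>i. if i < Suc n then if i = 0 then n else i - 1 else i"]
  show ?case unfolding bex_tuples_Suc
  proof (rule fdf_ex, rule Suc.IH, rule fdf_cong[OF *])
    fix N and v :: "nat \<Rightarrow> 'c"
    have "map (\<lambda>i. v (if i < Suc n then if i = 0 then n else i - 1 else i)) [0..<Suc n]
        = v n # map v [0..<n]"
      by (intro nth_equalityI) (auto simp: nth_Cons split: nat.splits simp del: upt_Suc)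
    then show "Q N (\<lambda>i. v (if i + Suc n < Suc n then if i + Suc n = 0 then n else i + Suc n - 1 else i + Suc n))
        (map (\<lambda>i. v (if i < Suc n then if i = 0 then n else i - 1 else i)) [0..<Suc n]) =
      Q N (\<lambda>i. v (Suc i + n)) (v (0 + n) # map v [0..<n])"
      by simp
  qed
qed

lemma fdf_alll:
  assumes "fdf L K (\<lambda>N v. Q N (\<lambda>i. v (i + n)) (map v [0..<n]))"
  shows "fdf L K (\<lambda>N v. \<forall>xs\<in>tuples (univ N) n. Q N v xs)"
  using fdf_neg[OF fdf_exl[where Q = "\<lambda>N v x. \<not> Q N v x"], OF fdf_neg, OF assms] by simp

section \<open>Definability with imaginary parameters\<close>

definition at_most :: "nat \<Rightarrow> 'b set \<Rightarrow> bool" where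
  "at_most N X \<longleftrightarrow> finite X \<and> card X \<le> N"

lemma at_most_0: "at_most 0 X \<longleftrightarrow> X = {}"
  by (auto simp: at_most_def)

text \<open>This recursion turns a bound on the number of solutions into first-order quantifiers.
  The witness ranges over all of \<open>Y\<close> because \<open>X\<close> may already be
  empty.\<close>

lemma at_most_Suc: "X \<subseteq> Y \<Longrightarrow> Y \<noteq> {} \<Longrightarrow> at_most (Suc N) X \<longleftrightarrow> (\<exists>z\<in>Y. at_most N (X - {z}))"
proof
  assume *: "X \<subseteq> Y" "Y \<noteq> {}" "at_most (Suc N) X"
  show "\<exists>z\<in>Y. at_most N (X - {z})"
  proof (cases "X = {}")
    case True
    then show ?thesis using * by (auto simp: at_most_def)
  next
    case False
    then obtain z where "z \<in> X" by blast
    then show ?thesis using * by (intro bexI[of _ z]) (auto simp: at_most_def card_Diff_singleton)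
  qed
next
  assume *: "\<exists>z\<in>Y. at_most N (X - {z})"
  then obtain z where "at_most N (X - {z})" by blast
  then show "at_most (Suc N) X"
    unfolding at_most_def by (cases "z \<in> X") (auto simp: card_Diff_singleton)
qed

lemma at_most_mono: "X \<subseteq> Y \<Longrightarrow> at_most N Y \<Longrightarrow> at_most N X"
  unfolding at_most_def by (meson card_mono finite_subset le_trans)

locale eq_structure =
  fixes L :: "('f, 'r) lang" and C :: "('f, 'r, 'a) struc"
  assumes struc: "is_struc L C"
begin

definition SU :: "('f, 'r) esort \<Rightarrow> ('f, 'r, 'a) elt set" where
  "SU s = {x \<in> Ceq L C. sort_of x = s}"

text \<open>The equivalence is demanded for all valuations, also outside \<open>Ceq L C\<close>:
  variables carry no sort, and only quantifiers are bounded, by some \<open>SU s\<close>.\<close>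

definition edf :: "('f, 'r, 'a) elt set \<Rightarrow> ((nat \<Rightarrow> ('f, 'r, 'a) elt) \<Rightarrow> bool) \<Rightarrow> bool" where
  "edf E P \<longleftrightarrow> (\<exists>\<phi> e. wf_eqfm L C \<phi> \<and> set e \<subseteq> E \<and> (\<forall>v. P v = sat_eq L C (pre e v) \<phi>))"

text \<open>The terms that the closure rules may substitute. With them \<open>intro\<close> also
  settles definability goals in which variables and parameters are mixed.\<close>

definition is_arg :: "('f, 'r, 'a) elt set \<Rightarrow> ((nat \<Rightarrow> ('f, 'r, 'a) elt) \<Rightarrow> ('f, 'r, 'a) elt) \<Rightarrow> bool" where
  "is_arg E t \<longleftrightarrow> (\<exists>i. t = (\<lambda>v. v i)) \<or> (\<exists>a\<in>E. t = (\<lambda>v. a))"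

lemma is_arg_var: "is_arg E (\<lambda>v. v i)"
  by (auto simp: is_arg_def)

lemma is_arg_par: "a \<in> E \<Longrightarrow> is_arg E (\<lambda>v. a)"
  by (auto simp: is_arg_def)

lemmas is_args = is_arg_var is_arg_par

lemma SU_Ceq: "SU s \<subseteq> Ceq L C"
  by (auto simp: SU_def)

lemma sort_SU: "x \<in> SU s \<Longrightarrow> sort_of x = s"
  by (auto simp: SU_def)

lemma in_SU: "x \<in> Ceq L C \<Longrightarrow> x \<in> SU (sort_of x)"
  by (auto simp: SU_def)

lemma SU_Real: "SU RealSort = Rl ` univ C"
  by (auto simp: SU_def Ceq_def)

lemma univ_ne: "univ C \<noteq> {}"
  using struc by (auto simp: is_struc_def)

lemma wf_sort_of: "x \<in> Ceq L C \<Longrightarrow> wf_sort L C (sort_of x)"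
  by (auto simp: Ceq_def)

lemma tuples_ne: "tuples (univ C) n \<noteq> {}"
proof -
  obtain u where "u \<in> univ C" using univ_ne by blast
  then have "replicate n u \<in> tuples (univ C) n" by (auto simp: tuples_def)
  then show ?thesis by blast
qed

lemma SU_ne: "wf_sort L C s \<Longrightarrow> SU s \<noteq> {}"
  using univ_ne tuples_ne by (cases s) (fastforce simp: SU_def Ceq_def)+

lemma edf_mono: "edf E P \<Longrightarrow> E \<subseteq> E' \<Longrightarrow> edf E' P"
  unfolding edf_def by blast

section \<open>Closure rules for definability over imaginary parameters\<close>

lemma edf_sat: "wf_eqfm L C \<phi> \<Longrightarrow> edf E (\<lambda>v. sat_eq L C v \<phi>)"
  unfolding edf_def by (intro exI[of _ \<phi>] exI[of _ "[]"]) auto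

lemma edf_neg: "edf E P \<Longrightarrow> edf E (\<lambda>v. \<not> P v)"
  unfolding edf_def by (metis sat_eq.simps(4) wf_eqfm.simps(4))

lemma edf_conj:
  assumes "edf E P" "edf E Q"
  shows "edf E (\<lambda>v. P v \<and> Q v)"
proof -
  obtain \<phi> e \<psi> d where 1: "wf_eqfm L C \<phi>" "set e \<subseteq> E" "\<And>v. P v = sat_eq L C (pre e v) \<phi>"
    and 2: "wf_eqfm L C \<psi>" "set d \<subseteq> E" "\<And>v. Q v = sat_eq L C (pre d v) \<psi>"
    using assms unfolding edf_def by metis
  define g where "g i = (if i < length e then i else i + length d)" for i
  define h where "h i = i + length e" for i
  have "pre (e @ d) v \<circ> g = pre e v" "pre (e @ d) v \<circ> h = pre d v" for v
    by (auto simp: pre_def g_def h_def nth_append fun_eq_iff)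
  then show ?thesis unfolding edf_def using 1 2
    by (intro exI[of _ "ConjE (subst_eq \<phi> g) (subst_eq \<psi> h)"] exI[of _ "e @ d"])
      (auto simp: wf_subst_eq sat_subst_eq)
qed

lemma edf_imp: "edf E P \<Longrightarrow> edf E Q \<Longrightarrow> edf E (\<lambda>v. P v \<longrightarrow> Q v)"
  by (drule edf_neg[of _ Q], drule edf_conj, assumption, drule edf_neg) simp

lemma edf_disj: "edf E P \<Longrightarrow> edf E Q \<Longrightarrow> edf E (\<lambda>v. P v \<or> Q v)"
  by (drule edf_neg[of _ P], drule edf_imp, assumption) (simp add: disj_imp)

lemma edf_ren:
  assumes "edf E P"
  shows "edf E (\<lambda>v. P (\<lambda>i. v (g i)))"
proof -
  obtain \<phi> e where 1: "wf_eqfm L C \<phi>" "set e \<subseteq> E" "\<And>v. P v = sat_eq L C (pre e v) \<phi>"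
    using assms unfolding edf_def by metis
  define h where "h i = (if i < length e then i else g (i - length e) + length e)" for i
  have "pre e v \<circ> h = pre e (\<lambda>i. v (g i))" for v
    by (auto simp: pre_def h_def fun_eq_iff)
  then show ?thesis unfolding edf_def using 1
    by (intro exI[of _ "subst_eq \<phi> h"] exI[of _ e]) (auto simp: wf_subst_eq sat_subst_eq)
qed

lemma edf_par: "edf E P \<Longrightarrow> a \<in> E \<Longrightarrow> edf E (\<lambda>v. P (case_nat a v))"
  unfolding edf_def
  apply clarify
  subgoal for \<phi> e
    by (rule exI[of _ \<phi>], rule exI[of _ "e @ [a]"]) (auto simp: pre_append pre_Cons)
  done

lemma edf_eq0: "edf E (\<lambda>v. v i = v j)"
  using edf_sat[of "EqE i j"] by simp

lemma edf_True: "edf E (\<lambda>v. True)"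
  using edf_eq0[of E 0 0] by simp

lemma edf_ex:
  assumes "edf E (\<lambda>v. Q (\<lambda>i. v (Suc i)) (v 0))" and s: "wf_sort L C s"
  shows "edf E (\<lambda>v. \<exists>x\<in>SU s. Q v x)"
proof -
  obtain \<phi> e where \<phi>: "wf_eqfm L C \<phi>" "set e \<subseteq> E"
    "\<And>v. Q (\<lambda>i. v (Suc i)) (v 0) = sat_eq L C (pre e v) \<phi>"
    using assms unfolding edf_def by blast
  \<comment> \<open>The bound variable must avoid the positions of the parameters as well, hence
    \<open>length e\<close> is inserted.\<close>
  define m where "m = fresh (insert (length e) (fv_eq \<phi>))"
  define g where "g i = (if i < length e then i else if i = length e then m else i - 1)" for i
  have m: "length e < m" by (auto simp: m_def fresh_gt)
  have "sat_eq L C ((pre e v)(m := x) \<circ> g) \<phi> = Q v x" for v x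
  proof -
    have "sat_eq L C ((pre e v)(m := x) \<circ> g) \<phi> = sat_eq L C (pre e (case_nat x v)) \<phi>"
    proof (rule sat_eq_cong)
      fix i assume "i \<in> fv_eq \<phi>"
      then have "i < m" by (auto simp: m_def fresh_gt)
      then show "((pre e v)(m := x) \<circ> g) i = pre e (case_nat x v) i"
        using m by (auto simp: g_def pre_def Nitpick.case_nat_unfold)
    qed
    also have "\<dots> = Q v x" using \<phi>(3)[of "case_nat x v"] by simp
    finally show ?thesis .
  qed
  then show ?thesis
    unfolding edf_def using \<phi> s
    by (intro exI[of _ "ExiE s m (subst_eq \<phi> g)"] exI[of _ e]) (auto simp: wf_subst_eq sat_subst_eq SU_def)
qed

lemma edf_all:
  assumes "edf E (\<lambda>v. Q (\<lambda>i. v (Suc i)) (v 0))" "wf_sort L C s"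
  shows "edf E (\<lambda>v. \<forall>x\<in>SU s. Q v x)"
  using edf_neg[OF edf_ex[where Q = "\<lambda>v x. \<not> Q v x"], OF edf_neg, OF assms] by simp

lemma edf_exR:
  "edf E (\<lambda>v. Q (\<lambda>i. v (Suc i)) (v 0)) \<Longrightarrow> edf E (\<lambda>v. \<exists>x\<in>SU RealSort. Q v x)"
  by (rule edf_ex) auto

lemma edf_allR:
  "edf E (\<lambda>v. Q (\<lambda>i. v (Suc i)) (v 0)) \<Longrightarrow> edf E (\<lambda>v. \<forall>x\<in>SU RealSort. Q v x)"
  by (rule edf_all) auto

lemma edf_ball_list:
  "(\<And>x. x \<in> set xs \<Longrightarrow> edf E (P x)) \<Longrightarrow> edf E (\<lambda>v. \<forall>x\<in>set xs. P x v)"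
proof (induction xs)
  case Nil
  then show ?case by (simp add: edf_True)
next
  case (Cons a xs)
  then show ?case using edf_conj[of E "P a" "\<lambda>v. \<forall>x\<in>set xs. P x v"] by simp
qed

lemma edf_ball: "finite F \<Longrightarrow> (\<And>x. x \<in> F \<Longrightarrow> edf E (P x)) \<Longrightarrow> edf E (\<lambda>v. \<forall>x\<in>F. P x v)"
  using edf_ball_list[of _ E P] finite_list[of F] by auto

lemma eq_tuples_Nil [simp]: "eq_tuples L C [] = {[]}"
  by (auto simp: eq_tuples_def)

lemma eq_tuples_Cons: "x # xs \<in> eq_tuples L C (s # \<sigma>) \<longleftrightarrow> x \<in> SU s \<and> xs \<in> eq_tuples L C \<sigma>"
  by (auto simp: eq_tuples_def SU_def)

lemma bex_eq_tuples_Cons: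
  "(\<exists>xs\<in>eq_tuples L C (s # \<sigma>). P xs) = (\<exists>x\<in>SU s. \<exists>xs\<in>eq_tuples L C \<sigma>. P (x # xs))"
proof
  assume "\<exists>xs\<in>eq_tuples L C (s # \<sigma>). P xs"
  then obtain xs where *: "xs \<in> eq_tuples L C (s # \<sigma>)" "P xs" by blast
  then obtain y ys where "xs = y # ys" by (cases xs) (auto simp: eq_tuples_def)
  then show "\<exists>x\<in>SU s. \<exists>xs\<in>eq_tuples L C \<sigma>. P (x # xs)"
    using * by (auto simp: eq_tuples_Cons)
qed (use eq_tuples_Cons in blast)

lemma edf_exl:
  assumes "edf E (\<lambda>v. Q (\<lambda>i. v (i + length \<sigma>)) (map v [0..<length \<sigma>]))"
    and "list_all (wf_sort L C) \<sigma>"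
  shows "edf E (\<lambda>v. \<exists>xs\<in>eq_tuples L C \<sigma>. Q v xs)"
  using assms
proof (induction \<sigma> arbitrary: Q)
  case Nil
  then show ?case by simp
next
  case (Cons s \<sigma>)
  let ?n = "length \<sigma>"
  let ?g = "\<lambda>i. if i < Suc ?n then if i = 0 then ?n else i - 1 else i"
  note * = edf_ren[OF Cons.prems(1), of ?g]
  have eq: "Q (\<lambda>i. v (?g (i + length (s # \<sigma>)))) (map (\<lambda>i. v (?g i)) [0..<length (s # \<sigma>)]) =
      Q (\<lambda>i. v (Suc i + ?n)) (v (0 + ?n) # map v [0..<?n])" for v
  proof -
    have "map (\<lambda>i. v (?g i)) [0..<Suc ?n] = v ?n # map v [0..<?n]"
      by (intro nth_equalityI) (auto simp: nth_Cons split: nat.splits simp del: upt_Suc)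
    then show ?thesis by simp
  qed
  have "edf E (\<lambda>v. \<exists>x\<in>SU s. \<exists>xs\<in>eq_tuples L C \<sigma>. Q v (x # xs))"
    by (rule edf_ex, rule Cons.IH) (use * eq Cons.prems in auto)
  then show ?case unfolding bex_eq_tuples_Cons .
qed

lemma edf_at_most:
  assumes "edf E (\<lambda>v. Q (\<lambda>i. v (Suc i)) (v 0))" and s: "wf_sort L C s"
  shows "edf E (\<lambda>v. at_most N {x \<in> SU s. Q v x})"
  using assms(1)
proof (induction N arbitrary: Q)
  case 0
  have "edf E (\<lambda>v. \<not> (\<exists>x\<in>SU s. Q v x))"
    by (rule edf_neg, rule edf_ex[OF 0 s])
  moreover have "at_most 0 {x \<in> SU s. Q v x} \<longleftrightarrow> \<not> (\<exists>x\<in>SU s. Q v x)" for v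
    unfolding at_most_0 by blast
  ultimately show ?case by simp
next
  case (Suc N)
  have *: "at_most (Suc N) {x \<in> SU s. Q v x} = (\<exists>z\<in>SU s. at_most N {x \<in> SU s. Q v x \<and> x \<noteq> z})" for v
  proof -
    have "{x \<in> SU s. Q v x} - {z} = {x \<in> SU s. Q v x \<and> x \<noteq> z}" for z by auto
    then show ?thesis using at_most_Suc[of "{x \<in> SU s. Q v x}" "SU s" N] SU_ne[OF s] by auto
  qed
  show ?case unfolding *
    apply (rule edf_ex[OF _ s])
    apply (rule Suc.IH)
    apply (rule edf_conj)
     apply (use edf_ren[OF Suc.prems, of "\<lambda>i. if i = 0 then 0 else Suc i"] in simp)
    apply (rule edf_neg, rule edf_eq0)
    done
qed

lemma edf_pre:
  assumes "edf E P" "\<forall>t\<in>set ts. is_arg E t"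
  shows "edf E (\<lambda>v. P (pre (map (\<lambda>t. t v) ts) v))"
  using assms
proof (induction ts arbitrary: P)
  case Nil
  then show ?case by simp
next
  case (Cons t ts)
  from Cons.prems(2) consider i where "t = (\<lambda>v. v i)" | a where "a \<in> E" "t = (\<lambda>v. a)"
    by (auto simp: is_arg_def)
  then show ?case
  proof cases
    case 1
    \<comment> \<open>The arguments still to be substituted stand in front of the variables, so
      variable \<open>i\<close> sits at \<open>i + length ts\<close> at this stage.\<close>
    have "edf E (\<lambda>w. P (\<lambda>j. w (if j = 0 then i + length ts else j - 1)))"
      by (rule edf_ren[OF Cons.prems(1)])
    from Cons.IH[OF this] Cons.prems(2) have
      "edf E (\<lambda>v. P (\<lambda>j. pre (map (\<lambda>t. t v) ts) v (if j = 0 then i + length ts else j - 1)))"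
      by simp
    also have "(\<lambda>v j. pre (map (\<lambda>t. t v) ts) v (if j = 0 then i + length ts else j - 1))
        = (\<lambda>v. pre (map (\<lambda>t. t v) (t # ts)) v)"
      using 1 by (auto simp: pre_def fun_eq_iff nth_Cons split: nat.splits)
    finally show ?thesis by (simp add: fun_eq_iff)
  next
    case 2
    from Cons.IH[OF edf_par[OF Cons.prems(1) 2(1)]] Cons.prems(2) show ?thesis
      using 2 by (simp add: pre_Cons)
  qed
qed

lemma edf_app:
  assumes "edf E (\<lambda>v. Q (map v [0..<k]))" "length ts = k" "\<forall>t\<in>set ts. is_arg E t"
  shows "edf E (\<lambda>v. Q (map (\<lambda>t. t v) ts))"
  using edf_pre[OF assms(1,3)] assms(2) by simp

lemma edf1: "edf E (\<lambda>v. R (v 0)) \<Longrightarrow> is_arg E s \<Longrightarrow> edf E (\<lambda>v. R (s v))"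
  using edf_pre[of E "\<lambda>v. R (v 0)" "[s]"] by simp

lemma edf2: "edf E (\<lambda>v. R (v 0) (v 1)) \<Longrightarrow> is_arg E s \<Longrightarrow> is_arg E t \<Longrightarrow> edf E (\<lambda>v. R (s v) (t v))"
  using edf_pre[of E "\<lambda>v. R (v 0) (v 1)" "[s, t]"] by simp

lemma edf_eq: "is_arg E s \<Longrightarrow> is_arg E t \<Longrightarrow> edf E (\<lambda>v. s v = t v)"
  by (rule edf2[where R = "(=)"]) (rule edf_eq0)

text \<open>Turns a formula over \<open>E a\<close> into a family of formulas over \<open>E\<close>
  in which \<open>a\<close> can be moved. A parameter that lies in \<open>E\<close> stays fixed even
  if it also occurs in \<open>a\<close>.\<close>

lemma edf_params:
  assumes "edf (E \<union> set a) P"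
  shows "\<exists>P'. edf E P' \<and> (\<forall>v. P v = P' (pre a v))"
proof -
  obtain \<phi> e where \<phi>: "wf_eqfm L C \<phi>" "set e \<subseteq> E \<union> set a" "\<And>v. P v = sat_eq L C (pre e v) \<phi>"
    using assms unfolding edf_def by blast
  let ?n = "length e" and ?m = "length a"
  have "\<exists>h. e ! j = a ! h \<and> h < ?m" if "j < ?n" "e ! j \<notin> E" for j
  proof -
    have "e ! j \<in> set a" using \<phi>(2) that nth_mem by blast
    then show ?thesis by (metis in_set_conv_nth)
  qed
  then obtain h where h: "\<And>j. j < ?n \<Longrightarrow> e ! j \<notin> E \<Longrightarrow> e ! j = a ! h j \<and> h j < ?m" by metis
  define ts where "ts = map (\<lambda>j. if e ! j \<in> E then (\<lambda>w. e ! j) else (\<lambda>w :: nat \<Rightarrow> ('f, 'r, 'a) elt. w (h j))) [0..<?n]"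
  have ts: "\<forall>t\<in>set ts. is_arg E t" by (auto simp: ts_def is_args)
  have "edf E (\<lambda>w. sat_eq L C (\<lambda>i. w (if i < ?n then i else i + ?m)) \<phi>)"
    by (rule edf_ren[OF edf_sat[OF \<phi>(1)]])
  from edf_pre[OF this ts]
  have "edf E (\<lambda>w. sat_eq L C (\<lambda>i. pre (map (\<lambda>t. t w) ts) w (if i < ?n then i else i + ?m)) \<phi>)" .
  moreover have "(\<lambda>i. pre (map (\<lambda>t. t (pre a v)) ts) (pre a v) (if i < ?n then i else i + ?m)) = pre e v" for v
    using h by (auto simp: ts_def pre_def fun_eq_iff)
  ultimately show ?thesis using \<phi>(3)
    by (intro exI[of _ "\<lambda>w. sat_eq L C (\<lambda>i. pre (map (\<lambda>t. t w) ts) w (if i < ?n then i else i + ?m)) \<phi>"]) simp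
qed

lemma edf_params_insert:
  assumes "edf (insert a E) P"
  shows "\<exists>P'. edf E P' \<and> (\<forall>v. P v = P' (case_nat a v))"
  using edf_params[of E "[a]" P] assms by (simp add: pre_Cons)

lemma edf_eqfm:
  assumes "edf E (\<lambda>v. Q (map v [0..<k + m]))"
  shows "\<exists>\<delta> e. set e \<subseteq> E \<and> wf_eqfm L C \<delta> \<and> fv_eq \<delta> \<subseteq> {..<k + (length e + m)} \<and>
    (\<forall>x zs. length x = k \<longrightarrow> length zs = m \<longrightarrow> eqholds L C (\<delta>, e @ zs) x = Q (x @ zs))"
proof -
  obtain \<phi> e where \<phi>: "wf_eqfm L C \<phi>" "set e \<subseteq> E" "\<And>v. Q (map v [0..<k + m]) = sat_eq L C (pre e v) \<phi>"
    using assms unfolding edf_def by blast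
  let ?n = "length e"
  \<comment> \<open>The truth value depends on the first \<open>k + m\<close> variables only. All
    others are sent to \<open>z\<close>, which a dummy quantifier over the nonempty real sort binds;
    this gives the required bound on free variables. The renaming \<open>g\<close> also moves
    \<open>e\<close> from the front to its place between \<open>x\<close> and
    \<open>zs\<close>.\<close>
  define z where "z = k + ?n + m"
  define g where "g i = (if i < ?n then k + i else if i - ?n < k then i - ?n else if i - ?n < k + m then i else z)" for i
  define \<delta> where "\<delta> = ExiE RealSort z (subst_eq \<phi> g)"
  have "fv_eq \<delta> \<subseteq> {..<k + (?n + m)}"
    by (auto simp: \<delta>_def fv_subst_eq g_def z_def)
  moreover have "eqholds L C (\<delta>, e @ zs) x = Q (x @ zs)" if "length x = k" "length zs = m" for x zs
  proof -
    have "sat_eq L C (((!) (x @ e @ zs))(z := y) \<circ> g) \<phi> = Q (x @ zs)" for y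
    proof -
      have "((!) (x @ e @ zs))(z := y) \<circ> g = pre e (pre (x @ zs) (\<lambda>_. y))"
        using that by (auto simp: fun_eq_iff pre_def g_def z_def nth_append)
          (metis add.commute diff_add_inverse2 diff_diff_left)+
      then show ?thesis using \<phi>(3)[of "pre (x @ zs) (\<lambda>_. y)"] that by simp
    qed
    moreover have "\<exists>y\<in>Ceq L C. sort_of y = RealSort" using SU_ne[of RealSort] by (auto simp: SU_def)
    ultimately show ?thesis by (auto simp: eqholds_def \<delta>_def sat_subst_eq)
  qed
  ultimately show ?thesis using \<phi>(1,2)
    by (intro exI[of _ \<delta>] exI[of _ e]) (auto simp: \<delta>_def wf_subst_eq)
qed

lemma eqfm_edf:
  assumes "\<psi> \<in> eqfms_over L C k E"
  shows "edf E (\<lambda>v. eqholds L C \<psi> (map v [0..<k]))"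
proof -
  obtain \<phi> e where \<psi>: "\<psi> = (\<phi>, e)" "wf_eqfm L C \<phi>" "fv_eq \<phi> \<subseteq> {..<k + length e}" "set e \<subseteq> E"
    using assms by (auto simp: eqfms_over_def)
  define g where "g i = (if i < k then i + length e else i - k)" for i
  have "sat_eq L C ((!) (map v [0..<k] @ e)) \<phi> = sat_eq L C (pre e v \<circ> g) \<phi>" for v
    by (rule sat_eq_cong) (use \<psi>(3) in \<open>auto simp: g_def nth_append pre_def\<close>)
  then show ?thesis unfolding edf_def using \<psi>
    by (intro exI[of _ "subst_eq \<phi> g"] exI[of _ e]) (auto simp: wf_subst_eq sat_subst_eq eqholds_def)
qed

section \<open>Elimination of imaginary variables\<close>

text \<open>The sequence \<open>f\<close> supplies as many coordinates as the sort asks for, so real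
  and imaginary variables are treated alike.\<close>

definition rep :: "('f, 'r) esort \<Rightarrow> (nat \<Rightarrow> 'a) \<Rightarrow> ('f, 'r, 'a) elt" where
  "rep s f = (case s of RealSort \<Rightarrow> Rl (f 0)
     | ImagSort \<epsilon> n \<Rightarrow> Img \<epsilon> n (eclass C \<epsilon> n (map f [0..<n])))"

primrec sort_len :: "('f, 'r) esort \<Rightarrow> nat" where
  "sort_len RealSort = 1"
| "sort_len (ImagSort \<epsilon> n) = n"

lemma sort_rep [simp]: "sort_of (rep s f) = s"
  by (auto simp: rep_def split: esort.split)

lemma rep_Ceq: "wf_sort L C s \<Longrightarrow> range f \<subseteq> univ C \<Longrightarrow> rep s f \<in> Ceq L C"
proof (cases s)
  case (ImagSort \<epsilon> n)
  assume "wf_sort L C s" "range f \<subseteq> univ C"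
  then have "equiv_fm L C \<epsilon> n" "map f [0..<n] \<in> tuples (univ C) n"
    using ImagSort by (auto simp: tuples_def)
  then show ?thesis using ImagSort by (auto simp: rep_def Ceq_def)
qed (auto simp: rep_def Ceq_def)

lemma rep_cong: "(\<And>i. i < sort_len s \<Longrightarrow> f i = g i) \<Longrightarrow> rep s f = rep s g"
  by (cases s) (auto simp: rep_def intro!: arg_cong[where f = "eclass _ _ _"])

text \<open>The constant sequence chosen for a real element has the element itself as its only
  value; passing to representatives therefore adds no new parameters when all parameters are
  real.\<close>

lemma rep_ex:
  assumes "x \<in> Ceq L C"
  shows "\<exists>f. range f \<subseteq> univ C \<and> x = rep (sort_of x) f \<and> (\<forall>a. x = Rl a \<longrightarrow> f = (\<lambda>_. a))"
  using assms unfolding Ceq_def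
proof (elim UnE)
  assume "x \<in> Rl ` univ C"
  then obtain a where "x = Rl a" "a \<in> univ C" by blast
  then show ?thesis by (intro exI[of _ "\<lambda>_. a"]) (auto simp: rep_def)
next
  assume "x \<in> {Img \<epsilon> n (eclass C \<epsilon> n xs) |\<epsilon> n xs. equiv_fm L C \<epsilon> n \<and> xs \<in> tuples (univ C) n}"
  then obtain \<epsilon> n xs where x: "x = Img \<epsilon> n (eclass C \<epsilon> n xs)" "xs \<in> tuples (univ C) n" by blast
  obtain u where u: "u \<in> univ C" using univ_ne by blast
  have "map (pre xs (\<lambda>_. u)) [0..<n] = xs" using x by (simp add: tuples_def)
  moreover have "range (pre xs (\<lambda>_. u)) \<subseteq> univ C" using x u by (intro range_pre) (auto simp: tuples_def)
  ultimately show ?thesis using x by (intro exI[of _ "pre xs (\<lambda>_. u)"]) (auto simp: rep_def)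
qed

lemma eclass_eq:
  assumes "equiv_fm L C \<epsilon> n" "x \<in> tuples (univ C) n" "y \<in> tuples (univ C) n"
  shows "eclass C \<epsilon> n x = eclass C \<epsilon> n y \<longleftrightarrow> sat C ((!) (x @ y)) \<epsilon>"
proof -
  let ?R = "{(x, y). x \<in> tuples (univ C) n \<and> y \<in> tuples (univ C) n \<and> sat C ((!) (x @ y)) \<epsilon>}"
  have "equiv (tuples (univ C) n) ?R" using assms by (simp add: equiv_fm_def)
  from eq_equiv_class_iff[OF this assms(2,3)]
  have "?R `` {x} = ?R `` {y} \<longleftrightarrow> (x, y) \<in> ?R" .
  moreover have "?R `` {z} = eclass C \<epsilon> n z" if "z \<in> tuples (univ C) n" for z
    using that by (auto simp: eclass_def)
  ultimately show ?thesis using assms by auto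
qed

lemma fdf_eclass:
  assumes "equiv_fm L C \<epsilon> n"
  shows "fdf L {C} (\<lambda>N v. eclass C \<epsilon> n (map (\<lambda>j. v (g j)) [0..<n]) = eclass C \<epsilon> n (map (\<lambda>j. v (h j)) [0..<n]))"
proof -
  let ?k = "\<lambda>i. if i < n then g i else h (i - n)"
  have \<epsilon>: "wf_fm L \<epsilon>" "fv \<epsilon> \<subseteq> {..<2 * n}" using assms by (auto simp: equiv_fm_def)
  show ?thesis
  proof (rule fdf_cong[OF fdf_ren[OF fdf_sat[OF \<epsilon>(1)], of _ ?k]])
    fix N :: "('f, 'r, 'a) struc" and v :: "nat \<Rightarrow> 'a"
    assume N: "N \<in> {C}" "range v \<subseteq> univ N"
    let ?x = "map (\<lambda>j. v (g j)) [0..<n]" and ?y = "map (\<lambda>j. v (h j)) [0..<n]"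
    have "?x \<in> tuples (univ C) n" "?y \<in> tuples (univ C) n"
      using N by (auto simp: tuples_def)
    from eclass_eq[OF assms this] have
      "(eclass C \<epsilon> n ?x = eclass C \<epsilon> n ?y) = sat C ((!) (?x @ ?y)) \<epsilon>" .
    also have "\<dots> = sat C (\<lambda>i. v (?k i)) \<epsilon>"
    proof (rule sat_cong)
      fix i assume "i \<in> fv \<epsilon>"
      then have "i < 2 * n" using \<epsilon>(2) by auto
      then show "(?x @ ?y) ! i = v (?k i)" by (auto simp: nth_append)
    qed
    finally show "sat N (\<lambda>i. v (?k i)) \<epsilon> = (eclass C \<epsilon> n ?x = eclass C \<epsilon> n ?y)"
      using N by simp
  qed
qed

text \<open>Coordinate \<open>j\<close> of a representative of variable \<open>i\<close> is stored in variable
  \<open>prod_encode (i, j)\<close>.\<close>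

lemma fdf_sat_eq:
  assumes "wf_eqfm L C \<phi>" "\<forall>i. wf_sort L C (s i)"
  shows "fdf L {C} (\<lambda>N v. sat_eq L C (\<lambda>i. rep (s i) (\<lambda>j. v (prod_encode (i, j)))) \<phi>)"
  using assms
proof (induction \<phi> arbitrary: s)
  case (Base \<phi>)
  show ?case
  proof (cases "\<forall>i\<in>fv \<phi>. s i = RealSort")
    case True
    have "fdf L {C} (\<lambda>N v. sat N (\<lambda>i. v (prod_encode (i, 0))) \<phi>)"
      by (rule fdf_ren[OF fdf_sat]) (use Base in auto)
    then show ?thesis
    proof (rule fdf_cong)
      fix N :: "('f, 'r, 'a) struc" and v :: "nat \<Rightarrow> 'a"
      assume "N \<in> {C}"
      have "sat C (\<lambda>i. v (prod_encode (i, 0))) \<phi> = sat C (\<lambda>i. the_real (rep (s i) (\<lambda>j. v (prod_encode (i, j))))) \<phi>"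
        by (rule sat_cong) (use True in \<open>auto simp: rep_def\<close>)
      then show "sat N (\<lambda>i. v (prod_encode (i, 0))) \<phi> =
          sat_eq L C (\<lambda>i. rep (s i) (\<lambda>j. v (prod_encode (i, j)))) (Base \<phi>)"
        using \<open>N \<in> {C}\<close> True by simp
    qed
  next
    case False
    then show ?thesis by (intro fdf_cong[OF fdf_False]) auto
  qed
next
  case (EqE i j)
  show ?case
  proof (cases "s i = s j")
    case False
    then have "rep (s i) f \<noteq> rep (s j) g" for f g by (metis sort_rep)
    then show ?thesis using fdf_False[of L "{C}"] by simp
  next
    case True
    show ?thesis
    proof (cases "s i")
      case RealSort
      then show ?thesis using True by (simp add: rep_def fdf_eq)
    next
      case (ImagSort \<epsilon> n)
      then have "equiv_fm L C \<epsilon> n" using EqE.prems(2) by (metis wf_sort.simps(2))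
      moreover have "s i = ImagSort \<epsilon> n" "s j = ImagSort \<epsilon> n" using True ImagSort by auto
      ultimately show ?thesis using fdf_eclass[of \<epsilon> n] by (simp add: rep_def)
    qed
  qed
next
  case (Proj \<epsilon> n "is" j)
  show ?case
  proof (cases "(\<forall>i\<in>set is. s i = RealSort) \<and> s j = ImagSort \<epsilon> n")
    case True
    then have e: "equiv_fm L C \<epsilon> n" "length is = n" using Proj.prems by auto
    have m: "map (\<lambda>i. the_real (rep (s i) (\<lambda>j. v (prod_encode (i, j))))) is =
        map (\<lambda>j. v (prod_encode (is ! j, 0))) [0..<n]" for v
      using True e by (intro nth_equalityI) (auto simp: rep_def)
    show ?thesis
      using fdf_eclass[OF e(1), of "\<lambda>i. prod_encode (j, i)" "\<lambda>j. prod_encode (is ! j, 0)"] True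
      by (simp del: map_eq_conv add: m) (simp add: rep_def)
  next
    case False
    then have neg: "\<not> sat_eq L C (\<lambda>i. rep (s i) (\<lambda>j. v (prod_encode (i, j)))) (Proj \<epsilon> n is j)" for v
      by (metis sat_eq.simps(3) sort_of.simps(2) sort_rep)
    then show ?thesis by (intro fdf_cong[OF fdf_False]) (simp only: neg)
  qed
next
  case (NegE \<phi>)
  then show ?case using fdf_neg by fastforce
next
  case (ConjE \<phi> \<psi>)
  then show ?case using fdf_conj by fastforce
next
  case (ExiE t i \<phi>)
  let ?s = "s(i := t)" and ?m = "sort_len t"
  \<comment> \<open>Overwrites the coordinates of variable \<open>i\<close> by the quantified
    representative \<open>xs\<close> and leaves all other codes alone.\<close>
  let ?w = "\<lambda>(v :: nat \<Rightarrow> 'a) xs p. (let (i', j) = prod_decode p in if i' = i \<and> j < ?m then xs ! j else v p)"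
  have t: "wf_sort L C t" using ExiE.prems by simp
  have "fdf L {C} (\<lambda>N v. sat_eq L C (\<lambda>i. rep (?s i) (\<lambda>j. v (prod_encode (i, j)))) \<phi>)" (is "fdf L _ (\<lambda>N. ?P)")
    by (rule ExiE.IH) (use ExiE.prems in auto)
  note P = fdf_ren[OF this, of "\<lambda>p. let (i', j) = prod_decode p in if i' = i \<and> j < ?m then j else p + ?m"]
  have "(\<lambda>p. v (let (i', j) = prod_decode p in if i' = i \<and> j < ?m then j else p + ?m)) =
      ?w (\<lambda>i. v (i + ?m)) (map v [0..<?m])" for v :: "nat \<Rightarrow> 'a"
    by (auto simp: fun_eq_iff split: prod.splits)
  from fdf_cong[OF P arg_cong[where f = ?P, OF this]]
  have "fdf L {C} (\<lambda>N v. ?P (?w (\<lambda>i. v (i + ?m)) (map v [0..<?m])))" .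
  then have "fdf L {C} (\<lambda>N v. \<exists>xs\<in>tuples (univ N) ?m. ?P (?w v xs))"
    by (rule fdf_exl)
  then show ?case
  proof (rule fdf_cong)
    fix N :: "('f, 'r, 'a) struc" and v :: "nat \<Rightarrow> 'a"
    assume N: "N \<in> {C}" "range v \<subseteq> univ N"
    let ?r = "\<lambda>i. rep (s i) (\<lambda>j. v (prod_encode (i, j)))"
    have *: "(\<lambda>i'. rep (?s i') (\<lambda>j. ?w v xs (prod_encode (i', j)))) = ?r(i := rep t (\<lambda>j. xs ! j))" for xs
      by (auto simp: fun_eq_iff intro!: rep_cong)
    show "(\<exists>xs\<in>tuples (univ N) ?m. ?P (?w v xs)) = sat_eq L C ?r (ExiE t i \<phi>)"
    proof
      assume "\<exists>xs\<in>tuples (univ N) ?m. ?P (?w v xs)"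
      then obtain xs where xs: "xs \<in> tuples (univ C) ?m" "sat_eq L C (?r(i := rep t (\<lambda>j. xs ! j))) \<phi>"
        using N unfolding * by auto
      obtain u where u: "u \<in> univ C" using univ_ne by blast
      have "rep t (\<lambda>j. xs ! j) = rep t (pre xs (\<lambda>_. u))"
        using xs by (intro rep_cong) (auto simp: tuples_def)
      moreover have "rep t (pre xs (\<lambda>_. u)) \<in> Ceq L C"
        using xs u by (intro rep_Ceq[OF t] range_pre) (auto simp: tuples_def)
      ultimately show "sat_eq L C ?r (ExiE t i \<phi>)" using xs(2)
        by (simp only: sat_eq.simps) (intro bexI[of _ "rep t (pre xs (\<lambda>_. u))"], simp_all)
    next
      assume "sat_eq L C ?r (ExiE t i \<phi>)"
      then obtain y where y: "y \<in> Ceq L C" "sort_of y = t" "sat_eq L C (?r(i := y)) \<phi>" by auto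
      then obtain f where f: "range f \<subseteq> univ C" "y = rep t f" using rep_ex by metis
      have "rep t (\<lambda>j. map f [0..<?m] ! j) = y" unfolding f by (rule rep_cong) auto
      then have "?P (?w v (map f [0..<?m]))" using y(3) unfolding * by simp
      moreover have "map f [0..<?m] \<in> tuples (univ N) ?m" using N f by (auto simp: tuples_def)
      ultimately show "\<exists>xs\<in>tuples (univ N) ?m. ?P (?w v xs)" by blast
    qed
  qed
qed

definition rdf :: "'a set \<Rightarrow> ((nat \<Rightarrow> 'a) \<Rightarrow> bool) \<Rightarrow> bool" where
  "rdf A P \<longleftrightarrow> (\<exists>\<chi> e. wf_fm L \<chi> \<and> set e \<subseteq> A \<and>
     (\<forall>v. range v \<subseteq> univ C \<longrightarrow> P v = sat C (pre e v) \<chi>))"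

definition repf :: "('f, 'r, 'a) elt \<Rightarrow> nat \<Rightarrow> 'a" where
  "repf x = (SOME f. range f \<subseteq> univ C \<and> x = rep (sort_of x) f \<and> (\<forall>a. x = Rl a \<longrightarrow> f = (\<lambda>_. a)))"

lemma repf:
  assumes "x \<in> Ceq L C"
  shows "range (repf x) \<subseteq> univ C" "x = rep (sort_of x) (repf x)" "x = Rl a \<Longrightarrow> repf x = (\<lambda>_. a)"
  using someI_ex[OF rep_ex[OF assms]] unfolding repf_def by auto

lemma edf_rdf:
  assumes "edf E P" "E \<subseteq> Ceq L C"
  shows "rdf ((\<lambda>(x, j). repf x j) ` (E \<times> UNIV)) (\<lambda>v. P (\<lambda>i. Rl (v i)))"
proof -
  obtain \<phi> e where \<phi>: "wf_eqfm L C \<phi>" "set e \<subseteq> E" "\<And>v. P v = sat_eq L C (pre e v) \<phi>"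
    using assms unfolding edf_def by blast
  let ?n = "length e"
  define s where "s i = (if i < ?n then sort_of (e ! i) else RealSort)" for i
  have "\<forall>i. wf_sort L C (s i)" using \<phi>(2) assms(2) wf_sort_of by (auto simp: s_def) (meson nth_mem subset_iff)
  from fdf_sat_eq[OF \<phi>(1) this] obtain \<chi> where \<chi>: "wf_fm L \<chi>"
    "\<And>v. range v \<subseteq> univ C \<Longrightarrow> sat_eq L C (\<lambda>i. rep (s i) (\<lambda>j. v (prod_encode (i, j)))) \<phi> = sat C v \<chi>"
    unfolding fdf_def by auto
  \<comment> \<open>Only coordinates below \<open>m\<close> occur in \<open>\<chi>\<close>. The list
    \<open>e'\<close> is a flattened matrix whose row \<open>i\<close> holds the first
    \<open>m\<close> coordinates of a representative of \<open>e ! i\<close>; \<open>g\<close>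
    translates codes into positions of this matrix, or into variables behind it.\<close>
  define m where "m = fresh ((\<lambda>p. snd (prod_decode p)) ` fv \<chi>)"
  define e' where "e' = map (\<lambda>q. repf (e ! (q div m)) (q mod m)) [0..<?n * m]"
  define g where "g p = (let (i, j) = prod_decode p in if i < ?n then i * m + j else ?n * m + (i - ?n))" for p
  have m0: "m > 0" by (simp add: m_def fresh_def)
  have eE: "e ! i \<in> E" if "i < ?n" for i using \<phi>(2) that by auto
  have "P (\<lambda>i. Rl (v i)) = sat C (pre e' v) (subst_fm \<chi> g)" if v: "range v \<subseteq> univ C" for v
  proof -
    define w where "w p = (let (i, j) = prod_decode p in if i < ?n then repf (e ! i) j else v (i - ?n))" for p
    have w: "range w \<subseteq> univ C"
      using v repf(1) eE assms(2) by (fastforce simp: w_def image_subset_iff split: prod.splits)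
    have "(\<lambda>i. rep (s i) (\<lambda>j. w (prod_encode (i, j)))) = pre e (\<lambda>i. Rl (v i))"
    proof
      fix i
      show "rep (s i) (\<lambda>j. w (prod_encode (i, j))) = pre e (\<lambda>i. Rl (v i)) i"
      proof (cases "i < ?n")
        case True
        then show ?thesis using repf(2)[of "e ! i"] eE[of i] assms(2) by (auto simp: s_def w_def pre_def)
      next
        case False
        then show ?thesis by (auto simp: s_def w_def pre_def rep_def)
      qed
    qed
    then have "P (\<lambda>i. Rl (v i)) = sat C w \<chi>" using \<chi>(2)[OF w] \<phi>(3) by simp
    also have "\<dots> = sat C (pre e' v \<circ> g) \<chi>"
    proof (rule sat_cong)
      fix p assume "p \<in> fv \<chi>"
      obtain i j where p: "prod_decode p = (i, j)" by fastforce
      have j: "j < m" using fresh_gt[of "(\<lambda>p. snd (prod_decode p)) ` fv \<chi>" j] \<open>p \<in> fv \<chi>\<close> p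
        by (force simp: m_def)
      show "w p = (pre e' v \<circ> g) p"
      proof (cases "i < ?n")
        case True
        have "i * m + j < i * m + m" using j by simp
        also have "\<dots> = Suc i * m" by simp
        also have "\<dots> \<le> ?n * m" using True by (intro mult_le_mono1) simp
        finally have "i * m + j < ?n * m" .
        then show ?thesis using True p j m0 by (simp add: w_def g_def pre_def e'_def)
      next
        case False
        have "pre e' v (length e' + (i - ?n)) = v (i - ?n)" by (rule pre_shift)
        then show ?thesis using p False by (simp add: w_def g_def e'_def)
      qed
    qed
    finally show ?thesis by (simp add: sat_subst_fm)
  qed
  moreover have "set e' \<subseteq> (\<lambda>(x, j). repf x j) ` (E \<times> UNIV)"
    using eE m0 by (auto simp: e'_def image_iff less_mult_imp_div_less)
  ultimately show ?thesis unfolding rdf_def using \<chi>(1)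
    by (intro exI[of _ "subst_fm \<chi> g"] exI[of _ e']) (simp add: wf_subst_fm)
qed

lemma rdf_fms:
  assumes "rdf A P"
    and dep: "\<And>v w. range v \<subseteq> univ C \<Longrightarrow> range w \<subseteq> univ C \<Longrightarrow> (\<forall>i<k. v i = w i) \<Longrightarrow> P v = P w"
  shows "\<exists>\<psi>\<in>fms_over L k A. \<forall>v. range v \<subseteq> univ C \<longrightarrow> (map v [0..<k] \<in> solset C k \<psi>) = P v"
proof -
  obtain \<chi> e where \<chi>: "wf_fm L \<chi>" "set e \<subseteq> A" "\<And>v. range v \<subseteq> univ C \<Longrightarrow> P v = sat C (pre e v) \<chi>"
    using assms unfolding rdf_def by blast
  let ?n = "length e"
  \<comment> \<open>As in \<open>edf_eqfm\<close>, a dummy quantifier binds all variables on which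
    \<open>P\<close> does not depend.\<close>
  define z where "z = k + ?n"
  define g where "g i = (if i < ?n then k + i else if i - ?n < k then i - ?n else z)" for i
  define \<delta> where "\<delta> = Exi z (subst_fm \<chi> g)"
  have "fv \<delta> \<subseteq> {..<k + ?n}"
    by (auto simp: \<delta>_def fv_subst_fm g_def z_def)
  moreover have "(map v [0..<k] \<in> solset C k (\<delta>, e)) = P v" if v: "range v \<subseteq> univ C" for v
  proof -
    have "sat C (((!) (map v [0..<k] @ e))(z := y) \<circ> g) \<chi> = P v" if "y \<in> univ C" for y
    proof -
      have "((!) (map v [0..<k] @ e))(z := y) \<circ> g = pre e (pre (map v [0..<k]) (\<lambda>_. y))"
        by (auto simp: fun_eq_iff pre_def g_def z_def nth_append)
      moreover have "range (pre (map v [0..<k]) (\<lambda>_. y)) \<subseteq> univ C"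
        using v that by (intro range_pre) auto
      moreover have "P v = P (pre (map v [0..<k]) (\<lambda>_. y))"
        by (rule dep) (use v calculation in \<open>auto simp: pre_def\<close>)
      ultimately show ?thesis using \<chi>(3) by simp
    qed
    moreover have "map v [0..<k] \<in> tuples (univ C) k" using v by (auto simp: tuples_def)
    ultimately show ?thesis using univ_ne by (auto simp: solset_def \<delta>_def sat_subst_fm)
  qed
  ultimately show ?thesis using \<chi>(1,2)
    by (intro bexI[of _ "(\<delta>, e)"]) (auto simp: \<delta>_def wf_subst_fm fms_over_def)
qed

end

section \<open>Algebraic closure\<close>

context eq_structure
begin

text \<open>\<open>Q\<close> is an unsorted predicate, so finiteness is asked within the sort of
  \<open>b\<close> only.\<close>

definition acl :: "('f, 'r, 'a) elt set \<Rightarrow> ('f, 'r, 'a) elt set" where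
  "acl E = {b \<in> Ceq L C. \<exists>Q. edf E (\<lambda>v. Q (v 0)) \<and> Q b \<and> finite {y \<in> SU (sort_of b). Q y}}"

lemma aclI: "b \<in> Ceq L C \<Longrightarrow> edf E (\<lambda>v. Q (v 0)) \<Longrightarrow> Q b \<Longrightarrow> finite {y \<in> SU (sort_of b). Q y} \<Longrightarrow> b \<in> acl E"
  by (auto simp: acl_def)

lemma acl_Ceq: "acl E \<subseteq> Ceq L C"
  by (auto simp: acl_def)

lemma acl_mono: "E \<subseteq> E' \<Longrightarrow> acl E \<subseteq> acl E'"
  unfolding acl_def using edf_mono by blast

lemma acl_refl: "b \<in> E \<Longrightarrow> b \<in> Ceq L C \<Longrightarrow> b \<in> acl E"
  by (rule aclI[where Q = "\<lambda>y. y = b"]) (auto intro!: edf_eq is_args)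

lemma acl_finite_support: "b \<in> acl E \<Longrightarrow> \<exists>e. set e \<subseteq> E \<and> b \<in> acl (set e)"
  unfolding acl_def edf_def by blast

text \<open>The number of solutions at \<open>a\<close> is built into the formula as a bound, which
  then holds at every tuple \<open>x\<close> that has a solution. Algebraicity of one element thus
  becomes a uniformly finite family, ready for transfer to other tuples and for
  \<open>k\<close>-inconsistency.\<close>

lemma acl_listD:
  assumes "b \<in> acl (E \<union> set a)" "length a = n"
  shows "\<exists>Q N. edf E (\<lambda>v. Q (map v [0..<Suc n])) \<and> Q (a @ [b]) \<and>
    (\<forall>x z. length x = n \<longrightarrow> Q (x @ [z]) \<longrightarrow> at_most N {y \<in> SU (sort_of b). Q (x @ [y])})"
proof -
  let ?s = "sort_of b"
  have b: "b \<in> Ceq L C" using assms acl_Ceq by blast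
  obtain Q0 where Q0: "edf (E \<union> set a) (\<lambda>v. Q0 (v 0))" "Q0 b" "finite {y \<in> SU ?s. Q0 y}"
    using assms unfolding acl_def by blast
  obtain P where P: "edf E P" "\<And>v. Q0 (v 0) = P (pre a v)"
    using edf_params[OF Q0(1)] by auto
  \<comment> \<open>\<open>P\<close> may look at any index; capping it at \<open>n\<close> makes the
    predicate read nothing beyond the \<open>Suc n\<close> entries of the list.\<close>
  define Q1 where "Q1 xs = P (\<lambda>i. xs ! min i n)" for xs
  have Q1: "Q1 (a @ [y]) = Q0 y" for y
  proof -
    have "(\<lambda>i. (a @ [y]) ! min i n) = pre a (\<lambda>_. y)"
      using assms(2) by (auto simp: fun_eq_iff nth_append pre_def min_def)
    then show ?thesis using P(2)[of "\<lambda>_. y"] by (simp add: Q1_def)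
  qed
  have eQ1: "edf E (\<lambda>v. Q1 (map v [0..<Suc n]))"
  proof -
    have "map v [0..<Suc n] ! min i n = v (min i n)" for v :: "nat \<Rightarrow> ('f, 'r, 'a) elt" and i
      by (subst nth_map) (auto simp del: upt_Suc)
    then show ?thesis using edf_ren[OF P(1), of "\<lambda>i. min i n"] by (simp add: Q1_def del: upt_Suc)
  qed
  define N where "N = card {y \<in> SU ?s. Q0 y}"
  define Q where "Q xs \<longleftrightarrow> Q1 xs \<and> at_most N {y \<in> SU ?s. Q1 (take n xs @ [y])}" for xs
  have "edf E (\<lambda>v. Q1 (map v [0..<Suc n]) \<and> at_most N {y \<in> SU ?s. Q1 (map v [0..<n] @ [y])})"
  proof (rule edf_conj[OF eQ1], rule edf_at_most[OF _ wf_sort_of[OF b]])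
    have "edf E (\<lambda>v. Q1 (map (\<lambda>t. t v) (map (\<lambda>i v. v (Suc i)) [0..<n] @ [\<lambda>v. v 0])))"
      by (rule edf_app[OF eQ1]) (auto intro: is_args)
    then show "edf E (\<lambda>v. Q1 (map (\<lambda>i. v (Suc i)) [0..<n] @ [v 0]))"
      by (simp add: comp_def)
  qed
  moreover have "take n (map v [0..<Suc n]) = map v [0..<n]" for v :: "nat \<Rightarrow> ('f, 'r, 'a) elt"
    by (simp add: take_map)
  ultimately have "edf E (\<lambda>v. Q (map v [0..<Suc n]))"
    by (simp add: Q_def del: upt_Suc)
  moreover have "Q (a @ [b])" using Q0 assms(2) by (simp add: Q_def Q1 at_most_def N_def)
  moreover have "at_most N {y \<in> SU ?s. Q (x @ [y])}" if "length x = n" "Q (x @ [z])" for x z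
    by (rule at_most_mono[of _ "{y \<in> SU ?s. Q1 (x @ [y])}"]) (use that in \<open>auto simp: Q_def\<close>)
  ultimately show ?thesis by blast
qed

lemma acl_insertD:
  assumes "b \<in> acl (insert a E)"
  shows "\<exists>R N. edf E (\<lambda>v. R (v 0) (v 1)) \<and> R a b \<and>
    (\<forall>x z. R x z \<longrightarrow> at_most N {y \<in> SU (sort_of b). R x y})"
proof -
  obtain Q N where Q: "edf E (\<lambda>v. Q (map v [0..<Suc 1]))" "Q ([a] @ [b])"
    "\<And>x z. length x = 1 \<Longrightarrow> Q (x @ [z]) \<Longrightarrow> at_most N {y \<in> SU (sort_of b). Q (x @ [y])}"
    using acl_listD[of b E "[a]" 1] assms by auto
  show ?thesis
  proof (intro exI conjI allI impI)
    show "edf E (\<lambda>v. Q [v 0, v 1])" using Q(1) by simp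
    show "Q [a, b]" using Q(2) by simp
    show "at_most N {y \<in> SU (sort_of b). Q [x, y]}" if "Q [x, z]" for x z
      using Q(3)[of "[x]" z] that by simp
  qed
qed

text \<open>By the uniform bound every fibre of \<open>R\<close> is finite, so the union of the
  fibres over the finitely many solutions of the formula for \<open>a\<close> is finite, and it
  contains \<open>b\<close>.\<close>

lemma acl_trans:
  assumes "b \<in> acl (insert a E)" "a \<in> acl E"
  shows "b \<in> acl E"
proof -
  obtain R N where R: "edf E (\<lambda>v. R (v 0) (v 1))" "R a b"
    "\<And>x z. R x z \<Longrightarrow> at_most N {y \<in> SU (sort_of b). R x y}"
    using acl_insertD[OF assms(1)] by blast
  obtain Q where Q: "edf E (\<lambda>v. Q (v 0))" "Q a" "finite {y \<in> SU (sort_of a). Q y}" and a: "a \<in> Ceq L C"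
    using assms(2) unfolding acl_def by blast
  have b: "b \<in> Ceq L C" using assms acl_Ceq by blast
  show ?thesis
  proof (rule aclI[where Q = "\<lambda>y. \<exists>x\<in>SU (sort_of a). Q x \<and> R x y", OF b])
    show "edf E (\<lambda>v. \<exists>x\<in>SU (sort_of a). Q x \<and> R x (v 0))"
      by (intro edf_ex edf_conj edf1[OF Q(1)] edf2[OF R(1)] wf_sort_of a is_args)
    show "\<exists>x\<in>SU (sort_of a). Q x \<and> R x b" using Q(2) R(2) in_SU[OF a] by blast
    have "{y \<in> SU (sort_of b). \<exists>x\<in>SU (sort_of a). Q x \<and> R x y} =
        (\<Union>x\<in>{y \<in> SU (sort_of a). Q y}. {y \<in> SU (sort_of b). R x y})" by blast
    moreover have "finite {y \<in> SU (sort_of b). R x y}" for x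
    proof (cases "\<exists>z. R x z")
      case True
      then show ?thesis using R(3) by (auto simp: at_most_def)
    next
      case False
      then have "{y \<in> SU (sort_of b). R x y} = {}" by blast
      then show ?thesis by (simp only: finite.emptyI)
    qed
    ultimately show "finite {y \<in> SU (sort_of b). \<exists>x\<in>SU (sort_of a). Q x \<and> R x y}"
      using Q(3) by simp
  qed
qed

lemma acl_closed:
  assumes "E' \<subseteq> acl E"
  shows "acl E' \<subseteq> acl E"
proof
  fix b assume "b \<in> acl E'"
  then obtain e where e: "set e \<subseteq> E'" "b \<in> acl (set e)" using acl_finite_support by blast
  have "b \<in> acl (E \<union> set e)" "set e \<subseteq> acl E" using e assms acl_mono[of "set e" "E \<union> set e"] by auto
  then show "b \<in> acl E"
  proof (induction e)
    case (Cons a e)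
    have "a \<in> acl (E \<union> set e)" using Cons.prems acl_mono[of E "E \<union> set e"] by auto
    moreover have "b \<in> acl (insert a (E \<union> set e))" using Cons.prems(1) by simp
    ultimately have "b \<in> acl (E \<union> set e)" by (rule acl_trans[rotated])
    then show ?case using Cons by simp
  qed simp
qed

lemma acl_insert_eq: "a \<in> acl E \<Longrightarrow> E \<subseteq> Ceq L C \<Longrightarrow> acl (insert a E) = acl E"
  by (intro equalityI acl_closed acl_mono) (auto intro: acl_refl)

end

section \<open>One side of an o-minimal order\<close>

text \<open>The order is kept abstract here, so that results on left endpoints can be used
  for the reversed order, too.\<close>

lemma finite_at_most_one:
  assumes "\<And>x y. x \<in> X \<Longrightarrow> y \<in> X \<Longrightarrow> x = y"
  shows "finite X"
proof (cases "X = {}")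
  case False
  then obtain x where "x \<in> X" by blast
  then have "X \<subseteq> {x}" using assms by blast
  then show ?thesis by (rule finite_subset) simp
qed simp

definition piece :: "'b set \<Rightarrow> ('b \<Rightarrow> 'b \<Rightarrow> bool) \<Rightarrow> 'b set \<Rightarrow> bool" where
  "piece X ls I \<longleftrightarrow> (\<exists>a\<in>X. I = {a}) \<or>
     (\<exists>l u. set_option l \<subseteq> X \<and> set_option u \<subseteq> X \<and>
        I = {x \<in> X. (\<forall>a. l = Some a \<longrightarrow> ls a x) \<and> (\<forall>b. u = Some b \<longrightarrow> ls x b)})"

locale order_side = eq_structure L C for L :: "('f, 'r) lang" and C :: "('f, 'r, 'a) struc" +
  fixes ls :: "('f, 'r, 'a) elt \<Rightarrow> ('f, 'r, 'a) elt \<Rightarrow> bool"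
  assumes irr: "x \<in> SU RealSort \<Longrightarrow> \<not> ls x x"
    and tr: "x \<in> SU RealSort \<Longrightarrow> y \<in> SU RealSort \<Longrightarrow> z \<in> SU RealSort \<Longrightarrow> ls x y \<Longrightarrow> ls y z \<Longrightarrow> ls x z"
    and tot: "x \<in> SU RealSort \<Longrightarrow> y \<in> SU RealSort \<Longrightarrow> ls x y \<or> x = y \<or> ls y x"
    and dense: "x \<in> SU RealSort \<Longrightarrow> y \<in> SU RealSort \<Longrightarrow> ls x y \<Longrightarrow> \<exists>z\<in>SU RealSort. ls x z \<and> ls z y"
    and lower: "x \<in> SU RealSort \<Longrightarrow> \<exists>y\<in>SU RealSort. ls y x"
    and edf_ls0: "edf {} (\<lambda>v. ls (v 0) (v 1))"
    and pieces: "edf E (\<lambda>v. Q (v 0)) \<Longrightarrow> E \<subseteq> Ceq L C \<Longrightarrow>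
      \<exists>F. finite F \<and> {x \<in> SU RealSort. Q x} = \<Union>F \<and>
        (\<forall>I\<in>F. piece (SU RealSort) ls I)"
begin

abbreviation "U \<equiv> SU RealSort"

lemma U_Ceq: "x \<in> U \<Longrightarrow> x \<in> Ceq L C" using SU_Ceq by blast

lemma edf_ls: "is_arg E s \<Longrightarrow> is_arg E t \<Longrightarrow> edf E (\<lambda>v. ls (s v) (t v))"
  by (rule edf2[OF edf_mono[OF edf_ls0]]) auto

section \<open>Intervals and infima in definable sets\<close>

lemma asym: "x \<in> U \<Longrightarrow> y \<in> U \<Longrightarrow> ls x y \<Longrightarrow> \<not> ls y x"
  using irr tr by blast

lemma le_less_trans: "x \<in> U \<Longrightarrow> y \<in> U \<Longrightarrow> z \<in> U \<Longrightarrow> \<not> ls y x \<Longrightarrow> ls y z \<Longrightarrow> ls x z"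
  using tr tot by blast

lemma less_le_trans: "x \<in> U \<Longrightarrow> y \<in> U \<Longrightarrow> z \<in> U \<Longrightarrow> ls x y \<Longrightarrow> \<not> ls z y \<Longrightarrow> ls x z"
  using tr tot by blast

lemma dense2: "z \<in> U \<Longrightarrow> b \<in> U \<Longrightarrow> t \<in> U \<Longrightarrow> ls z b \<Longrightarrow> ls z t \<Longrightarrow> \<exists>x\<in>U. ls z x \<and> ls x b \<and> ls x t"
  using tot[of b t] dense[of z b] dense[of z t] tr[of _ b t] tr[of _ t b] by blast

lemma infinite_interval:
  assumes "edf E (\<lambda>v. Q (v 0))" "E \<subseteq> Ceq L C" "infinite {x \<in> U. Q x}"
  shows "\<exists>a\<in>U. \<exists>b\<in>U. ls a b \<and> (\<forall>x\<in>U. ls a x \<longrightarrow> ls x b \<longrightarrow> Q x)"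
proof -
  obtain F where F: "finite F" "{x \<in> U. Q x} = \<Union>F"
    "\<And>I. I \<in> F \<Longrightarrow> piece U ls I"
    using pieces[OF assms(1,2)] by blast
  obtain I where I: "I \<in> F" "infinite I" using F(1,2) assms(3) finite_Union[of F] by metis
  obtain l u where lu: "set_option l \<subseteq> U" "set_option u \<subseteq> U"
    "I = {x \<in> U. (\<forall>a. l = Some a \<longrightarrow> ls a x) \<and> (\<forall>b. u = Some b \<longrightarrow> ls x b)}"
    using F(3)[OF I(1)] I(2) unfolding piece_def by auto
  obtain x where x: "x \<in> I" using I(2) by fastforce
  obtain y where y: "y \<in> I" "y \<noteq> x" using I(2)
  proof -
    have "\<not> I \<subseteq> {x}" using I(2) finite_subset by blast
    then show thesis using that by blast
  qed
  have *: "\<forall>z\<in>U. ls p z \<longrightarrow> ls z q \<longrightarrow> Q z" if "p \<in> I" "q \<in> I" for p q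
  proof (intro ballI impI)
    fix z assume z: "z \<in> U" "ls p z" "ls z q"
    have "z \<in> I" unfolding lu(3)
    proof (intro CollectI conjI allI impI)
      show "ls a z" if "l = Some a" for a
        using tr[of a p z] z \<open>p \<in> I\<close> that lu by auto
      show "ls z b" if "u = Some b" for b
        using tr[of z q b] z \<open>q \<in> I\<close> that lu by auto
    qed (rule z)
    then show "Q z" using F(2) I(1) by blast
  qed
  have "x \<in> U" "y \<in> U" using x y lu(3) by auto
  then show ?thesis using tot[of x y] *[OF x y(1)] *[OF y(1) x] y(2) by blast
qed

text \<open>The order need not be complete, but a nonempty piece is unbounded below or has its left
  end in \<open>U\<close>; for a union the smaller of two infima serves.\<close>

lemma glb_Union:
  assumes "finite F" "\<And>I. I \<in> F \<Longrightarrow> piece U ls I"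
  shows "\<Union>F = {} \<or> (\<forall>m\<in>U. \<exists>x\<in>\<Union>F. ls x m) \<or>
    (\<exists>z\<in>U. (\<forall>x\<in>\<Union>F. \<not> ls x z) \<and> (\<forall>z'\<in>U. ls z z' \<longrightarrow> (\<exists>x\<in>\<Union>F. ls x z')))"
  using assms
proof (induction F)
  case (insert I F)
  have pU: "piece U ls I \<Longrightarrow> I \<subseteq> U" for I by (auto simp: piece_def)
  have sub: "\<Union>F \<subseteq> U" using insert.prems pU by blast
  have I: "I = {} \<or> (\<forall>m\<in>U. \<exists>x\<in>I. ls x m) \<or>
    (\<exists>z\<in>U. (\<forall>x\<in>I. \<not> ls x z) \<and> (\<forall>z'\<in>U. ls z z' \<longrightarrow> (\<exists>x\<in>I. ls x z')))"
  proof (cases "\<exists>a\<in>U. I = {a}")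
    case True
    then show ?thesis using irr by auto
  next
    case False
    then obtain l u where lu: "set_option l \<subseteq> U" "set_option u \<subseteq> U"
      "I = {x \<in> U. (\<forall>a. l = Some a \<longrightarrow> ls a x) \<and> (\<forall>b. u = Some b \<longrightarrow> ls x b)}"
      using insert.prems[of I] unfolding piece_def by auto
    show ?thesis
    proof (cases "I = {}")
      case False
      then obtain x where x: "x \<in> I" by blast
      then have xU: "x \<in> U" using lu by auto
      show ?thesis
      proof (cases l)
        case None
        have "\<exists>y\<in>I. ls y m" if m: "m \<in> U" for m
        proof -
          obtain y where y: "y \<in> U" "ls y m" "ls y x"
            using tot[OF m xU] lower[OF m] lower[OF xU] tr[of _ m x] tr[of _ x m] m xU by blast
          then have "y \<in> I" using x lu None tr[of y x] xU by auto
          then show ?thesis using y by blast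
        qed
        then show ?thesis by blast
      next
        case (Some a)
        have aU: "a \<in> U" using lu Some by auto
        have "\<exists>y\<in>I. ls y z'" if z': "z' \<in> U" "ls a z'" for z'
        proof -
          have "ls a x" using x lu Some by auto
          then obtain y where y: "y \<in> U" "ls a y" "ls y z'" "ls y x"
            using dense2[OF aU z'(1) xU z'(2)] by blast
          then have "y \<in> I" using x lu Some tr[of y x] xU by auto
          then show ?thesis using y by blast
        qed
        moreover have "\<not> ls y a" if "y \<in> I" for y using that lu Some asym aU by auto
        ultimately show ?thesis using aU by blast
      qed
    qed simp
  qed
  have IU: "I \<subseteq> U" using insert.prems[of I] pU by blast
  have IH: "\<Union>F = {} \<or> (\<forall>m\<in>U. \<exists>x\<in>\<Union>F. ls x m) \<or>
    (\<exists>z\<in>U. (\<forall>x\<in>\<Union>F. \<not> ls x z) \<and> (\<forall>z'\<in>U. ls z z' \<longrightarrow> (\<exists>x\<in>\<Union>F. ls x z')))"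
    using insert by auto
  consider "I = {}" | "\<Union>F = {}" | "\<forall>m\<in>U. \<exists>x\<in>I \<union> \<Union>F. ls x m"
    | z1 z2 where "z1 \<in> U" "z2 \<in> U" "\<forall>x\<in>I. \<not> ls x z1" "\<forall>z'\<in>U. ls z1 z' \<longrightarrow> (\<exists>x\<in>I. ls x z')"
        "\<forall>x\<in>\<Union>F. \<not> ls x z2" "\<forall>z'\<in>U. ls z2 z' \<longrightarrow> (\<exists>x\<in>\<Union>F. ls x z')"
    using I IH by blast
  then show ?case
  proof cases
    case 1
    then show ?thesis using IH by simp
  next
    case 2
    then have "\<Union>(insert I F) = I" by blast
    then show ?thesis using I by simp
  next
    case 3
    then show ?thesis by simp
  next
    case 4
    show ?thesis
    proof (cases "ls z1 z2")
      case True
      have "\<not> ls x z1" if "x \<in> I \<union> \<Union>F" for x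
        using that 4 True tr[of x z1 z2] IU sub by blast
      then show ?thesis using 4 by (intro disjI2 bexI[of _ z1]) (simp, blast)
    next
      case False
      have "\<not> ls x z2" if "x \<in> I \<union> \<Union>F" for x
        using that 4 False less_le_trans[of x z2 z1] IU sub by blast
      then show ?thesis using 4 by (intro disjI2 bexI[of _ z2]) (simp, blast)
    qed
  qed
qed simp

lemma glb:
  assumes "edf E (\<lambda>v. W (v 0))" "E \<subseteq> Ceq L C" "w \<in> U" "W w" "m \<in> U" "\<And>x. x \<in> U \<Longrightarrow> W x \<Longrightarrow> \<not> ls x m"
  shows "\<exists>z\<in>U. (\<forall>x\<in>U. W x \<longrightarrow> \<not> ls x z) \<and> (\<forall>z'\<in>U. ls z z' \<longrightarrow> (\<exists>x\<in>U. W x \<and> ls x z'))"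
proof -
  obtain F where F: "finite F" "{x \<in> U. W x} = \<Union>F"
    "\<And>I. I \<in> F \<Longrightarrow> piece U ls I"
    using pieces[OF assms(1,2)] by blast
  have "\<Union>F = {} \<or> (\<forall>m\<in>U. \<exists>x\<in>\<Union>F. ls x m) \<or>
    (\<exists>z\<in>U. (\<forall>x\<in>\<Union>F. \<not> ls x z) \<and> (\<forall>z'\<in>U. ls z z' \<longrightarrow> (\<exists>x\<in>\<Union>F. ls x z')))"
    by (rule glb_Union[OF F(1)]) (rule F(3))
  then show ?thesis unfolding F(2)[symmetric]
  proof (elim disjE)
    assume "{x \<in> U. W x} = {}"
    then show ?thesis using assms(3,4) by blast
  next
    assume "\<forall>m\<in>U. \<exists>x\<in>{x \<in> U. W x}. ls x m"
    then show ?thesis using assms(5,6) by blast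
  qed blast
qed

text \<open>The points of \<open>Q\<close> that \<open>Q\<close> does not surround on the left form
  an \<open>E\<close>-definable set. If infinite, it would contain an interval, whose inner points
  are surrounded on the left. So it is finite, and its points are algebraic over
  \<open>E\<close>.\<close>

lemma generic_interval:
  assumes Q: "edf E (\<lambda>v. Q (v 0))" and E: "E \<subseteq> Ceq L C" and a: "a \<in> U" "Q a" "a \<notin> acl E"
  shows "\<exists>w\<in>U. ls w a \<and> (\<forall>x\<in>U. ls w x \<longrightarrow> ls x a \<longrightarrow> Q x)"
proof (rule ccontr)
  assume contra: "\<not> ?thesis"
  define N where "N x \<longleftrightarrow> Q x \<and> \<not> (\<exists>w\<in>U. ls w x \<and> (\<forall>x'\<in>U. ls w x' \<longrightarrow> ls x' x \<longrightarrow> Q x'))" for x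
  have N: "edf E (\<lambda>v. N (v 0))" unfolding N_def
    by (intro edf_conj edf_neg edf_exR edf_allR edf_imp edf_ls edf1[OF Q] is_args)
  have "N a" using contra a by (auto simp: N_def)
  then have "infinite {x \<in> U. N x}"
    using a aclI[OF U_Ceq[OF a(1)] N] sort_SU by fastforce
  from infinite_interval[OF N E this] obtain p q where pq: "p \<in> U" "q \<in> U" "ls p q"
    "\<And>x. x \<in> U \<Longrightarrow> ls p x \<Longrightarrow> ls x q \<Longrightarrow> N x" by blast
  obtain x where x: "x \<in> U" "ls p x" "ls x q" using dense pq by blast
  have "\<forall>x'\<in>U. ls p x' \<longrightarrow> ls x' x \<longrightarrow> Q x'"
    using pq x tr[of _ x q] by (auto simp: N_def)
  then show False using pq(4)[OF x] x pq(1) by (auto simp: N_def)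
qed

text \<open>\<open>t\<close> only marks the maximal interval from the right; it need not satisfy
  \<open>S\<close> itself.\<close>

definition left_end :: "(('f, 'r, 'a) elt \<Rightarrow> bool) \<Rightarrow> ('f, 'r, 'a) elt \<Rightarrow> ('f, 'r, 'a) elt \<Rightarrow> bool" where
  "left_end S z t \<longleftrightarrow> ls z t \<and> (\<forall>x\<in>U. ls z x \<longrightarrow> ls x t \<longrightarrow> S x) \<and>
     (\<forall>w\<in>U. ls w z \<longrightarrow> \<not> (\<forall>x\<in>U. ls w x \<longrightarrow> ls x t \<longrightarrow> S x))"

lemma left_end_unique:
  assumes "z \<in> U" "t \<in> U" "t' \<in> U" "left_end (\<lambda>x. R x y) z t" "left_end (\<lambda>x. R x y') z t'"
    and "\<And>x. x \<in> U \<Longrightarrow> R x y \<Longrightarrow> R x y' \<Longrightarrow> y = y'"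
  shows "y = y'"
proof -
  obtain x where "x \<in> U" "ls z x" "ls x t" "ls x t'"
    using dense2[of z t t'] assms by (auto simp: left_end_def)
  then show ?thesis using assms by (auto simp: left_end_def)
qed

text \<open>Otherwise left ends fill an interval, and two of them satisfy
  \<open>z1 < z2 < t1\<close>. The intervals that start there overlap, so functionality of
  \<open>R\<close> gives them the same value; together they form one interval reaching to the left
  of \<open>z2\<close>, against the maximality at \<open>z2\<close>.\<close>

lemma finite_left_ends:
  assumes e: "edf E (\<lambda>v. \<exists>y\<in>Y. \<exists>t\<in>U. left_end (\<lambda>x. R x y) (v 0) t)" and E: "E \<subseteq> Ceq L C"
    and fn: "\<And>x y y'. x \<in> U \<Longrightarrow> y \<in> Y \<Longrightarrow> y' \<in> Y \<Longrightarrow> R x y \<Longrightarrow> R x y' \<Longrightarrow> y = y'"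
  shows "finite {z \<in> U. \<exists>y\<in>Y. \<exists>t\<in>U. left_end (\<lambda>x. R x y) z t}"
proof (rule ccontr)
  assume "\<not> ?thesis"
  from infinite_interval[OF e E this] obtain a b where ab: "a \<in> U" "b \<in> U" "ls a b"
    "\<And>z. z \<in> U \<Longrightarrow> ls a z \<Longrightarrow> ls z b \<Longrightarrow> \<exists>y\<in>Y. \<exists>t\<in>U. left_end (\<lambda>x. R x y) z t" by blast
  obtain z1 where z1: "z1 \<in> U" "ls a z1" "ls z1 b" using dense ab by blast
  obtain y1 t1 where 1: "y1 \<in> Y" "t1 \<in> U" "left_end (\<lambda>x. R x y1) z1 t1" using ab(4)[OF z1] by blast
  obtain z2 where z2: "z2 \<in> U" "ls z1 z2" "ls z2 b" "ls z2 t1"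
    using dense2[of z1 b t1] z1 1 ab by (auto simp: left_end_def)
  have "ls a z2" using z2 z1 ab tr by blast
  then obtain y2 t2 where 2: "y2 \<in> Y" "t2 \<in> U" "left_end (\<lambda>x. R x y2) z2 t2" using ab(4) z2 by blast
  obtain x where x: "x \<in> U" "ls z2 x" "ls x t1" "ls x t2"
    using dense2[of z2 t1 t2] z2 1 2 by (auto simp: left_end_def)
  have "R x y1" using 1(3) x tr[of z1 z2 x] z1 z2 by (auto simp: left_end_def)
  moreover have "R x y2" using 2(3) x by (auto simp: left_end_def)
  ultimately have y: "y1 = y2" using fn x(1) 1 2 by blast
  have "R u y2" if u: "u \<in> U" "ls z1 u" "ls u t2" for u
  proof (cases "ls u t1")
    case True
    then show ?thesis using 1(3) u y by (auto simp: left_end_def)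
  next
    case False
    then have "ls z2 u" using less_le_trans[of z2 t1 u] z2 u 1 by blast
    then show ?thesis using 2(3) u by (auto simp: left_end_def)
  qed
  then show False using 2(3) z1 z2 by (auto simp: left_end_def)
qed

text \<open>The left end is the infimum of all \<open>w\<close> such that \<open>S\<close> holds
  between \<open>w\<close> and \<open>y\<close>. This set is definable over \<open>y\<close> and
  \<open>E\<close>, which is enough because only the existence of the infimum is claimed.\<close>

lemma left_end_ex:
  assumes S: "edf E (\<lambda>v. S (v 0))" and E: "E \<subseteq> Ceq L C" and y: "y \<in> U"
    and w: "w \<in> U" "ls w y" "\<And>x. x \<in> U \<Longrightarrow> ls w x \<Longrightarrow> ls x y \<Longrightarrow> S x"
  shows "(\<forall>x\<in>U. ls x y \<longrightarrow> S x) \<or> (\<exists>z\<in>U. left_end S z y)"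
proof -
  define W where "W w \<longleftrightarrow> ls w y \<and> (\<forall>x\<in>U. ls w x \<longrightarrow> ls x y \<longrightarrow> S x)" for w
  have "edf (insert y E) (\<lambda>v. W (v 0))" unfolding W_def
    by (intro edf_conj edf_allR edf_imp edf_ls edf1[OF edf_mono[OF S]] is_args) auto
  note g = glb[OF this _ w(1)]
  show ?thesis
  proof (cases "\<exists>m\<in>U. \<forall>x\<in>U. W x \<longrightarrow> \<not> ls x m")
    case True
    then obtain m where m: "m \<in> U" "\<And>x. x \<in> U \<Longrightarrow> W x \<Longrightarrow> \<not> ls x m" by blast
    have "W w" using w by (auto simp: W_def)
    moreover have "insert y E \<subseteq> Ceq L C" using E U_Ceq[OF y] by simp
    ultimately obtain z where z: "z \<in> U" "\<And>x. x \<in> U \<Longrightarrow> W x \<Longrightarrow> \<not> ls x z"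
        "\<And>z'. z' \<in> U \<Longrightarrow> ls z z' \<Longrightarrow> \<exists>x\<in>U. W x \<and> ls x z'"
      using g[OF _ _ m] by blast
    have "ls z y" using le_less_trans[of z w y] z(1,2) w y by (auto simp: W_def)
    moreover have "S x" if "x \<in> U" "ls z x" "ls x y" for x
      using z(3)[of x] that by (auto simp: W_def)
    moreover have "\<not> (\<forall>x\<in>U. ls w x \<longrightarrow> ls x y \<longrightarrow> S x)" if "w \<in> U" "ls w z" for w
      using z(2)[of w] that tr[of w z y] \<open>ls z y\<close> z(1) y by (auto simp: W_def)
    ultimately show ?thesis using z(1) by (auto simp: left_end_def)
  next
    case False
    then show ?thesis unfolding W_def by blast
  qed
qed

lemma finite_minimal:
  assumes "finite X" "X \<noteq> {}" "X \<subseteq> U"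
  shows "\<exists>m\<in>X. \<forall>x\<in>X. \<not> ls x m"
  using assms
proof (induction X rule: finite_ne_induct)
  case (singleton x)
  then show ?case using irr by auto
next
  case (insert x F)
  then obtain m where m: "m \<in> F" "\<forall>y\<in>F. \<not> ls y m" by auto
  show ?case
  proof (cases "ls x m")
    case True
    have "\<not> ls y x" if "y \<in> F" for y
      using that m True tr[of y x m] insert.prems by blast
    then show ?thesis using insert.prems irr by auto
  next
    case False
    then show ?thesis using m by auto
  qed
qed

text \<open>The least element of a finite definable subset of the line is definable. Either it is
  \<open>b\<close>, or it is removed and the argument is repeated with a smaller set.\<close>

lemma dcl_eq_acl:
  assumes "b \<in> U" "b \<in> acl E"
  shows "\<exists>Q. edf E (\<lambda>v. Q (v 0)) \<and> {y \<in> U. Q y} = {b}"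
proof -
  obtain Q where Q: "edf E (\<lambda>v. Q (v 0))" "Q b" "finite {y \<in> U. Q y}"
    using assms sort_SU unfolding acl_def by force
  then show ?thesis
  proof (induction "card {y \<in> U. Q y}" arbitrary: Q rule: less_induct)
    case less
    note eQ = edf1[OF less.prems(1)]
    show ?case
    proof (cases "\<exists>z\<in>U. ls z b \<and> Q z")
      case False
      let ?Q = "\<lambda>y. Q y \<and> (\<forall>z\<in>U. Q z \<longrightarrow> \<not> ls z y)"
      have "edf E (\<lambda>v. ?Q (v 0))"
        by (intro edf_conj edf_allR edf_imp edf_neg edf_ls eQ is_args)
      moreover have "{y \<in> U. ?Q y} = {b}"
      proof (intro equalityI subsetI)
        fix y assume y: "y \<in> {y \<in> U. ?Q y}"
        then have "\<not> ls b y" "\<not> ls y b" using False less.prems(2) assms(1) by auto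
        then show "y \<in> {b}" using tot[of y b] y assms(1) by auto
      qed (use False less.prems(2) assms(1) in auto)
      ultimately show ?thesis by (intro exI[of _ ?Q] conjI)
    next
      case True
      let ?Q = "\<lambda>y. Q y \<and> (\<exists>z\<in>U. ls z y \<and> Q z)"
      obtain m where m: "m \<in> U" "Q m" "\<forall>x\<in>{y \<in> U. Q y}. \<not> ls x m"
        using finite_minimal[OF less.prems(3)] less.prems(2) assms(1) by blast
      then have sub: "{y \<in> U. ?Q y} \<subset> {y \<in> U. Q y}" by blast
      note c = psubset_card_mono[OF less.prems(3) sub]
      have f: "finite {y \<in> U. ?Q y}" using sub less.prems(3) finite_subset by blast
      have e: "edf E (\<lambda>v. ?Q (v 0))"
        by (intro edf_conj edf_exR edf_ls eQ is_args)
      have "?Q b" using True less.prems(2) by blast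
      from less.hyps[OF c e this f] show ?thesis .
    qed
  qed
qed

lemma edf_left_end:
  assumes "edf E (\<lambda>v. R (v 0) (v 1))" "is_arg E s" "is_arg E t" "is_arg E u"
  shows "edf E (\<lambda>v. left_end (\<lambda>x. R x (s v)) (t v) (u v))"
proof -
  have "edf E (\<lambda>v. left_end (\<lambda>x. R x (v 0)) (v 1) (v 2))"
    unfolding left_end_def
    by (intro edf_conj edf_allR edf_imp edf_neg edf_ls edf2[OF assms(1)] is_args)
  from edf_pre[OF this, of "[s, t, u]"] assms(2-) show ?thesis by simp
qed

text \<open>If \<open>b = f(a)\<close> and \<open>a\<close> is not algebraic over \<open>b\<close>, then \<open>f\<close> takes the value \<open>b\<close> on an
  interval ending at \<open>a\<close>. The maximal intervals on which \<open>f\<close> is constant have only finitely many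
  left endpoints, so \<open>b\<close> is one of finitely many values.\<close>

lemma exchange:
  assumes E: "E \<subseteq> Ceq L C" and a: "a \<in> U" and b: "b \<in> U"
    and ba: "b \<in> acl (insert a E)" and ab: "a \<notin> acl (insert b E)"
  shows "b \<in> acl E"
proof -
  obtain Q0 where Q0: "edf (insert a E) (\<lambda>v. Q0 (v 0))" "{y \<in> U. Q0 y} = {b}"
    using dcl_eq_acl[OF b ba] by blast
  obtain P where P: "edf E P" "\<And>v. Q0 (v 0) = P (case_nat a v)"
    using edf_params_insert[OF Q0(1)] by blast
  define R0 where "R0 x y = P (case_nat x (\<lambda>_. y))" for x y
  have R0a: "R0 a y = Q0 y" for y using P(2)[of "\<lambda>_. y"] by (simp add: R0_def)
  have R0: "edf E (\<lambda>v. R0 (v 0) (v 1))"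
  proof -
    have "(\<lambda>i. v (case i of 0 \<Rightarrow> 0 | Suc _ \<Rightarrow> 1)) = case_nat (v 0) (\<lambda>_. v 1)" for v :: "nat \<Rightarrow> ('f, 'r, 'a) elt"
      by (auto split: nat.splits)
    then show ?thesis using edf_ren[OF P(1), of "\<lambda>i. case i of 0 \<Rightarrow> 0 | Suc _ \<Rightarrow> 1"] by (simp add: R0_def)
  qed
  \<comment> \<open>\<open>R0\<close> gives a unique value at \<open>a\<close> but perhaps not
    elsewhere; \<open>R\<close> restricts it to points with exactly one value and so is the graph of
    a partial function.\<close>
  define R where "R x y \<longleftrightarrow> R0 x y \<and> (\<forall>y'\<in>U. R0 x y' \<longrightarrow> y' = y)" for x y
  have R: "edf E (\<lambda>v. R (v 0) (v 1))" unfolding R_def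
    by (intro edf_conj edf_allR edf_imp edf_eq edf2[OF R0] is_args)
  have fn: "y = y'" if "y \<in> U" "y' \<in> U" "R x y" "R x y'" for x y y'
    using that unfolding R_def by blast
  have Rab: "R a b" using Q0(2) b by (auto simp: R_def R0a)
  have S: "edf (insert b E) (\<lambda>v. R (v 0) b)"
    by (rule edf2[OF edf_mono[OF R]]) (auto intro: is_args)
  have bE: "insert b E \<subseteq> Ceq L C" using E U_Ceq[OF b] by auto
  obtain w where w: "w \<in> U" "ls w a" "\<And>x. x \<in> U \<Longrightarrow> ls w x \<Longrightarrow> ls x a \<Longrightarrow> R x b"
    using generic_interval[OF S bE a Rab ab] by blast
  have lb: "(\<forall>x\<in>U. ls x a \<longrightarrow> R x b) \<or> (\<exists>z\<in>U. left_end (\<lambda>x. R x b) z a)"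
    by (rule left_end_ex[OF S bE a w])
  \<comment> \<open>The first disjunct covers intervals of constancy that are unbounded to the left
    and so have no left end. Any two of them overlap, so at most one value arises in this
    way.\<close>
  define T where "T y \<longleftrightarrow> (\<exists>t\<in>U. (\<forall>x\<in>U. ls x t \<longrightarrow> R x y)) \<or> (\<exists>z\<in>U. \<exists>t\<in>U. left_end (\<lambda>x. R x y) z t)" for y
  have "edf E (\<lambda>v. T (v 0))" unfolding T_def
    by (intro edf_disj edf_allR edf_exR edf_imp edf_ls edf2[OF R] edf_left_end[OF R] is_args)
  moreover have "T b" using lb a by (auto simp: T_def)
  moreover have "finite {y \<in> U. T y}"
  proof -
    let ?Z = "{z \<in> U. \<exists>y\<in>U. \<exists>t\<in>U. left_end (\<lambda>x. R x y) z t}"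
    have Z: "finite ?Z"
      by (rule finite_left_ends[OF _ E fn])
        (intro edf_exR edf_left_end[OF R] is_args)
    let ?Y1 = "{y \<in> U. \<exists>t\<in>U. (\<forall>x\<in>U. ls x t \<longrightarrow> R x y)}"
    have "y = y'" if yy: "y \<in> ?Y1" "y' \<in> ?Y1" for y y'
    proof -
      obtain t where "t \<in> U" "\<forall>x\<in>U. ls x t \<longrightarrow> R x y" using yy(1) by auto
      moreover obtain t' where "t' \<in> U" "\<forall>x\<in>U. ls x t' \<longrightarrow> R x y'" using yy(2) by auto
      ultimately have t: "t \<in> U" "\<forall>x\<in>U. ls x t \<longrightarrow> R x y" "t' \<in> U" "\<forall>x\<in>U. ls x t' \<longrightarrow> R x y'"
        by auto
      obtain x where "x \<in> U" "ls x t" "ls x t'"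
        using tot[OF t(1,3)] lower[OF t(1)] lower[OF t(3)] tr[of _ t t'] tr[of _ t' t] t by blast
      then show ?thesis using t fn yy by blast
    qed
    then have Y1: "finite ?Y1" by (rule finite_at_most_one)
    let ?Y2 = "{y \<in> U. \<exists>z\<in>U. \<exists>t\<in>U. left_end (\<lambda>x. R x y) z t}"
    \<comment> \<open>A left end determines the value taken next to it, by
      \<open>left_end_unique\<close>; hence there are no more such values than left ends.\<close>
    define h where "h z = (SOME y. y \<in> U \<and> (\<exists>t\<in>U. left_end (\<lambda>x. R x y) z t))" for z
    have h: "h z \<in> U \<and> (\<exists>t\<in>U. left_end (\<lambda>x. R x (h z)) z t)" if "z \<in> ?Z" for z
      unfolding h_def by (rule someI_ex) (use that in blast)
    have "?Y2 \<subseteq> h ` ?Z"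
    proof
      fix y assume "y \<in> ?Y2"
      then obtain z t where zt: "y \<in> U" "z \<in> U" "t \<in> U" "left_end (\<lambda>x. R x y) z t" by blast
      then have "z \<in> ?Z" by blast
      moreover obtain t' where "t' \<in> U" "left_end (\<lambda>x. R x (h z)) z t'" using h[OF calculation] by blast
      ultimately have "y = h z" using left_end_unique[of z t t' R y "h z"] zt h fn by blast
      then show "y \<in> h ` ?Z" using \<open>z \<in> ?Z\<close> by blast
    qed
    then have "finite ?Y2" using Z finite_surj by blast
    moreover have "{y \<in> U. T y} \<subseteq> ?Y1 \<union> ?Y2" by (auto simp: T_def)
    ultimately show ?thesis using Y1 finite_subset by blast
  qed
  ultimately show ?thesis using aclI[OF U_Ceq[OF b], of E T] sort_SU[OF b] by simp
qed

text \<open>The left endpoint of the component around \<open>y\<close> of the fibre over \<open>b\<close> is algebraic both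
  over \<open>b\<close> and over \<open>y\<close>, hence over \<open>F\<close> by exchange.\<close>

lemma left_bound:
  assumes F: "F \<subseteq> Ceq L C" and y: "y \<in> U" and b: "b \<in> Ceq L C"
    and R: "edf F (\<lambda>v. R (v 0) (v 1))" "R y b"
    and yb: "y \<notin> acl (insert b F)" and by_: "b \<in> acl (insert y F)"
  shows "\<exists>G B. G \<subseteq> acl F \<and> edf G (\<lambda>v. B (v 0)) \<and> B y \<and> (\<forall>x\<in>U. ls x y \<longrightarrow> B x \<longrightarrow> R x b)"
proof -
  have S: "edf (insert b F) (\<lambda>v. R (v 0) b)"
    by (rule edf2[OF edf_mono[OF R(1)]]) (auto intro: is_args)
  have bF: "insert b F \<subseteq> Ceq L C" using F b by auto
  obtain w where w: "w \<in> U" "ls w y" "\<And>x. x \<in> U \<Longrightarrow> ls w x \<Longrightarrow> ls x y \<Longrightarrow> R x b"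
    using generic_interval[OF S bF y R(2) yb] by blast
  from left_end_ex[OF S bF y w] show ?thesis
  proof
    assume "\<forall>x\<in>U. ls x y \<longrightarrow> R x b"
    then show ?thesis by (intro exI[of _ "{}"] exI[of _ "\<lambda>_. True"]) (auto intro: edf_True)
  next
    assume "\<exists>z\<in>U. left_end (\<lambda>x. R x b) z y"
    then obtain z where z: "z \<in> U" "left_end (\<lambda>x. R x b) z y" by blast
    \<comment> \<open>Quantifying over the singleton \<open>{b}\<close> brings a single fibre into
      the form of \<open>finite_left_ends\<close>, whose functionality condition becomes
      trivial.\<close>
    let ?Z = "\<lambda>z. \<exists>y\<in>{b}. \<exists>t\<in>U. left_end (\<lambda>x. R x y) z t"
    have "edf (insert b F) (\<lambda>v. \<exists>t\<in>U. left_end (\<lambda>x. R x b) (v 0) t)"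
      by (intro edf_exR edf_left_end[OF edf_mono[OF R(1)]] is_args) auto
    then have eZ: "edf (insert b F) (\<lambda>v. ?Z (v 0))" by simp
    have "finite {z \<in> U. ?Z z}"
      by (rule finite_left_ends[OF eZ bF]) auto
    then have zb: "z \<in> acl (insert b F)"
      using aclI[OF U_Ceq[OF z(1)] eZ] z y sort_SU[OF z(1)] by auto
    have zy: "z \<in> acl (insert y F)"
    proof (rule acl_trans[OF _ by_])
      show "z \<in> acl (insert b (insert y F))" using zb acl_mono[of "insert b F" "insert b (insert y F)"] by auto
    qed
    have "y \<notin> acl (insert z F)"
    proof
      assume "y \<in> acl (insert z F)"
      then have "y \<in> acl (insert z (insert b F))" using acl_mono[of "insert z F" "insert z (insert b F)"] by auto
      then show False using acl_trans[OF _ zb] yb by blast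
    qed
    from exchange[OF F y z(1) zy this] have "{z} \<subseteq> acl F" by simp
    moreover have "edf {z} (\<lambda>v. ls z (v 0))" by (intro edf_ls is_args) auto
    moreover have "ls z y" "\<forall>x\<in>U. ls x y \<longrightarrow> ls z x \<longrightarrow> R x b" using z(2) by (auto simp: left_end_def)
    ultimately show ?thesis by (intro exI[of _ "{z}"] exI[of _ "ls z"]) auto
  qed
qed

end

section \<open>The monster model of an o-minimal theory\<close>

lemma piece_converse: "piece X ls I \<Longrightarrow> piece X (\<lambda>x y. ls y x) I"
  unfolding piece_def by blast

locale o_minimal_monster = eq_structure L C for L :: "('f, 'r) lang" and C :: "('f, 'r, 'a) struc" +
  fixes lt :: 'r
  assumes om: "o_minimal L lt C"
    and big: "|{\<phi>. wf_fm L \<phi>}| <o |univ C|"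
    and sat: "saturated L C"
begin

abbreviation "U \<equiv> SU RealSort"

section \<open>The order on the real elements and its reversal\<close>

definition lte :: "('f, 'r, 'a) elt \<Rightarrow> ('f, 'r, 'a) elt \<Rightarrow> bool" where
  "lte x y \<longleftrightarrow> (\<exists>a b. x = Rl a \<and> y = Rl b \<and> less_in C lt a b)"

lemma lte_Rl [simp]: "lte (Rl a) (Rl b) = less_in C lt a b"
  by (auto simp: lte_def)

lemma dlo: "dense_linear_order_no_endpoints C lt"
  using om by (simp add: o_minimal_def)

lemma dlo_irr: "\<forall>x\<in>univ C. \<not> less_in C lt x x"
  and dlo_tr: "\<forall>x\<in>univ C. \<forall>y\<in>univ C. \<forall>z\<in>univ C. less_in C lt x y \<longrightarrow> less_in C lt y z \<longrightarrow> less_in C lt x z"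
  and dlo_tot: "\<forall>x\<in>univ C. \<forall>y\<in>univ C. less_in C lt x y \<or> x = y \<or> less_in C lt y x"
  and dlo_dense: "\<forall>x\<in>univ C. \<forall>y\<in>univ C. less_in C lt x y \<longrightarrow> (\<exists>z\<in>univ C. less_in C lt x z \<and> less_in C lt z y)"
  and dlo_lower: "\<forall>x\<in>univ C. \<exists>y\<in>univ C. less_in C lt y x"
  and dlo_upper: "\<forall>x\<in>univ C. \<exists>y\<in>univ C. less_in C lt x y"
  using dlo unfolding dense_linear_order_no_endpoints_def by (elim conjE, blast)+

lemma edf_lte: "edf {} (\<lambda>v. lte (v 0) (v 1))"
proof -
  have "wf_eqfm L C (Base (Pred lt [Var 0, Var 1]))" using om by (simp add: o_minimal_def)
  from edf_sat[OF this, of "{}"]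
  have "edf {} (\<lambda>v. sat_eq L C v (Base (Pred lt [Var 0, Var 1])))" .
  moreover have "sat_eq L C v (Base (Pred lt [Var 0, Var 1])) = lte (v 0) (v 1)" for v
    by (cases "v 0"; cases "v 1") (auto simp: lte_def less_in_def)
  ultimately show ?thesis by (simp only:)
qed

lemma repf_univ: "E \<subseteq> Ceq L C \<Longrightarrow> (\<lambda>(x, j). repf x j) ` (E \<times> UNIV) \<subseteq> univ C"
  using repf(1) by (auto simp: image_subset_iff subset_iff)

lemma edf_fms1:
  assumes "edf E (\<lambda>v. Q (v 0))" "E \<subseteq> Ceq L C"
  shows "\<exists>\<psi>\<in>fms_over L 1 ((\<lambda>(x, j). repf x j) ` (E \<times> UNIV)).
    \<forall>a\<in>univ C. [a] \<in> solset C 1 \<psi> \<longleftrightarrow> Q (Rl a)"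
proof -
  obtain \<psi> where \<psi>: "\<psi> \<in> fms_over L 1 ((\<lambda>(x, j). repf x j) ` (E \<times> UNIV))"
    "\<And>v. range v \<subseteq> univ C \<Longrightarrow> (map v [0..<1] \<in> solset C 1 \<psi>) = Q (Rl (v 0))"
    using rdf_fms[OF edf_rdf[OF assms], of 1] by auto
  have "[a] \<in> solset C 1 \<psi> \<longleftrightarrow> Q (Rl a)" if "a \<in> univ C" for a
    using \<psi>(2)[of "\<lambda>_. a"] that by auto
  then show ?thesis using \<psi>(1) by blast
qed

lemma edf_pieces:
  assumes "edf E (\<lambda>v. Q (v 0))" "E \<subseteq> Ceq L C"
  shows "\<exists>F. finite F \<and> {x \<in> U. Q x} = \<Union>F \<and> (\<forall>I\<in>F. piece U lte I)"
proof -
  obtain \<psi> where \<psi>: "\<psi> \<in> fms_over L 1 ((\<lambda>(x, j). repf x j) ` (E \<times> UNIV))"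
    "\<And>a. a \<in> univ C \<Longrightarrow> [a] \<in> solset C 1 \<psi> \<longleftrightarrow> Q (Rl a)"
    using edf_fms1[OF assms] by blast
  have "definable_over L C (univ C) 1 (solset C 1 \<psi>)"
    using \<psi>(1) repf_univ[OF assms(2)] unfolding definable_over_def fms_over_def by fastforce
  then obtain F where F: "finite F" "\<And>I. I \<in> F \<Longrightarrow> point_or_interval C lt I" "{x. [x] \<in> solset C 1 \<psi>} = \<Union>F"
    using om unfolding o_minimal_def by meson
  have "{x. [x] \<in> solset C 1 \<psi>} \<subseteq> univ C" by (auto simp: solset_def tuples_def)
  then have "{x \<in> U. Q x} = Rl ` {x. [x] \<in> solset C 1 \<psi>}" using \<psi>(2) by (auto simp: SU_Real)
  then have "{x \<in> U. Q x} = \<Union>((`) Rl ` F)" unfolding F(3) by blast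
  moreover have "piece U lte (Rl ` I)" if I: "I \<in> F" for I
  proof -
    consider a where "a \<in> univ C" "I = {a}" | l u where "set_option l \<subseteq> univ C" "set_option u \<subseteq> univ C" "I = interval C lt l u"
      using F(2)[OF I] unfolding point_or_interval_def by blast
    then show ?thesis
    proof cases
      case 1
      then show ?thesis by (auto simp: piece_def SU_Real)
    next
      case 2
      have "Rl ` I = {x \<in> U. (\<forall>a. map_option Rl l = Some a \<longrightarrow> lte a x) \<and> (\<forall>b. map_option Rl u = Some b \<longrightarrow> lte x b)}"
        unfolding 2 by (auto simp: interval_def SU_Real)
      moreover have "set_option (map_option Rl l) \<subseteq> U" "set_option (map_option Rl u) \<subseteq> U"
        using 2 by (auto simp: SU_Real)
      ultimately show ?thesis unfolding piece_def by blast
    qed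
  qed
  ultimately show ?thesis using F(1) by (intro exI[of _ "(`) Rl ` F"]) auto
qed

sublocale lft: order_side L C lte
proof unfold_locales
  show "\<not> lte x x" if "x \<in> U" for x
    using that dlo_irr by (auto simp: SU_Real)
  show "lte x z" if "x \<in> U" "y \<in> U" "z \<in> U" "lte x y" "lte y z" for x y z
    using that unfolding SU_Real by (elim imageE, hypsubst) (unfold lte_Rl, rule dlo_tr[rule_format])
  show "lte x y \<or> x = y \<or> lte y x" if "x \<in> U" "y \<in> U" for x y
    using that dlo_tot unfolding SU_Real by (elim imageE, hypsubst) (unfold lte_Rl, blast)
  show "\<exists>z\<in>U. lte x z \<and> lte z y" if "x \<in> U" "y \<in> U" "lte x y" for x y
    using that dlo_dense unfolding SU_Real by auto
  show "\<exists>y\<in>U. lte y x" if "x \<in> U" for x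
    using that dlo_lower unfolding SU_Real by auto
qed (rule edf_lte, rule edf_pieces)

sublocale rgt: order_side L C "\<lambda>x y. lte y x"
proof unfold_locales
  show "\<exists>z\<in>U. lte z x \<and> lte y z" if "x \<in> U" "y \<in> U" "lte y x" for x y
    using lft.dense[of y x] that by blast
  show "\<exists>y\<in>U. lte x y" if "x \<in> U" for x
    using that dlo_upper unfolding SU_Real by auto
  show "edf {} (\<lambda>v. lte (v 1) (v 0))"
    by (rule lft.edf_ls) (rule is_args)+
  show "\<exists>F. finite F \<and> {x \<in> U. Q x} = \<Union>F \<and> (\<forall>I\<in>F. piece U (\<lambda>x y. lte y x) I)"
    if E: "edf E (\<lambda>v. Q (v 0))" "E \<subseteq> Ceq L C" for E Q
  proof -
    obtain F where F: "finite F" "{x \<in> U. Q x} = \<Union>F" "\<forall>I\<in>F. piece U lte I"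
      using edf_pieces[OF E] by blast
    have "\<forall>I\<in>F. piece U (\<lambda>x y. lte y x) I"
      by (rule ballI, rule piece_converse, rule bspec[OF F(3)])
    with F(1,2) show ?thesis by (intro exI[of _ F] conjI)
  qed
qed (use lft.irr lft.tr lft.tot in blast)+

lemma U_Ceq: "x \<in> U \<Longrightarrow> x \<in> Ceq L C"
  by (rule lft.U_Ceq)

text \<open>Here \<open>b\<close> may be imaginary: by the bounds on both sides, the component around \<open>y\<close> of the
  fibre over \<open>b\<close> contains \<open>y\<close> and is definable over algebraic elements, and only finitely many
  fibres through \<open>y\<close> contain it.\<close>

theorem exchange:
  assumes F: "F \<subseteq> Ceq L C" and y: "y \<in> U" and b: "b \<in> acl (insert y F)" and nb: "b \<notin> acl F"
  shows "y \<in> acl (insert b F)"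
proof (rule ccontr)
  assume ny: "y \<notin> acl (insert b F)"
  have bC: "b \<in> Ceq L C" using b acl_Ceq by blast
  obtain R N where R: "edf F (\<lambda>v. R (v 0) (v 1))" "R y b"
    "\<And>x z. R x z \<Longrightarrow> at_most N {y \<in> SU (sort_of b). R x y}"
    using acl_insertD[OF b] by blast
  obtain G1 B1 where 1: "G1 \<subseteq> acl F" "edf G1 (\<lambda>v. B1 (v 0))" "B1 y" "\<And>x. x \<in> U \<Longrightarrow> lte x y \<Longrightarrow> B1 x \<Longrightarrow> R x b"
    using lft.left_bound[OF F y bC R(1,2) ny b] by blast
  obtain G2 B2 where 2: "G2 \<subseteq> acl F" "edf G2 (\<lambda>v. B2 (v 0))" "B2 y" "\<And>x. x \<in> U \<Longrightarrow> lte y x \<Longrightarrow> B2 x \<Longrightarrow> R x b"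
    using rgt.left_bound[OF F y bC R(1,2) ny b] by blast
  let ?E = "F \<union> G1 \<union> G2"
  have E: "?E \<subseteq> acl F" using 1(1) 2(1) F acl_refl by blast
  have e1: "edf ?E (\<lambda>v. B1 (v 0))" and e2: "edf ?E (\<lambda>v. B2 (v 0))" and e3: "edf ?E (\<lambda>v. R (v 0) (v 1))"
    by (rule edf_mono[OF 1(2)], blast, rule edf_mono[OF 2(2)], blast, rule edf_mono[OF R(1)], blast)
  have "b \<in> acl ?E"
  proof (rule aclI[where Q = "\<lambda>z. \<forall>x\<in>U. B1 x \<longrightarrow> B2 x \<longrightarrow> R x z", OF bC])
    show "edf ?E (\<lambda>v. \<forall>x\<in>U. B1 x \<longrightarrow> B2 x \<longrightarrow> R x (v 0))"
      by (intro edf_allR edf_imp edf1[OF e1] edf1[OF e2] edf2[OF e3] is_args)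
    show "\<forall>x\<in>U. B1 x \<longrightarrow> B2 x \<longrightarrow> R x b" using lft.tot[OF _ y] 1(4) 2(4) R(2) by blast
    show "finite {z \<in> SU (sort_of b). \<forall>x\<in>U. B1 x \<longrightarrow> B2 x \<longrightarrow> R x z}"
      by (rule finite_subset[of _ "{z \<in> SU (sort_of b). R y z}"])
        (use 1(3) 2(3) y R(3)[OF R(2)] in \<open>auto simp: at_most_def\<close>)
  qed
  then show False using acl_closed[OF E] nb by blast
qed

section \<open>Rank\<close>

primrec rk :: "('f, 'r, 'a) elt set \<Rightarrow> ('f, 'r, 'a) elt list \<Rightarrow> nat" where
  "rk E [] = 0"
| "rk E (x # xs) = (if x \<in> acl E then 0 else 1) + rk (insert x E) xs"

lemma rk_mono: "E \<subseteq> E' \<Longrightarrow> rk E' xs \<le> rk E xs"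
proof (induction xs arbitrary: E E')
  case (Cons x xs)
  have "rk (insert x E') xs \<le> rk (insert x E) xs" by (rule Cons.IH) (use Cons.prems in auto)
  then show ?case using acl_mono[OF Cons.prems] by auto
qed simp

lemma rk_le_length: "rk E xs \<le> length xs"
  by (induction xs arbitrary: E) (auto simp: le_SucI)

lemma rk_append: "rk E (xs @ ys) = rk E xs + rk (E \<union> set xs) ys"
  by (induction xs arbitrary: E) auto

lemma rk_subset: "set xs \<subseteq> E \<Longrightarrow> E \<subseteq> Ceq L C \<Longrightarrow> rk E xs = 0"
proof (induction xs arbitrary: E)
  case (Cons x xs)
  then show ?case using acl_refl[of x E] by (auto simp: subset_iff insert_absorb)
qed simp

text \<open>At the first coordinate \<open>y\<close> that makes \<open>b\<close> algebraic, exchange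
  makes \<open>y\<close> algebraic over \<open>b\<close>, so this coordinate stops counting. All
  other coordinates can only lose by monotonicity.\<close>

lemma rk_algebraic_strict:
  assumes "F \<subseteq> Ceq L C" "set xs \<subseteq> U" "b \<in> acl (F \<union> set xs)" "b \<notin> acl F"
  shows "rk (insert b F) xs < rk F xs"
  using assms
proof (induction xs arbitrary: F)
  case (Cons y xs)
  have yU: "y \<in> U" using Cons.prems by simp
  show ?case
  proof (cases "b \<in> acl (insert y F)")
    case True
    then have "y \<in> acl (insert b F)" using exchange[OF Cons.prems(1) yU] Cons.prems(4) by blast
    moreover have "y \<notin> acl F" using acl_trans True Cons.prems(4) by blast
    moreover have "rk (insert y (insert b F)) xs \<le> rk (insert y F) xs" by (rule rk_mono) blast
    ultimately show ?thesis by simp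
  next
    case False
    have "rk (insert b (insert y F)) xs < rk (insert y F) xs"
      by (rule Cons.IH) (use Cons.prems False U_Ceq[OF yU] in auto)
    moreover have "acl F \<subseteq> acl (insert b F)" by (rule acl_mono) blast
    ultimately show ?thesis by (auto simp: insert_commute)
  qed
qed simp

text \<open>If \<open>b\<close> made a new coordinate \<open>y\<close> algebraic, exchange with
  \<open>b\<close> as the real point would make \<open>b\<close> algebraic over \<open>y\<close>.
  This is why \<open>b\<close> has to be real here, in contrast to
  \<open>rk_algebraic_strict\<close>.\<close>

lemma rk_independent:
  assumes "F \<subseteq> Ceq L C" "b \<in> U" "set xs \<subseteq> U" "b \<notin> acl (F \<union> set xs)"
  shows "rk (insert b F) xs = rk F xs"
  using assms
proof (induction xs arbitrary: F)
  case (Cons y xs)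
  have yU: "y \<in> U" using Cons.prems by simp
  have IH: "rk (insert b (insert y F)) xs = rk (insert y F) xs"
    by (rule Cons.IH) (use Cons.prems U_Ceq[OF yU] in auto)
  have "y \<in> acl F" if "y \<in> acl (insert b F)"
  proof (rule ccontr)
    assume "y \<notin> acl F"
    from exchange[OF Cons.prems(1,2) that this] have "b \<in> acl (insert y F)" .
    then show False using Cons.prems(4) acl_mono[of "insert y F" "F \<union> set (y # xs)"] by auto
  qed
  moreover have "acl F \<subseteq> acl (insert b F)" by (rule acl_mono) blast
  ultimately show ?case using IH by (auto simp: insert_commute)
qed simp

lemma rk_acl:
  assumes "E \<subseteq> Ceq L C" "set xs \<subseteq> Ceq L C" "b \<in> acl E"
  shows "rk (insert b E) xs = rk E xs"
  using assms
proof (induction xs arbitrary: E)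
  case (Cons y xs)
  have "rk (insert b (insert y E)) xs = rk (insert y E) xs"
    by (rule Cons.IH) (use Cons.prems acl_mono[of E "insert y E"] in auto)
  then show ?case using acl_insert_eq[OF Cons.prems(3,1)] by (simp add: insert_commute)
qed simp

text \<open>As soon as some coordinate \<open>y\<close> becomes algebraic through \<open>x\<close>,
  exchange makes \<open>x\<close> algebraic over \<open>y\<close>, and the later coordinates lose
  nothing more.\<close>

lemma rk_insert_ge:
  assumes "E \<subseteq> Ceq L C" "set ys \<subseteq> U" "x \<in> U"
  shows "rk E ys \<le> (if x \<in> acl E then 0 else 1) + rk (insert x E) ys"
  using assms
proof (induction ys arbitrary: E)
  case (Cons y ys)
  have yU: "y \<in> U" using Cons.prems by simp
  have IH: "rk (insert y E) ys \<le> (if x \<in> acl (insert y E) then 0 else 1) + rk (insert x (insert y E)) ys"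
    by (rule Cons.IH) (use Cons.prems U_Ceq[OF yU] in auto)
  have "acl E \<subseteq> acl (insert x E)" "acl E \<subseteq> acl (insert y E)" by (rule acl_mono, blast)+
  moreover have "x \<in> acl (insert y E)" "x \<notin> acl E" if "y \<in> acl (insert x E)" "y \<notin> acl E"
    using exchange[OF Cons.prems(1,3) that] that acl_trans by blast+
  ultimately show ?case using IH by (auto simp: insert_commute split: if_splits)
qed simp

lemma rk_nths:
  assumes "E \<subseteq> Ceq L C" "set xs \<subseteq> U"
  shows "rk E (nths xs I) \<le> rk E xs"
  using assms
proof (induction xs arbitrary: E I)
  case (Cons x xs)
  have xU: "x \<in> U" using Cons.prems by simp
  let ?ys = "nths xs {j. Suc j \<in> I}"
  have IH: "rk (insert x E) ?ys \<le> rk (insert x E) xs"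
    by (rule Cons.IH) (use Cons.prems U_Ceq[OF xU] in auto)
  moreover have "rk E ?ys \<le> (if x \<in> acl E then 0 else 1) + rk (insert x E) ?ys"
    by (rule rk_insert_ge) (use Cons.prems set_nths_subset[of xs] in auto)
  ultimately show ?case by (auto simp: nths_Cons)
qed simp

text \<open>Supplies the parameter for one step of the thorn-rank: the first coordinate that counts
  is adjoined to \<open>E\<close>.\<close>

lemma rk_pick:
  assumes "Suc n \<le> rk E xs"
  shows "\<exists>y\<in>set xs. y \<notin> acl E \<and> n \<le> rk (insert y E) xs"
  using assms
proof (induction xs arbitrary: E)
  case (Cons x xs)
  show ?case
  proof (cases "x \<in> acl E")
    case True
    then obtain z where z: "z \<in> set xs" "z \<notin> acl (insert x E)" "n \<le> rk (insert z (insert x E)) xs"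
      using Cons.IH[of "insert x E"] Cons.prems by auto
    then have "z \<notin> acl E" using acl_mono[of E "insert x E"] by blast
    then show ?thesis using z by (intro bexI[of _ z]) (auto simp: insert_commute)
  next
    case False
    then show ?thesis using Cons.prems by auto
  qed
qed simp

text \<open>When the entries of \<open>bs\<close> are adjoined one at a time, the rank drops at some
  first \<open>b\<close>; by \<open>rk_independent\<close> and \<open>rk_acl\<close> this
  \<open>b\<close> is algebraic with the help of \<open>xs\<close> but not without it. The entries
  adjoined before form \<open>c\<close>.\<close>

lemma rk_drop_witness:
  assumes "A \<subseteq> Ceq L C" "set bs \<subseteq> U" "set xs \<subseteq> U" "rk (A \<union> set bs) xs < rk A xs"
  shows "\<exists>c b. set c \<subseteq> set bs \<and> b \<in> set bs \<and> b \<in> acl (A \<union> set c \<union> set xs) \<and> b \<notin> acl (A \<union> set c)"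
  using assms
proof (induction bs arbitrary: A)
  case (Cons b bs)
  have bU: "b \<in> U" using Cons.prems by simp
  have xC: "set xs \<subseteq> Ceq L C" using Cons.prems(3) U_Ceq by blast
  show ?case
  proof (cases "rk (insert b A) xs = rk A xs")
    case True
    then have "\<exists>c d. set c \<subseteq> set bs \<and> d \<in> set bs \<and> d \<in> acl (insert b A \<union> set c \<union> set xs) \<and> d \<notin> acl (insert b A \<union> set c)"
      by (intro Cons.IH) (use Cons.prems U_Ceq[OF bU] in auto)
    then obtain c d where "set c \<subseteq> set bs" "d \<in> set bs" "d \<in> acl (insert b A \<union> set c \<union> set xs)" "d \<notin> acl (insert b A \<union> set c)"
      by blast
    then show ?thesis by (intro exI[of _ "b # c"] exI[of _ d]) auto
  next
    case False
    then have "b \<in> acl (A \<union> set xs)" "b \<notin> acl A"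
      using rk_independent[OF Cons.prems(1) bU Cons.prems(3)] rk_acl[OF Cons.prems(1) xC] by blast+
    then show ?thesis by (intro exI[of _ "[]"] exI[of _ b]) auto
  qed
qed simp

section \<open>Saturation\<close>

lemma finite_ordLess_infinite_card: "finite A \<Longrightarrow> infinite B \<Longrightarrow> |A| <o |B|"
  by (rule finite_ordLess_infinite) (auto simp: card_of_well_order_on Field_card_of)

lemma infinite_univ: "infinite (univ C)" and nat_less_univ: "|UNIV :: nat set| <o |univ C|"
proof -
  have "inj (\<lambda>i. Eq (Var i) (Var i) :: ('f, 'r) fm)" by (auto intro: injI)
  moreover have "range (\<lambda>i. Eq (Var i) (Var i) :: ('f, 'r) fm) \<subseteq> {\<phi>. wf_fm L \<phi>}" by auto
  ultimately have "|UNIV :: nat set| \<le>o |{\<phi>. wf_fm L \<phi>}|" using card_of_ordLeqI by blast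
  then show *: "|UNIV :: nat set| <o |univ C|" using big ordLeq_ordLess_trans by blast
  have "|univ C| <o |UNIV :: nat set|" if "finite (univ C)"
    by (rule finite_ordLess_infinite_card[OF that]) simp
  then show "infinite (univ C)" using * ordLess_irreflexive ordLess_transitive by blast
qed

section \<open>Small sets\<close>

lemma small_Un: "small C A \<Longrightarrow> small C B \<Longrightarrow> small C (A \<union> B)"
  unfolding small_def using card_of_Un_ordLess_infinite infinite_univ by blast

lemma small_finite: "finite A \<Longrightarrow> small C A"
  unfolding small_def using finite_ordLess_infinite_card infinite_univ by blast

lemma small_insert: "small C A \<Longrightarrow> small C (insert a A)"
  using small_Un[OF small_finite[of "{a}"], of A] by simp

lemma small_subset: "small C B \<Longrightarrow> A \<subseteq> B \<Longrightarrow> small C A"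
  unfolding small_def using card_of_mono1 ordLeq_ordLess_trans by blast

lemma small_image: "small C A \<Longrightarrow> small C (f ` A)"
  unfolding small_def using card_of_image ordLeq_ordLess_trans by blast

lemma small_repf: "small C E \<Longrightarrow> small C ((\<lambda>(x, j). repf x j) ` (E \<times> (UNIV :: nat set)))"
proof (rule small_image)
  \<comment> \<open>\<open>E\<close> may be finite; the infinite sum bounds the product in every
    case and is still smaller than \<open>univ C\<close>.\<close>
  let ?S = "E <+> (UNIV :: nat set)"
  assume "small C E"
  then have S: "|?S| <o |univ C|"
    unfolding small_def using card_of_Plus_ordLess_infinite infinite_univ nat_less_univ by blast
  have "infinite ?S" by (simp add: finite_Plus_iff)
  then have "|E \<times> (UNIV :: nat set)| \<le>o |?S|"
    by (rule card_of_Sigma_ordLeq_infinite) (auto intro: card_of_Plus1 card_of_Plus2)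
  then show "small C (E \<times> (UNIV :: nat set))" unfolding small_def using S by (rule ordLeq_ordLess_trans)
qed

section \<open>Saturation in variables of arbitrary sorts over imaginary parameters\<close>

definition compact_sorts :: "('f, 'r) esort list \<Rightarrow> bool" where
  "compact_sorts \<sigma> \<longleftrightarrow> (\<forall>E \<Q>. E \<subseteq> Ceq L C \<longrightarrow> small C E \<longrightarrow>
     (\<forall>Q\<in>\<Q>. edf E (\<lambda>v. Q (map v [0..<length \<sigma>]))) \<longrightarrow>
     (\<forall>F\<subseteq>\<Q>. finite F \<longrightarrow> (\<exists>x\<in>eq_tuples L C \<sigma>. \<forall>Q\<in>F. Q x)) \<longrightarrow>
     (\<exists>x\<in>eq_tuples L C \<sigma>. \<forall>Q\<in>\<Q>. Q x))"

lemma csatD: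
  assumes "compact_sorts \<sigma>" "E \<subseteq> Ceq L C" "small C E"
    and "\<And>Q. Q \<in> \<Q> \<Longrightarrow> edf E (\<lambda>v. Q (map v [0..<length \<sigma>]))"
    and "\<And>F. F \<subseteq> \<Q> \<Longrightarrow> finite F \<Longrightarrow> \<exists>x\<in>eq_tuples L C \<sigma>. \<forall>Q\<in>F. Q x"
  shows "\<exists>x\<in>eq_tuples L C \<sigma>. \<forall>Q\<in>\<Q>. Q x"
  using assms unfolding compact_sorts_def by blast

lemma eq_tuples_single: "x \<in> eq_tuples L C [s] \<longleftrightarrow> (\<exists>y\<in>SU s. x = [y])"
  by (auto simp: eq_tuples_def SU_def)

lemma compact_sorts_Nil: "compact_sorts []"
  unfolding compact_sorts_def
proof (intro allI impI)
  fix E and \<Q> :: "(('f, 'r, 'a) elt list \<Rightarrow> bool) set"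
  assume *: "\<forall>F\<subseteq>\<Q>. finite F \<longrightarrow> (\<exists>x\<in>eq_tuples L C []. \<forall>Q\<in>F. Q x)"
  have "Q []" if "Q \<in> \<Q>" for Q
    using *[rule_format, of "{Q}"] that by simp
  then show "\<exists>x\<in>eq_tuples L C []. \<forall>Q\<in>\<Q>. Q x" by (intro bexI[of _ "[]"] ballI) simp_all
qed

lemma compact_sorts_Real: "compact_sorts [RealSort]"
  unfolding compact_sorts_def
proof (intro allI impI)
  fix E and \<Q> :: "(('f, 'r, 'a) elt list \<Rightarrow> bool) set"
  assume E: "E \<subseteq> Ceq L C" "small C E" and e: "\<forall>Q\<in>\<Q>. edf E (\<lambda>v. Q (map v [0..<length [RealSort]]))"
    and fs: "\<forall>F\<subseteq>\<Q>. finite F \<longrightarrow> (\<exists>x\<in>eq_tuples L C [RealSort]. \<forall>Q\<in>F. Q x)"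
  let ?A = "(\<lambda>(x, j). repf x j) ` (E \<times> (UNIV :: nat set))"
  have "\<exists>\<psi>. \<psi> \<in> fms_over L 1 ?A \<and> (\<forall>a\<in>univ C. [a] \<in> solset C 1 \<psi> \<longleftrightarrow> Q [Rl a])" if "Q \<in> \<Q>" for Q
  proof -
    have "edf E (\<lambda>v. Q [v 0])" using e that by simp
    from edf_fms1[where Q = "\<lambda>x. Q [x]", OF this E(1)] show ?thesis by blast
  qed
  then obtain h where h: "\<And>Q. Q \<in> \<Q> \<Longrightarrow> h Q \<in> fms_over L 1 ?A"
    "\<And>Q a. Q \<in> \<Q> \<Longrightarrow> a \<in> univ C \<Longrightarrow> [a] \<in> solset C 1 (h Q) \<longleftrightarrow> Q [Rl a]" by metis
  have fin: "\<exists>x\<in>tuples (univ C) 1. \<forall>\<psi>\<in>F. x \<in> solset C 1 \<psi>" if F: "F \<subseteq> h ` \<Q>" "finite F" for F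
  proof -
    obtain F' where F': "F' \<subseteq> \<Q>" "finite F'" "F = h ` F'" using finite_subset_image[OF F(2,1)] by blast
    then obtain x where "x \<in> eq_tuples L C [RealSort]" "\<forall>Q\<in>F'. Q x" using fs by blast
    then obtain a where a: "a \<in> univ C" "\<forall>Q\<in>F'. Q [Rl a]" by (auto simp: eq_tuples_single SU_Real)
    have "[a] \<in> solset C 1 (h Q)" if "Q \<in> F'" for Q
      using h(2)[of Q a] F'(1) a that by blast
    moreover have "[a] \<in> tuples (univ C) 1" using a by (simp add: tuples_def)
    ultimately show ?thesis unfolding F'(3) by blast
  qed
  have "\<exists>x\<in>tuples (univ C) 1. \<forall>\<psi>\<in>h ` \<Q>. x \<in> solset C 1 \<psi>"
  proof (rule sat[unfolded saturated_def, rule_format, OF repf_univ[OF E(1)] small_repf[OF E(2)]])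
    show "h ` \<Q> \<subseteq> fms_over L 1 ?A" using h(1) by blast
  qed (rule fin)
  then obtain x where x: "x \<in> tuples (univ C) 1" "\<forall>\<psi>\<in>h ` \<Q>. x \<in> solset C 1 \<psi>" by blast
  then obtain a where a: "x = [a]" "a \<in> univ C" by (auto simp: tuples_def length_Suc_conv)
  have "Q [Rl a]" if "Q \<in> \<Q>" for Q using h(2)[OF that a(2)] x(2) that a(1) by blast
  then show "\<exists>x\<in>eq_tuples L C [RealSort]. \<forall>Q\<in>\<Q>. Q x"
    using a by (intro bexI[of _ "[Rl a]"]) (auto simp: eq_tuples_single SU_Real)
qed

text \<open>The first coordinate realizes, for every finite \<open>F\<close>, the formula saying
  that the tuple can be completed to satisfy \<open>F\<close>. With this coordinate fixed as a
  parameter, the conditions on the others are finitely satisfiable.\<close>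

lemma compact_sorts_Cons:
  assumes "compact_sorts [s]" "compact_sorts \<sigma>" and wf: "list_all (wf_sort L C) \<sigma>"
  shows "compact_sorts (s # \<sigma>)"
  unfolding compact_sorts_def
proof (intro allI impI)
  fix E and \<Q> :: "(('f, 'r, 'a) elt list \<Rightarrow> bool) set"
  assume E: "E \<subseteq> Ceq L C" "small C E" and e: "\<forall>Q\<in>\<Q>. edf E (\<lambda>v. Q (map v [0..<length (s # \<sigma>)]))"
    and fs: "\<forall>F\<subseteq>\<Q>. finite F \<longrightarrow> (\<exists>x\<in>eq_tuples L C (s # \<sigma>). \<forall>Q\<in>F. Q x)"
  let ?n = "length \<sigma>"
  define g where "g F xs \<longleftrightarrow> (\<exists>ys\<in>eq_tuples L C \<sigma>. \<forall>Q\<in>F. Q (hd xs # ys))"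
    for F :: "(('f, 'r, 'a) elt list \<Rightarrow> bool) set" and xs
  let ?D = "{F. F \<subseteq> \<Q> \<and> finite F}"
  have "\<exists>x\<in>eq_tuples L C [s]. \<forall>Q\<in>g ` ?D. Q x"
  proof (rule csatD[OF assms(1) E])
    fix G assume "G \<in> g ` ?D"
    then obtain F where F: "F \<subseteq> \<Q>" "finite F" "G = g F" by blast
    have "edf E (\<lambda>v. \<exists>ys\<in>eq_tuples L C \<sigma>. \<forall>Q\<in>F. Q (v 0 # ys))"
    proof (rule edf_exl[OF _ wf], rule edf_ball[OF F(2)])
      fix Q assume "Q \<in> F"
      then have "edf E (\<lambda>v. Q (map v [0..<Suc ?n]))" using e F by auto
      from edf_app[OF this, of "(\<lambda>v. v ?n) # map (\<lambda>i v. v i) [0..<?n]"]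
      show "edf E (\<lambda>v. Q (v (0 + ?n) # map v [0..<?n]))" by (auto simp: is_args comp_def)
    qed
    then show "edf E (\<lambda>v. G (map v [0..<length [s]]))" by (simp add: F g_def)
  next
    fix H assume "H \<subseteq> g ` ?D" "finite H"
    then obtain D where D: "D \<subseteq> ?D" "finite D" "H = g ` D" using finite_subset_image by meson
    then have "\<Union>D \<subseteq> \<Q>" "finite (\<Union>D)" by auto
    then obtain x where x: "x \<in> eq_tuples L C (s # \<sigma>)" "\<forall>Q\<in>\<Union>D. Q x" using fs by blast
    then obtain y ys where xy: "x = y # ys" by (cases x) (auto simp: eq_tuples_def)
    have "\<forall>Q\<in>H. Q [y]" using x D(3) by (auto simp: g_def xy eq_tuples_Cons)
    then show "\<exists>x\<in>eq_tuples L C [s]. \<forall>Q\<in>H. Q x" using x(1) by (auto simp: xy eq_tuples_Cons eq_tuples_single)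
  qed
  then obtain a where a: "a \<in> SU s" "\<And>F. F \<subseteq> \<Q> \<Longrightarrow> finite F \<Longrightarrow> g F [a]"
    by (auto simp: eq_tuples_single)
  let ?h = "\<lambda>Q ys. Q (a # ys)"
  have aE: "insert a E \<subseteq> Ceq L C" using E a SU_Ceq by blast
  have "\<exists>x\<in>eq_tuples L C \<sigma>. \<forall>Q\<in>?h ` \<Q>. Q x"
  proof (rule csatD[OF assms(2) aE small_insert[OF E(2)]])
    fix G assume "G \<in> ?h ` \<Q>"
    then obtain Q where Q: "Q \<in> \<Q>" "G = ?h Q" by blast
    then have "edf (insert a E) (\<lambda>v. Q (map v [0..<Suc ?n]))" using e edf_mono[of E _ "insert a E"] by auto
    from edf_app[OF this, of "(\<lambda>v. a) # map (\<lambda>i v. v i) [0..<?n]"]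
    show "edf (insert a E) (\<lambda>v. G (map v [0..<?n]))" by (auto simp: is_args comp_def Q)
  next
    fix H assume "H \<subseteq> ?h ` \<Q>" "finite H"
    then obtain F where F: "F \<subseteq> \<Q>" "finite F" "H = ?h ` F" using finite_subset_image by meson
    then show "\<exists>x\<in>eq_tuples L C \<sigma>. \<forall>Q\<in>H. Q x" using a(2)[OF F(1,2)] by (auto simp: g_def)
  qed
  then obtain ys where "ys \<in> eq_tuples L C \<sigma>" "\<forall>Q\<in>\<Q>. Q (a # ys)" by auto
  then show "\<exists>x\<in>eq_tuples L C (s # \<sigma>). \<forall>Q\<in>\<Q>. Q x"
    using a(1) by (intro bexI[of _ "a # ys"]) (auto simp: eq_tuples_Cons)
qed

lemma compact_sorts_reals: "compact_sorts (replicate n RealSort)"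
  by (induction n) (auto simp: compact_sorts_Nil list_all_iff intro: compact_sorts_Cons compact_sorts_Real)

lemma eq_tuples_reals: "x \<in> eq_tuples L C (replicate n RealSort) \<longleftrightarrow> length x = n \<and> set x \<subseteq> U"
proof -
  have "map sort_of x = replicate n RealSort \<longleftrightarrow> length x = n \<and> (\<forall>y\<in>set x. sort_of y = RealSort)"
    by (auto simp: list_eq_iff_nth_eq all_set_conv_all_nth)
  then show ?thesis by (auto simp: eq_tuples_def SU_def)
qed

text \<open>A class is found through a representative: \<open>Q'\<close> pulls \<open>Q\<close> back
  along the projection to classes, and a real tuple realizing all pullbacks exists by
  \<open>compact_sorts_reals\<close>.\<close>

lemma compact_sorts_sort:
  assumes "wf_sort L C s"
  shows "compact_sorts [s]"
proof (cases s)
  case RealSort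
  then show ?thesis using compact_sorts_Real by simp
next
  case (ImagSort \<epsilon> n)
  then have eq: "equiv_fm L C \<epsilon> n" using assms by simp
  let ?cl = "\<lambda>zs :: ('f, 'r, 'a) elt list. Img \<epsilon> n (eclass C \<epsilon> n (map the_real zs))"
  define Q' where "Q' Q zs \<longleftrightarrow> (\<exists>y\<in>SU s. ((\<forall>z\<in>set zs. sort_of z = RealSort) \<and> y = ?cl zs) \<and> Q [y])"
    for Q :: "('f, 'r, 'a) elt list \<Rightarrow> bool" and zs :: "('f, 'r, 'a) elt list"
  show ?thesis unfolding compact_sorts_def
  proof (intro allI impI)
    fix E and \<Q> :: "(('f, 'r, 'a) elt list \<Rightarrow> bool) set"
    assume E: "E \<subseteq> Ceq L C" "small C E" and e: "\<forall>Q\<in>\<Q>. edf E (\<lambda>v. Q (map v [0..<length [s]]))"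
      and fs: "\<forall>F\<subseteq>\<Q>. finite F \<longrightarrow> (\<exists>x\<in>eq_tuples L C [s]. \<forall>Q\<in>F. Q x)"
    have "\<exists>x\<in>eq_tuples L C (replicate n RealSort). \<forall>Q\<in>Q' ` \<Q>. Q x"
    proof (rule csatD[OF compact_sorts_reals E])
      fix G assume "G \<in> Q' ` \<Q>"
      then obtain Q where Q: "Q \<in> \<Q>" "G = Q' Q" by blast
      have eQ: "edf E (\<lambda>v. Q [v 0])" using e Q by simp
      have "wf_eqfm L C (Proj \<epsilon> n (map Suc [0..<n]) 0)" using eq by simp
      from edf_sat[OF this, of E] have
        p: "edf E (\<lambda>v. (\<forall>z\<in>set (map (\<lambda>i. v (Suc i)) [0..<n]). sort_of z = RealSort) \<and> v 0 = ?cl (map (\<lambda>i. v (Suc i)) [0..<n]))"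
        by (simp add: comp_def del: image_Suc_atLeastLessThan)
      show "edf E (\<lambda>v. G (map v [0..<length (replicate n RealSort)]))"
        unfolding Q Q'_def length_replicate
        by (intro edf_ex edf_conj[OF p] edf1[where R = "\<lambda>y. Q [y]", OF eQ] is_args assms)
    next
      fix H assume "H \<subseteq> Q' ` \<Q>" "finite H"
      then obtain F where F: "F \<subseteq> \<Q>" "finite F" "H = Q' ` F" using finite_subset_image by meson
      obtain xs where xs: "xs \<in> eq_tuples L C [s]" "\<forall>Q\<in>F. Q xs" using fs[rule_format, OF F(1,2)] by (rule bexE)
      then obtain y where y: "y \<in> SU s" "xs = [y]" unfolding eq_tuples_single by (elim bexE)
      then obtain x where x: "x \<in> tuples (univ C) n" "y = Img \<epsilon> n (eclass C \<epsilon> n x)"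
        by (auto simp: ImagSort SU_def Ceq_def)
      let ?x = "map Rl x :: ('f, 'r, 'a) elt list"
      have "map the_real ?x = x" by (simp add: comp_def)
      then have "?cl ?x = y" using x by (simp only:)
      moreover have "\<forall>z\<in>set ?x. sort_of z = RealSort" by simp
      ultimately have "Q' Q ?x" if "Q \<in> F" for Q
        unfolding Q'_def using bspec[OF xs(2) that] y by (intro bexI[of _ y]) simp_all
      then have "\<forall>Q\<in>H. Q ?x" unfolding F by simp
      then show "\<exists>x\<in>eq_tuples L C (replicate n RealSort). \<forall>Q\<in>H. Q x"
        using x by (intro bexI[of _ ?x]) (auto simp: eq_tuples_reals SU_Real tuples_def)
    qed
    then obtain x where x: "length x = n" "set x \<subseteq> U" "\<forall>Q\<in>\<Q>. Q' Q x" by (auto simp: eq_tuples_reals)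
    have "set (map the_real x) \<subseteq> univ C" using x by (auto simp: SU_Real)
    then have "map the_real x \<in> tuples (univ C) n" using x by (simp add: tuples_def)
    then have "?cl x \<in> SU s" using eq unfolding ImagSort SU_def Ceq_def by auto
    moreover have "\<forall>Q\<in>\<Q>. Q [?cl x]" using x(3) by (auto simp: Q'_def)
    ultimately show "\<exists>x\<in>eq_tuples L C [s]. \<forall>Q\<in>\<Q>. Q x" by (auto simp: eq_tuples_single)
  qed
qed

lemma compact_sorts1:
  assumes "wf_sort L C s" "E \<subseteq> Ceq L C" "small C E"
    and e: "\<And>Q. Q \<in> \<Q> \<Longrightarrow> edf E (\<lambda>v. Q (v 0))"
    and fs: "\<And>F. F \<subseteq> \<Q> \<Longrightarrow> finite F \<Longrightarrow> \<exists>x\<in>SU s. \<forall>Q\<in>F. Q x"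
  shows "\<exists>x\<in>SU s. \<forall>Q\<in>\<Q>. Q x"
proof -
  let ?h = "\<lambda>Q xs. Q (hd xs)"
  have "\<exists>x\<in>eq_tuples L C [s]. \<forall>Q\<in>?h ` \<Q>. Q x"
  proof (rule csatD[OF compact_sorts_sort[OF assms(1)] assms(2,3)])
    fix G assume "G \<in> ?h ` \<Q>"
    then show "edf E (\<lambda>v. G (map v [0..<length [s]]))" using e by auto
  next
    fix H assume "H \<subseteq> ?h ` \<Q>" "finite H"
    then obtain F where F: "F \<subseteq> \<Q>" "finite F" "H = ?h ` F" using finite_subset_image by meson
    obtain x where "x \<in> SU s" "\<forall>Q\<in>F. Q x" using fs[OF F(1,2)] by blast
    then show "\<exists>x\<in>eq_tuples L C [s]. \<forall>Q\<in>H. Q x"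
      unfolding F(3) by (intro bexI[of _ "[x]"]) (simp_all add: eq_tuples_single)
  qed
  then obtain xs where xs: "xs \<in> eq_tuples L C [s]" "\<forall>Q\<in>?h ` \<Q>. Q xs" by (rule bexE)
  then obtain y where y: "y \<in> SU s" "xs = [y]" unfolding eq_tuples_single by (elim bexE)
  have "Q y" if "Q \<in> \<Q>" for Q
    using bspec[OF xs(2) imageI[OF that]] y(2) by simp
  then show ?thesis using y(1) by (intro bexI[of _ y] ballI)
qed

text \<open>The negations of all formulas over \<open>E\<close> with finitely many solutions are
  added to the conditions; finitely many of them exclude only finitely many points of an infinite
  set.\<close>

lemma generic_point:
  assumes "wf_sort L C s" "E \<subseteq> Ceq L C" "small C E"
    and e: "\<And>Q. Q \<in> \<Q> \<Longrightarrow> edf E (\<lambda>v. Q (v 0))"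
    and inf: "\<And>F. F \<subseteq> \<Q> \<Longrightarrow> finite F \<Longrightarrow> infinite {x \<in> SU s. \<forall>Q\<in>F. Q x}"
  shows "\<exists>x\<in>SU s. x \<notin> acl E \<and> (\<forall>Q\<in>\<Q>. Q x)"
proof -
  let ?\<N> = "{Q. edf E (\<lambda>v. Q (v 0)) \<and> finite {y \<in> SU s. Q y}}"
  let ?h = "\<lambda>Q x. \<not> Q x"
  have "\<exists>x\<in>SU s. \<forall>Q\<in>\<Q> \<union> ?h ` ?\<N>. Q x"
  proof (rule compact_sorts1[OF assms(1-3)])
    fix Q assume "Q \<in> \<Q> \<union> ?h ` ?\<N>"
    then show "edf E (\<lambda>v. Q (v 0))" using e edf_neg by blast
  next
    fix F assume F: "F \<subseteq> \<Q> \<union> ?h ` ?\<N>" "finite F"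
    have "F \<inter> ?h ` ?\<N> \<subseteq> ?h ` ?\<N>" "finite (F \<inter> ?h ` ?\<N>)" using F by auto
    then obtain N where N: "N \<subseteq> ?\<N>" "finite N" "F \<inter> ?h ` ?\<N> = ?h ` N" using finite_subset_image by meson
    have "finite (\<Union>Q\<in>N. {y \<in> SU s. Q y})" using N by auto
    moreover have "infinite {x \<in> SU s. \<forall>Q\<in>F \<inter> \<Q>. Q x}" by (rule inf) (use F in auto)
    ultimately have "\<not> {x \<in> SU s. \<forall>Q\<in>F \<inter> \<Q>. Q x} \<subseteq> (\<Union>Q\<in>N. {y \<in> SU s. Q y})"
      using finite_subset by blast
    then obtain x where "x \<in> {x \<in> SU s. \<forall>Q\<in>F \<inter> \<Q>. Q x}" "x \<notin> (\<Union>Q\<in>N. {y \<in> SU s. Q y})"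
      unfolding subset_iff not_all not_imp by (elim exE conjE) rule
    then have x: "x \<in> SU s" "\<forall>Q\<in>F \<inter> \<Q>. Q x" "\<forall>Q\<in>N. \<not> Q x" by auto
    have "Q x" if "Q \<in> F" for Q
    proof (cases "Q \<in> \<Q>")
      case False
      then have "Q \<in> ?h ` N" using that F(1) N(3) by blast
      then show ?thesis using x(3) by auto
    qed (use that x in blast)
    then show "\<exists>x\<in>SU s. \<forall>Q\<in>F. Q x" using x(1) by blast
  qed
  then obtain x where x: "x \<in> SU s" "\<forall>Q\<in>\<Q> \<union> ?h ` ?\<N>. Q x" by (rule bexE)
  have nQ: "\<not> Q x" if "Q \<in> ?\<N>" for Q by (rule bspec[OF x(2) UnI2[OF imageI[OF that]]])
  have "x \<notin> acl E"
  proof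
    assume xE: "x \<in> acl E"
    obtain Q where Q: "edf E (\<lambda>v. Q (v 0))" "Q x" "finite {y \<in> SU s. Q y}"
      using xE sort_SU[OF x(1)] unfolding acl_def by blast
    have "Q \<in> ?\<N>" using Q(1,3) by (intro CollectI conjI)
    from nQ[OF this] show False using Q(2) by (rule notE)
  qed
  moreover have "\<forall>Q\<in>\<Q>. Q x" by (rule ballI, rule bspec[OF x(2) UnI1])
  ultimately show ?thesis using x(1) by (intro bexI[of _ x] conjI)
qed

lemma generic_between:
  assumes "E \<subseteq> Ceq L C" "small C E" "w \<in> U" "t \<in> U" "lte w t"
  shows "\<exists>x\<in>U. x \<notin> acl E \<and> lte w x \<and> lte x t"
proof -
  \<comment> \<open>The endpoints join the parameters to make the interval definable. The point
    found avoids the closure of the larger set and hence that of \<open>E\<close>.\<close>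
  let ?Q = "\<lambda>x. lte w x \<and> lte x t" and ?E = "insert w (insert t E)"
  have inf: "infinite {x \<in> U. ?Q x}"
  proof
    assume fin: "finite {x \<in> U. ?Q x}"
    obtain z where "z \<in> {x \<in> U. ?Q x}" using lft.dense[OF assms(3-5)] by blast
    then obtain m where m: "m \<in> U" "?Q m" "\<forall>x\<in>{x \<in> U. ?Q x}. \<not> lte x m"
      using lft.finite_minimal[OF fin] by blast
    obtain x where "x \<in> U" "lte w x" "lte x m" using lft.dense[OF assms(3) m(1)] m(2) by blast
    then show False using m lft.tr[of x m t] assms(4) by blast
  qed
  have "\<exists>x\<in>U. x \<notin> acl ?E \<and> (\<forall>Q\<in>{?Q}. Q x)"
  proof (rule generic_point)
    show "wf_sort L C RealSort" by simp
    show "?E \<subseteq> Ceq L C" using assms(1) U_Ceq[OF assms(3)] U_Ceq[OF assms(4)] by simp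
    show "small C ?E" by (intro small_insert assms)
    show "edf ?E (\<lambda>v. Q (v 0))" if "Q \<in> {?Q}" for Q
    proof -
      have "edf ?E (\<lambda>v. ?Q (v 0))" by (intro edf_conj lft.edf_ls is_args) auto
      then show ?thesis using that by simp
    qed
    show "infinite {x \<in> U. \<forall>Q\<in>F. Q x}" if "F \<subseteq> {?Q}" for F
      by (rule infinite_super[OF _ inf]) (use that in blast)
  qed
  then obtain x where x: "x \<in> U" "x \<notin> acl ?E \<and> (\<forall>Q\<in>{?Q}. Q x)" by (rule bexE)
  have "acl E \<subseteq> acl ?E" by (rule acl_mono) blast
  moreover have "lte w x \<and> lte x t" using x(2) by simp
  ultimately show ?thesis using x by (intro bexI[of _ x]) auto
qed

end

context o_minimal_monster
begin

section \<open>Equality of types\<close>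

lemma small_Un_finite: "small C A \<Longrightarrow> finite B \<Longrightarrow> small C (A \<union> B)"
  by (rule small_Un[OF _ small_finite])

text \<open>Equality of types in semantic form, so that the closure rules for \<open>edf\<close>
  apply without writing formulas.\<close>

definition same_tp :: "('f, 'r, 'a) elt set \<Rightarrow> ('f, 'r, 'a) elt list \<Rightarrow> ('f, 'r, 'a) elt list \<Rightarrow> bool" where
  "same_tp E a a' \<longleftrightarrow> length a = length a' \<and>
     (\<forall>Q. edf E (\<lambda>v. Q (map v [0..<length a])) \<longrightarrow> Q a = Q a')"

lemma eqvD: "same_tp E a a' \<Longrightarrow> length a = n \<Longrightarrow> edf E (\<lambda>v. Q (map v [0..<n])) \<Longrightarrow> Q a = Q a'"
  unfolding same_tp_def by blast

lemma same_tp_length: "same_tp E a a' \<Longrightarrow> length a' = length a"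
  by (simp add: same_tp_def)

lemma same_tp_refl: "same_tp E a a"
  by (simp add: same_tp_def)

lemma same_tp_sym: "same_tp E a a' \<Longrightarrow> same_tp E a' a"
  unfolding same_tp_def by metis

lemma same_tp_mono: "same_tp E' a a' \<Longrightarrow> E \<subseteq> E' \<Longrightarrow> same_tp E a a'"
  unfolding same_tp_def using edf_mono by blast

lemma same_tp_prefix:
  assumes "same_tp E (a @ x) (a' @ x')" "length a = length a'"
  shows "same_tp E a a'"
  unfolding same_tp_def
proof (intro conjI allI impI)
  fix Q :: "('f, 'r, 'a) elt list \<Rightarrow> bool"
  assume Q: "edf E (\<lambda>v. Q (map v [0..<length a]))"
  have "take (length a) (map v [0..<length (a @ x)]) = map v [0..<length a]" for v :: "nat \<Rightarrow> ('f, 'r, 'a) elt"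
    by (simp add: take_map)
  then have "edf E (\<lambda>v. Q (take (length a) (map v [0..<length (a @ x)])))" using Q by simp
  from eqvD[OF assms(1) refl, of "\<lambda>xs. Q (take (length a) xs)", OF this] show "Q a = Q a'"
    using assms(2) by simp
qed (rule assms(2))

lemma edf_prefix_const:
  assumes "edf E (\<lambda>v. Q (map v [0..<length a + m]))" "set a \<subseteq> E"
  shows "edf E (\<lambda>v. Q (a @ map v [0..<m]))"
proof -
  have "edf E (\<lambda>v. Q (map (\<lambda>t. t v) (map (\<lambda>c v. c) a @ map (\<lambda>i v. v i) [0..<m])))"
    by (rule edf_app[OF assms(1)]) (use assms(2) in \<open>auto intro: is_args\<close>)
  then show ?thesis by (simp add: comp_def)
qed

lemma edf_prefix_const1:
  assumes "edf E (\<lambda>v. Q (map v [0..<Suc (length a)]))" "set a \<subseteq> E"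
  shows "edf E (\<lambda>v. Q (a @ [v 0]))"
  using edf_prefix_const[of E Q a 1] assms by simp

lemma edf_at_most_snoc:
  assumes "edf E (\<lambda>v. Q (map v [0..<Suc n]))" "wf_sort L C s"
  shows "edf E (\<lambda>v. at_most N {y \<in> SU s. Q (map v [0..<n] @ [y])})"
proof (rule edf_at_most[OF _ assms(2)])
  have "edf E (\<lambda>v. Q (map (\<lambda>t. t v) (map (\<lambda>i v. v (Suc i)) [0..<n] @ [\<lambda>v. v 0])))"
    by (rule edf_app[OF assms(1)]) (auto intro: is_args)
  then show "edf E (\<lambda>v. Q (map (\<lambda>i. v (Suc i)) [0..<n] @ [v 0]))"
    by (simp add: comp_def)
qed

text \<open>The forth step of a back-and-forth argument. If \<open>y\<close> is not algebraic over
  \<open>E a\<close>, each condition carried over to \<open>a'\<close> has infinitely many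
  solutions, so \<open>y'\<close> can even be chosen generic over the larger set
  \<open>E' a'\<close>.\<close>

lemma extension_step:
  assumes E: "E \<subseteq> E'" "E' \<subseteq> Ceq L C" "small C E'"
    and a: "same_tp E a a'" "set a' \<subseteq> Ceq L C" and y: "y \<in> Ceq L C"
  shows "\<exists>y'\<in>SU (sort_of y). same_tp E (a @ [y]) (a' @ [y']) \<and>
    (y \<notin> acl (E \<union> set a) \<longrightarrow> y' \<notin> acl (E' \<union> set a'))"
proof -
  let ?s = "sort_of y" and ?n = "length a" and ?E = "E' \<union> set a'"
  define D where "D = {Q. edf E (\<lambda>v. Q (map v [0..<Suc ?n])) \<and> Q (a @ [y])}"
  let ?h = "\<lambda>Q z. Q (a' @ [z])"
  have s: "wf_sort L C ?s" by (rule wf_sort_of[OF y])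
  have len: "length a' = ?n" using same_tp_length[OF a(1)] .
  have E': "?E \<subseteq> Ceq L C" "small C ?E" using E a small_Un small_finite[of "set a'"] by auto
  have e: "edf ?E (\<lambda>v. G (v 0))" if G: "G \<in> ?h ` D" for G
  proof -
    obtain Q where Q: "Q \<in> D" "G = ?h Q" using G by (rule imageE)
    have "edf E (\<lambda>v. Q (map v [0..<Suc (length a')]))" using Q(1) by (simp add: D_def len del: upt_Suc)
    then have "edf ?E (\<lambda>v. Q (map v [0..<Suc (length a')]))" by (rule edf_mono) (use E in auto)
    from edf_prefix_const1[OF this] show ?thesis unfolding Q(2) by auto
  qed
  have fin: "\<exists>Q. edf E (\<lambda>v. Q (map v [0..<Suc ?n])) \<and> Q (a @ [y]) \<and> {z \<in> SU ?s. \<forall>G\<in>F. G z} = {z \<in> SU ?s. Q (a' @ [z])}"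
    if F: "F \<subseteq> ?h ` D" "finite F" for F
  proof -
    obtain F0 where F0: "F0 \<subseteq> D" "finite F0" "F = ?h ` F0" using finite_subset_image[OF F(2,1)] by blast
    show ?thesis
    proof (intro exI conjI)
      show "edf E (\<lambda>v. \<forall>Q\<in>F0. Q (map v [0..<Suc ?n]))"
        by (rule edf_ball[OF F0(2)]) (use F0(1) in \<open>auto simp: D_def\<close>)
      show "\<forall>Q\<in>F0. Q (a @ [y])" using F0(1) by (auto simp: D_def)
      show "{z \<in> SU ?s. \<forall>G\<in>F. G z} = {z \<in> SU ?s. \<forall>Q\<in>F0. Q (a' @ [z])}"
        unfolding F0(3) by (simp only: ball_simps)
    qed
  qed
  \<comment> \<open>Counting passes from \<open>a\<close> to \<open>a'\<close>: the bound
    \<open>0\<close> says that there is no solution, and failure of all bounds says that there are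
    infinitely many.\<close>
  have transfer: "at_most m {z \<in> SU ?s. Q (a @ [z])} = at_most m {z \<in> SU ?s. Q (a' @ [z])}"
    if "edf E (\<lambda>v. Q (map v [0..<Suc ?n]))" for Q m
    by (rule eqvD[OF a(1) refl, of "\<lambda>xs. at_most m {z \<in> SU ?s. Q (xs @ [z])}"], rule edf_at_most_snoc[OF that s])
  have "\<exists>y'\<in>SU ?s. (y \<notin> acl (E \<union> set a) \<longrightarrow> y' \<notin> acl ?E) \<and> (\<forall>G\<in>?h ` D. G y')"
  proof (cases "y \<in> acl (E \<union> set a)")
    case True
    have "\<exists>x\<in>SU ?s. \<forall>G\<in>?h ` D. G x"
    proof (rule compact_sorts1[OF s E' e])
      fix F assume F: "F \<subseteq> ?h ` D" "finite F"
      from fin[OF this] obtain Q where Q: "edf E (\<lambda>v. Q (map v [0..<Suc ?n]))" "Q (a @ [y])"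
        "{z \<in> SU ?s. \<forall>G\<in>F. G z} = {z \<in> SU ?s. Q (a' @ [z])}" by (elim exE conjE)
      have "\<not> at_most 0 {z \<in> SU ?s. Q (a @ [z])}" unfolding at_most_0 using Q(2) in_SU[OF y] by blast
      then have "{z \<in> SU ?s. \<forall>G\<in>F. G z} \<noteq> {}" unfolding transfer[OF Q(1)] at_most_0 Q(3) .
      then show "\<exists>x\<in>SU ?s. \<forall>G\<in>F. G x" by (simp only: Collect_empty_eq Bex_def not_all not_not)
    qed
    then obtain x where "x \<in> SU ?s" "\<forall>G\<in>?h ` D. G x" by (rule bexE)
    then show ?thesis using True by (intro bexI[of _ x]) simp_all
  next
    case False
    have "\<exists>x\<in>SU ?s. x \<notin> acl ?E \<and> (\<forall>G\<in>?h ` D. G x)"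
    proof (rule generic_point[OF s E' e])
      fix F assume F: "F \<subseteq> ?h ` D" "finite F"
      from fin[OF this] obtain Q where Q: "edf E (\<lambda>v. Q (map v [0..<Suc ?n]))" "Q (a @ [y])"
        "{z \<in> SU ?s. \<forall>G\<in>F. G z} = {z \<in> SU ?s. Q (a' @ [z])}" by (elim exE conjE)
      have "edf (E \<union> set a) (\<lambda>v. Q (a @ [v 0]))"
        by (rule edf_prefix_const1[OF edf_mono[OF Q(1)]]) auto
      then have "infinite {z \<in> SU ?s. Q (a @ [z])}"
        using aclI[OF y, of "E \<union> set a" "\<lambda>z. Q (a @ [z])"] Q(2) False by auto
      then have "\<not> at_most m {z \<in> SU ?s. Q (a @ [z])}" for m by (simp add: at_most_def)
      then have "\<not> at_most m {z \<in> SU ?s. Q (a' @ [z])}" for m unfolding transfer[OF Q(1)] .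
      then show "infinite {x \<in> SU ?s. \<forall>G\<in>F. G x}" unfolding Q(3) at_most_def by blast
    qed
    then obtain x where x: "x \<in> SU ?s" "x \<notin> acl ?E" "\<forall>G\<in>?h ` D. G x" by (elim bexE conjE)
    show ?thesis by (rule bexI[OF _ x(1)], rule conjI, rule impI, rule x(2), rule x(3))
  qed
  then obtain y' where y': "y' \<in> SU ?s" "y \<notin> acl (E \<union> set a) \<longrightarrow> y' \<notin> acl ?E" "\<forall>G\<in>?h ` D. G y'"
    by (elim bexE conjE)
  have D: "Q (a' @ [y'])" if "edf E (\<lambda>v. Q (map v [0..<Suc ?n]))" "Q (a @ [y])" for Q
    using y'(3) that by (auto simp: D_def)
  have "same_tp E (a @ [y]) (a' @ [y'])" unfolding same_tp_def
  proof (intro conjI allI impI)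
    fix Q assume Q: "edf E (\<lambda>v. Q (map v [0..<length (a @ [y])]))"
    then show "Q (a @ [y]) = Q (a' @ [y'])"
      using D[of Q] D[of "\<lambda>xs. \<not> Q xs", OF edf_neg] by auto
  qed (simp add: len)
  then show ?thesis using y'(1,2) by blast
qed

text \<open>The extension property of the independence given by \<open>rk\<close>: each coordinate
  that counts for \<open>x\<close> is replaced by one that is generic over the larger set.\<close>

lemma extension:
  assumes E: "E \<subseteq> E'" "E' \<subseteq> Ceq L C" "small C E'"
    and "same_tp E a a'" "set a' \<subseteq> Ceq L C" "set x \<subseteq> Ceq L C"
  shows "\<exists>x'. map sort_of x' = map sort_of x \<and> set x' \<subseteq> Ceq L C \<and> same_tp E (a @ x) (a' @ x') \<and>
    rk (E \<union> set a) x \<le> rk (E' \<union> set a') x'"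
  using assms(4-)
proof (induction x arbitrary: a a')
  case Nil
  then show ?case by simp
next
  case (Cons y x)
  obtain y' where y': "y' \<in> SU (sort_of y)" "same_tp E (a @ [y]) (a' @ [y'])"
    "y \<notin> acl (E \<union> set a) \<Longrightarrow> y' \<notin> acl (E' \<union> set a')"
    using extension_step[OF E Cons.prems(1,2), of y] Cons.prems(3) by auto
  have "\<exists>x'. map sort_of x' = map sort_of x \<and> set x' \<subseteq> Ceq L C \<and> same_tp E ((a @ [y]) @ x) ((a' @ [y']) @ x') \<and>
    rk (E \<union> set (a @ [y])) x \<le> rk (E' \<union> set (a' @ [y'])) x'"
    by (rule Cons.IH[OF y'(2)]) (use Cons.prems y'(1) SU_Ceq in auto)
  then obtain x' where x': "map sort_of x' = map sort_of x" "set x' \<subseteq> Ceq L C"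
    "same_tp E (a @ y # x) (a' @ y' # x')" "rk (insert y (E \<union> set a)) x \<le> rk (insert y' (E' \<union> set a')) x'"
    by auto
  show ?case
    by (rule exI[of _ "y' # x'"]) (use x' y' SU_Ceq sort_SU[OF y'(1)] in auto)
qed

text \<open>Algebraicity of a coordinate on the right is witnessed by a formula whose bound holds at
  every tuple, so it passes back to the corresponding coordinate on the left.\<close>

lemma rk_same_tp:
  assumes "same_tp E (a @ x) (a' @ x')" "length a = length a'" "map sort_of x = map sort_of x'" "set x \<subseteq> Ceq L C"
  shows "rk (E \<union> set a) x \<le> rk (E \<union> set a') x'"
  using assms
proof (induction x arbitrary: a a' x')
  case (Cons y x)
  then obtain y' z where x': "x' = y' # z" by (cases x') auto
  have "rk (E \<union> set (a @ [y])) x \<le> rk (E \<union> set (a' @ [y'])) z"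
    by (rule Cons.IH) (use Cons.prems x' in auto)
  moreover have "y \<in> acl (E \<union> set a)" if "y' \<in> acl (E \<union> set a')"
  proof -
    let ?n = "length a"
    have "length a' = ?n" using Cons.prems(2) by simp
    from acl_listD[OF that this] obtain Q N where Q: "edf E (\<lambda>v. Q (map v [0..<Suc ?n]))" "Q (a' @ [y'])"
      "\<And>x z. length x = ?n \<Longrightarrow> Q (x @ [z]) \<Longrightarrow> at_most N {w \<in> SU (sort_of y'). Q (x @ [w])}" by blast
    have "same_tp E (a @ [y]) (a' @ [y'])" by (rule same_tp_prefix[of _ _ x _ z]) (use Cons.prems x' in auto)
    from eqvD[OF this _ Q(1)] have Qy: "Q (a @ [y])" using Q(2) by simp
    show ?thesis
    proof (rule aclI[where Q = "\<lambda>w. Q (a @ [w])"])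
      show "edf (E \<union> set a) (\<lambda>v. Q (a @ [v 0]))"
        by (rule edf_prefix_const1[OF edf_mono[OF Q(1)]]) auto
      show "finite {w \<in> SU (sort_of y). Q (a @ [w])}"
        using Q(3)[OF refl Qy] Cons.prems(3) x' by (simp add: at_most_def)
    qed (use Cons.prems Qy in auto)
  qed
  ultimately show ?case using x' by auto
qed simp

lemma rk_zero: "rk E xs = 0 \<Longrightarrow> E \<subseteq> Ceq L C \<Longrightarrow> set xs \<subseteq> acl E"
proof (induction xs arbitrary: E)
  case (Cons x xs)
  then have x: "x \<in> acl E" by (auto split: if_splits)
  moreover have "set xs \<subseteq> acl (insert x E)"
    using Cons x acl_Ceq by (auto split: if_splits)
  ultimately show ?case using acl_insert_eq[OF x] Cons.prems by simp
qed simp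

text \<open>Some coordinate of \<open>b\<close> counts over \<open>H\<close>. A copy of
  \<open>b\<close> that keeps its rank over \<open>H\<close> together with all earlier copies
  differs from each of these, because an earlier copy has rank \<open>0\<close> there.\<close>

lemma many_realizations:
  assumes H: "H \<subseteq> Ceq L C" "small C H" and b: "set b \<subseteq> Ceq L C" "\<not> set b \<subseteq> acl H"
  shows "\<exists>S. finite S \<and> card S = k \<and> (\<forall>b'\<in>S. same_tp H b b' \<and> map sort_of b' = map sort_of b \<and> set b' \<subseteq> Ceq L C)"
proof (induction k)
  case 0
  then show ?case by (intro exI[of _ "{}"]) simp
next
  case (Suc k)
  then obtain S where S: "finite S" "card S = k"
    "\<And>b'. b' \<in> S \<Longrightarrow> same_tp H b b' \<and> map sort_of b' = map sort_of b \<and> set b' \<subseteq> Ceq L C" by blast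
  let ?H = "H \<union> \<Union>(set ` S)"
  have H': "?H \<subseteq> Ceq L C" using H S by blast
  have "small C ?H" using H S by (intro small_Un_finite) auto
  from extension[OF _ H' this same_tp_refl[of H "[]"] _ b(1)]
  obtain b' where b': "map sort_of b' = map sort_of b" "set b' \<subseteq> Ceq L C" "same_tp H b b'" "rk H b \<le> rk ?H b'"
    by auto
  have "rk H b \<noteq> 0" using rk_zero[OF _ H(1), of b] b(2) by blast
  then have "b' \<notin> S" using rk_subset[of b' ?H] b'(4) H' by auto
  then show ?case using S b' by (intro exI[of _ "insert b' S"]) auto
qed

section \<open>Thorn-forking\<close>

lemma same_tp_eqholds: "same_tp E a a' \<Longrightarrow> \<psi> \<in> eqfms_over L C (length a) E \<Longrightarrow> eqholds L C \<psi> a = eqholds L C \<psi> a'"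
  by (rule eqvD[OF _ refl], assumption, rule eqfm_edf)

lemma same_tp_realizes:
  "same_tp E a a' \<Longrightarrow> a' \<in> eq_tuples L C \<sigma> \<Longrightarrow> a' \<in> realizations L C \<sigma> (tp L C a E)"
  using same_tp_eqholds by (auto simp: realizations_def tp_def)

lemma realizes_same_tp:
  assumes "a' \<in> realizations L C \<sigma> (tp L C a E)" "length \<sigma> = length a"
  shows "same_tp E a a'"
  unfolding same_tp_def
proof (intro conjI allI impI)
  show len: "length a = length a'" using assms by (auto simp: realizations_def eq_tuples_def)
  have *: "Q a'" if "edf E (\<lambda>v. Q (map v [0..<length a]))" "Q a" for Q
  proof -
    from edf_eqfm[of E Q "length a" 0] that(1) obtain \<delta> e where
      "set e \<subseteq> E" "wf_eqfm L C \<delta>" "fv_eq \<delta> \<subseteq> {..<length a + length e}"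
      "\<And>x. length x = length a \<Longrightarrow> eqholds L C (\<delta>, e) x = Q x"
      by auto
    then have "(\<delta>, e) \<in> tp L C a E" "eqholds L C (\<delta>, e) a' = Q a'"
      using that(2) len by (auto simp: tp_def eqfms_over_def)
    then show ?thesis using assms(1) by (auto simp: realizations_def)
  qed
  fix Q assume "edf E (\<lambda>v. Q (map v [0..<length a]))"
  then show "Q a = Q a'" using *[of Q] *[of "\<lambda>xs. \<not> Q xs", OF edf_neg] by blast
qed

lemma algebraic_tp:
  assumes "set b \<subseteq> acl F"
  shows "algebraic L C (map sort_of b) (tp L C b F)"
proof -
  let ?n = "length b"
  let ?P = "\<lambda>i Q. edf F (\<lambda>v. Q (v 0)) \<and> Q (b ! i) \<and> finite {y \<in> SU (sort_of (b ! i)). Q y}"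
  define Q where "Q i = (SOME Q. ?P i Q)" for i
  have P: "?P i (Q i)" if i: "i < ?n" for i
  proof -
    have "\<exists>Q. ?P i Q" using assms nth_mem[OF i] unfolding acl_def by blast
    from someI_ex[OF this] show ?thesis unfolding Q_def .
  qed
  note Q = P[THEN conjunct1] P[THEN conjunct2, THEN conjunct1] P[THEN conjunct2, THEN conjunct2]
  let ?Q = "\<lambda>xs. \<forall>i\<in>{..<?n}. Q i (xs ! i)"
  have "edf F (\<lambda>v. Q i (map v [0..<?n] ! i))" if i: "i < ?n" for i
    using edf1[OF Q(1)[OF i] is_arg_var] i by simp
  then have "edf F (\<lambda>v. ?Q (map v [0..<?n]))" by (intro edf_ball) auto
  then obtain \<delta> e where \<delta>: "set e \<subseteq> F" "wf_eqfm L C \<delta>" "fv_eq \<delta> \<subseteq> {..<?n + length e}"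
      "\<And>x. length x = ?n \<Longrightarrow> eqholds L C (\<delta>, e) x = ?Q x"
    using edf_eqfm[of F ?Q ?n 0] by auto
  have "(\<delta>, e) \<in> tp L C b F" using \<delta> Q(2) by (auto simp: tp_def eqfms_over_def)
  moreover have "finite (realizations L C (map sort_of b) {(\<delta>, e)})"
  proof (rule finite_subset)
    let ?Y = "\<Union>i\<in>{..<?n}. {y \<in> SU (sort_of (b ! i)). Q i y}"
    show "finite {xs. set xs \<subseteq> ?Y \<and> length xs = ?n}"
      by (rule finite_lists_length_eq) (use Q(3) in auto)
    show "realizations L C (map sort_of b) {(\<delta>, e)} \<subseteq> {xs. set xs \<subseteq> ?Y \<and> length xs = ?n}"
    proof
      fix xs assume xs: "xs \<in> realizations L C (map sort_of b) {(\<delta>, e)}"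
      then have 1: "set xs \<subseteq> Ceq L C" "map sort_of xs = map sort_of b" and h: "eqholds L C (\<delta>, e) xs"
        by (auto simp: realizations_def eq_tuples_def)
      then have len: "length xs = ?n" by (metis length_map)
      have "xs ! i \<in> ?Y" if "i < ?n" for i
      proof -
        have "sort_of (xs ! i) = sort_of (b ! i)" using 1(2) that len by (metis nth_map)
        moreover have "xs ! i \<in> Ceq L C" using 1(1) that len by auto
        moreover have "Q i (xs ! i)" using h \<delta>(4)[OF len] that by auto
        ultimately show ?thesis using that by (auto simp: SU_def)
      qed
      then show "xs \<in> {xs. set xs \<subseteq> ?Y \<and> length xs = ?n}" using len by (auto simp: in_set_conv_nth)
    qed
  qed
  ultimately show ?thesis unfolding algebraic_def by blast
qed

text \<open>If \<open>b\<close> were not algebraic over \<open>F x\<close>, its type over \<open>F x\<close> would have arbitrarily many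
  realizations, and \<open>x\<close> would satisfy the dividing formula at all of them.\<close>

lemma strongly_divides_algebraic:
  assumes F: "F \<subseteq> Ceq L C" "small C F" and x: "length x = k" "set x \<subseteq> U"
    and \<delta>: "(\<delta>, b) \<in> eqfms_over L C k (Ceq L C)" "eqholds L C (\<delta>, b) x"
    and sd: "strongly_divides L C (replicate k RealSort) (\<delta>, b) F"
  shows "\<exists>\<beta>\<in>set b. \<beta> \<notin> acl F \<and> \<beta> \<in> acl (F \<union> set x)"
proof -
  obtain N where na: "\<not> algebraic L C (map sort_of b) (tp L C b F)" and
    ki: "k_inconsistent L C (replicate k RealSort) \<delta> (realizations L C (map sort_of b) (tp L C b F)) N"
    using sd by (auto simp: strongly_divides_def)
  have wf: "wf_eqfm L C \<delta>" "fv_eq \<delta> \<subseteq> {..<k + length b}" "set b \<subseteq> Ceq L C"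
    using \<delta>(1) by (auto simp: eqfms_over_def)
  have xC: "set x \<subseteq> Ceq L C" using x U_Ceq by blast
  have "set b \<subseteq> acl (F \<union> set x)"
  proof (rule ccontr)
    assume "\<not> set b \<subseteq> acl (F \<union> set x)"
    moreover have "F \<union> set x \<subseteq> Ceq L C" using F xC by blast
    moreover have "small C (F \<union> set x)" using F by (intro small_Un_finite) auto
    ultimately obtain S where S: "finite S" "card S = N"
      "\<And>b'. b' \<in> S \<Longrightarrow> same_tp (F \<union> set x) b b' \<and> map sort_of b' = map sort_of b \<and> set b' \<subseteq> Ceq L C"
      using many_realizations[of "F \<union> set x" b N] wf(3) by blast
    have "S \<subseteq> realizations L C (map sort_of b) (tp L C b F)"
      using S(3) same_tp_mono[of "F \<union> set x" b _ F] by (auto intro!: same_tp_realizes simp: eq_tuples_def)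
    then have "realizations L C (replicate k RealSort) ((\<lambda>a. (\<delta>, a)) ` S) = {}"
      using ki S(1,2) unfolding k_inconsistent_def by blast
    moreover have "x \<in> realizations L C (replicate k RealSort) ((\<lambda>a. (\<delta>, a)) ` S)"
    proof -
      have "edf (F \<union> set x) (\<lambda>v. sat_eq L C ((!) (map v [0..<length x + length b])) \<delta>)"
      proof -
        have "sat_eq L C ((!) (map v [0..<length x + length b])) \<delta> = sat_eq L C v \<delta>" for v
          by (rule sat_eq_cong) (use wf x in auto)
        then show ?thesis using edf_sat[OF wf(1)] by simp
      qed
      from edf_prefix_const[where Q = "\<lambda>zs. sat_eq L C ((!) zs) \<delta>", OF this]
      have "edf (F \<union> set x) (\<lambda>v. eqholds L C (\<delta>, map v [0..<length b]) x)"
        by (simp add: eqholds_def)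
      then have "eqholds L C (\<delta>, b') x" if "b' \<in> S" for b'
        using eqvD[of "F \<union> set x" b b' _ "\<lambda>ys. eqholds L C (\<delta>, ys) x"] S(3)[OF that] \<delta>(2) by blast
      then show ?thesis using x by (auto simp: realizations_def eq_tuples_reals)
    qed
    ultimately show False by blast
  qed
  moreover have "\<not> set b \<subseteq> acl F" using algebraic_tp na by blast
  ultimately show ?thesis by blast
qed

text \<open>A realization \<open>x'\<close> of the type of \<open>x\<close> over \<open>E'\<close>
  is chosen whose rank over all parameters of the disjunction is at least that of \<open>x\<close>
  over \<open>E'\<close>. It satisfies some disjunct, and strong division yields
  \<open>\<beta>\<close> algebraic over \<open>x'\<close> and the base but not over the base alone;
  adjoining \<open>\<beta>\<close> costs rank. The type over \<open>E\<close> then carries the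
  inequality back to \<open>x\<close>.\<close>

lemma forking_rank_drop:
  assumes E: "E \<subseteq> E'" "E' \<subseteq> Ceq L C" "small C E'" and x: "length x = k" "set x \<subseteq> U"
    and \<psi>: "\<psi> \<in> tp L C x E'" "thorn_forks_fm L C (replicate k RealSort) \<psi> E"
  shows "rk E' x < rk E x"
proof -
  let ?\<sigma> = "replicate k RealSort :: ('f, 'r) esort list"
  obtain D where D: "finite D" "D \<subseteq> eqfms_over L C k (Ceq L C)" "\<And>\<delta>. \<delta> \<in> D \<Longrightarrow> thorn_divides L C ?\<sigma> \<delta> E"
    "realizations L C ?\<sigma> {\<psi>} \<subseteq> (\<Union>\<delta>\<in>D. realizations L C ?\<sigma> {\<delta>})"
    using \<psi>(2) unfolding thorn_forks_fm_def by auto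
  obtain c where c: "\<And>\<delta>. \<delta> \<in> D \<Longrightarrow> set (c \<delta>) \<subseteq> Ceq L C"
      "\<And>\<delta>. \<delta> \<in> D \<Longrightarrow> strongly_divides L C ?\<sigma> \<delta> (E \<union> set (c \<delta>))"
    using D(3) unfolding thorn_divides_def by metis
  \<comment> \<open>It is not known beforehand which disjunct \<open>x'\<close> will satisfy, so the
    parameters of all of them and of their dividing are collected.\<close>
  define X where "X = (\<Union>\<delta>\<in>D. set (snd \<delta>) \<union> set (c \<delta>))"
  have X: "finite X" "X \<subseteq> Ceq L C"
    using D(1,2) c(1) by (auto simp: X_def eqfms_over_def subset_iff)
  let ?H = "E' \<union> X"
  have H: "?H \<subseteq> Ceq L C" "small C ?H" using E X by (auto intro: small_Un_finite)
  have xC: "set x \<subseteq> Ceq L C" using x U_Ceq by blast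
  obtain x' where x': "map sort_of x' = map sort_of x" "set x' \<subseteq> Ceq L C" "same_tp E' x x'" "rk E' x \<le> rk ?H x'"
    using extension[OF _ H same_tp_refl[of E' "[]"] _ xC] by auto
  have "x \<in> eq_tuples L C ?\<sigma>" using x by (simp add: eq_tuples_reals)
  then have x't: "x' \<in> eq_tuples L C ?\<sigma>" using x' by (simp add: eq_tuples_def)
  then have x'r: "length x' = k" "set x' \<subseteq> U" by (auto simp: eq_tuples_reals)
  have "x' \<in> realizations L C ?\<sigma> {\<psi>}"
    using same_tp_realizes[OF x'(3) x't] \<psi>(1) by (auto simp: realizations_def)
  then obtain \<delta> b where \<delta>: "(\<delta>, b) \<in> D" "eqholds L C (\<delta>, b) x'"
    using D(4) by (auto simp: realizations_def)
  let ?F = "E \<union> set (c (\<delta>, b))"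
  have F: "?F \<subseteq> Ceq L C" "small C ?F" using E c(1)[OF \<delta>(1)] small_subset[OF E(3,1)] by (auto intro: small_Un_finite)
  obtain \<beta> where \<beta>: "\<beta> \<in> set b" "\<beta> \<notin> acl ?F" "\<beta> \<in> acl (?F \<union> set x')"
    using strongly_divides_algebraic[OF F x'r _ \<delta>(2) c(2)[OF \<delta>(1)]] D(2) \<delta>(1) by blast
  have "rk ?H x' \<le> rk (insert \<beta> ?F) x'"
    by (rule rk_mono) (use E \<delta>(1) \<beta>(1) in \<open>force simp: X_def\<close>)
  also have "\<dots> < rk ?F x'" by (rule rk_algebraic_strict[OF F(1) x'r(2) \<beta>(3,2)])
  also have "\<dots> \<le> rk E x'" by (rule rk_mono) blast
  also have "\<dots> \<le> rk E x"
    using rk_same_tp[of E "[]" x' "[]" x] same_tp_sym[OF same_tp_mono[OF x'(3) E(1)]] x'(1,2) by simp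
  finally show ?thesis using x'(4) by simp
qed

text \<open>The formula \<open>\<delta>\<close> has parameters \<open>e @ [\<beta>]\<close> with
  \<open>e\<close> in \<open>E c\<close>, so conjugates over \<open>E c\<close> differ in the last
  entry only. At each \<open>y\<close> at most \<open>N\<close> last entries are allowed, whence
  \<open>Suc N\<close> conjugates are inconsistent.\<close>

lemma forkingI:
  assumes x: "length x = k" "set x \<subseteq> U" and c: "E \<subseteq> Ceq L C" "set c \<subseteq> Ceq L C"
    and E': "E \<union> set c \<union> {\<beta>} \<subseteq> E'" "E' \<subseteq> Ceq L C"
    and \<beta>: "\<beta> \<in> acl (E \<union> set c \<union> set x)" "\<beta> \<notin> acl (E \<union> set c)"
  shows "thorn_forks L C (replicate k RealSort) (tp L C x E') E"
proof -
  let ?\<sigma> = "replicate k RealSort :: ('f, 'r) esort list" and ?G = "E \<union> set c" and ?s = "sort_of \<beta>"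
  have \<beta>C: "\<beta> \<in> Ceq L C" using E' by blast
  obtain Q N where Q: "edf ?G (\<lambda>v. Q (map v [0..<Suc k]))" "Q (x @ [\<beta>])"
    "\<And>y z. length y = k \<Longrightarrow> Q (y @ [z]) \<Longrightarrow> at_most N {w \<in> SU ?s. Q (y @ [w])}"
    using acl_listD[OF \<beta>(1) x(1)] by blast
  obtain \<delta> e where \<delta>: "set e \<subseteq> ?G" "wf_eqfm L C \<delta>" "fv_eq \<delta> \<subseteq> {..<k + (length e + 1)}"
    "\<And>y z. length y = k \<Longrightarrow> eqholds L C (\<delta>, e @ [z]) y = Q (y @ [z])"
  proof -
    have "edf ?G (\<lambda>v. Q (map v [0..<k + 1]))" using Q(1) by simp
    from edf_eqfm[OF this] obtain \<delta> e where 1: "set e \<subseteq> ?G" "wf_eqfm L C \<delta>" "fv_eq \<delta> \<subseteq> {..<k + (length e + 1)}"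
      "\<And>y zs. length y = k \<Longrightarrow> length zs = 1 \<Longrightarrow> eqholds L C (\<delta>, e @ zs) y = Q (y @ zs)" by blast
    have "eqholds L C (\<delta>, e @ [z]) y = Q (y @ [z])" if "length y = k" for y z
      using 1(4)[of y "[z]"] that by simp
    then show ?thesis using that 1 by blast
  qed
  let ?b = "e @ [\<beta>]" and ?\<psi> = "(\<delta>, e @ [\<beta>])"
  have \<psi>E: "?\<psi> \<in> eqfms_over L C k E'" using \<delta> E' by (auto simp: eqfms_over_def)
  then have \<psi>: "?\<psi> \<in> tp L C x E'" using \<delta>(4)[OF x(1)] Q(2) x(1) by (simp add: tp_def)
  have "strongly_divides L C ?\<sigma> ?\<psi> ?G"
  proof -
    have "\<not> algebraic L C (map sort_of ?b) (tp L C ?b ?G)"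
    proof
      assume "algebraic L C (map sort_of ?b) (tp L C ?b ?G)"
      then obtain \<chi> where \<chi>: "\<chi> \<in> tp L C ?b ?G" "finite (realizations L C (map sort_of ?b) {\<chi>})"
        unfolding algebraic_def by blast
      have "edf ?G (\<lambda>v. eqholds L C \<chi> (map v [0..<Suc (length e)]))"
        using eqfm_edf[of \<chi> "Suc (length e)" ?G] \<chi>(1) by (simp add: tp_def)
      then have "edf ?G (\<lambda>v. eqholds L C \<chi> (e @ [v 0]))"
        by (rule edf_prefix_const1[where Q = "eqholds L C \<chi>"]) (rule \<delta>(1))
      moreover have "finite {z \<in> SU ?s. eqholds L C \<chi> (e @ [z])}"
      proof (rule finite_subset)
        show "finite (last ` realizations L C (map sort_of ?b) {\<chi>})" using \<chi>(2) by simp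
        show "{z \<in> SU ?s. eqholds L C \<chi> (e @ [z])} \<subseteq> last ` realizations L C (map sort_of ?b) {\<chi>}"
        proof
          fix z assume z: "z \<in> {z \<in> SU ?s. eqholds L C \<chi> (e @ [z])}"
          then have "e @ [z] \<in> realizations L C (map sort_of ?b) {\<chi>}"
            using \<delta>(1) c by (auto simp: realizations_def eq_tuples_def SU_def)
          from imageI[OF this, of last] show "z \<in> last ` realizations L C (map sort_of ?b) {\<chi>}" by simp
        qed
      qed
      moreover have "eqholds L C \<chi> (e @ [\<beta>])" using \<chi>(1) by (simp add: tp_def)
      ultimately show False using aclI[OF \<beta>C, of ?G "\<lambda>z. eqholds L C \<chi> (e @ [z])"] \<beta>(2) by blast
    qed
    moreover have "k_inconsistent L C ?\<sigma> \<delta> (realizations L C (map sort_of ?b) (tp L C ?b ?G)) (Suc N)"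
      unfolding k_inconsistent_def
    proof (intro allI impI, rule ccontr)
      fix S assume S: "S \<subseteq> realizations L C (map sort_of ?b) (tp L C ?b ?G)" "finite S" "card S = Suc N"
        and "realizations L C ?\<sigma> ((\<lambda>a. (\<delta>, a)) ` S) \<noteq> {}"
      then obtain y where y: "length y = k" "\<And>b'. b' \<in> S \<Longrightarrow> eqholds L C (\<delta>, b') y"
        by (auto simp: realizations_def eq_tuples_reals)
      \<comment> \<open>Each entry of \<open>e\<close> is a parameter, so the formula fixing it
        belongs to the type of \<open>?b\<close> and every realization begins with
        \<open>e\<close>.\<close>
      have b': "b' = e @ [last b'] \<and> last b' \<in> SU ?s" if b': "b' \<in> S" for b'
      proof -
        have eb: "same_tp ?G ?b b'" using realizes_same_tp[of b' "map sort_of ?b" ?b ?G] S(1) b' by auto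
        have len: "length b' = Suc (length e)" using same_tp_length[OF eb] by simp
        have "b' ! i = e ! i" if i: "i < length e" for i
        proof -
          have "edf ?G (\<lambda>v. v i = e ! i)" using subsetD[OF \<delta>(1) nth_mem[OF i]] by (intro edf_eq is_args)
          then have "edf ?G (\<lambda>v. map v [0..<length ?b] ! i = e ! i)" using i by (simp del: upt_Suc)
          from eqvD[OF eb refl, of "\<lambda>ys. ys ! i = e ! i", OF this] i show ?thesis by (simp add: nth_append)
        qed
        note e = this
        obtain ys w where ys: "b' = ys @ [w]" using len by (cases b' rule: rev_cases) auto
        have "ys = e" using len e ys by (intro nth_equalityI) (auto simp: nth_append)
        then have "b' = e @ [last b']" using ys by simp
        moreover have "b' \<in> eq_tuples L C (map sort_of ?b)" using S(1) b' by (auto simp: realizations_def)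
        ultimately show ?thesis
          by (auto simp: eq_tuples_def SU_def)
            (metis last_in_set append_is_Nil_conv not_Cons_self2 subsetD, metis last_map last_snoc append_is_Nil_conv not_Cons_self2)
      qed
      have inj: "inj_on last S" by (rule inj_onI) (metis b')
      have sub: "last ` S \<subseteq> {w \<in> SU ?s. Q (y @ [w])}"
      proof
        fix w assume "w \<in> last ` S"
        then obtain b' where "b' \<in> S" "w = last b'" by blast
        then show "w \<in> {w \<in> SU ?s. Q (y @ [w])}" using b'[of b'] y(2)[of b'] \<delta>(4)[OF y(1), of w] by auto
      qed
      have "S \<noteq> {}" using S(3) by auto
      then obtain z where "Q (y @ [z])" using sub by blast
      from Q(3)[OF y(1) this] have "card (last ` S) \<le> N"
        using card_mono[OF _ sub] by (auto simp: at_most_def)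
      then show False using card_image[OF inj] S(3) by simp
    qed
    ultimately show ?thesis unfolding strongly_divides_def by auto
  qed
  then have "thorn_divides L C ?\<sigma> ?\<psi> E" unfolding thorn_divides_def using c(2) by blast
  moreover have "?\<psi> \<in> eqfms_over L C (length ?\<sigma>) (Ceq L C)" using \<psi>E E'(2) by (auto simp: eqfms_over_def)
  ultimately have "thorn_forks_fm L C ?\<sigma> ?\<psi> E"
    unfolding thorn_forks_fm_def by (intro exI[of _ "{?\<psi>}"]) simp
  then show ?thesis unfolding thorn_forks_def using \<psi> by blast
qed

theorem thorn_forks_iff:
  assumes A: "A \<subseteq> Ceq L C" "small C A" and b: "set b \<subseteq> U" and x: "length x = k" "set x \<subseteq> U"
  shows "thorn_forks L C (replicate k RealSort) (tp L C x (A \<union> set b)) A \<longleftrightarrow> rk (A \<union> set b) x < rk A x"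
proof
  assume "thorn_forks L C (replicate k RealSort) (tp L C x (A \<union> set b)) A"
  then show "rk (A \<union> set b) x < rk A x"
    unfolding thorn_forks_def using A b U_Ceq x
    by (auto intro!: forking_rank_drop[of A "A \<union> set b" x k] small_Un_finite)
next
  assume "rk (A \<union> set b) x < rk A x"
  then obtain c \<beta> where c: "set c \<subseteq> set b" "\<beta> \<in> set b" "\<beta> \<in> acl (A \<union> set c \<union> set x)" "\<beta> \<notin> acl (A \<union> set c)"
    using rk_drop_witness[OF A(1) b x(2)] by blast
  show "thorn_forks L C (replicate k RealSort) (tp L C x (A \<union> set b)) A"
    by (rule forkingI[OF x A(1) _ _ _ c(3,4)]) (use c(1,2) A b U_Ceq in auto)
qed

section \<open>The thorn-rank\<close>

lemma is_succ_nat: "is_succ m n \<longleftrightarrow> n = Suc m"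
  unfolding is_succ_def by (auto simp: le_antisym Suc_leI)

lemma not_is_limit_nat: "\<not> is_limit (n :: nat)"
  unfolding is_limit_def is_succ_nat by (metis not0_implies_Suc not_less0)

lemma consistent_realized:
  assumes A: "A \<subseteq> Ceq L C" "small C A" and p: "p \<subseteq> eqfms_over L C k A"
    and con: "consistent L C (replicate k RealSort) p"
  shows "\<exists>x. x \<in> realizations L C (replicate k RealSort) p"
proof -
  have "\<exists>x\<in>eq_tuples L C (replicate k RealSort). \<forall>Q\<in>eqholds L C ` p. Q x"
  proof (rule csatD[OF compact_sorts_reals A])
    fix Q assume "Q \<in> eqholds L C ` p"
    then show "edf A (\<lambda>v. Q (map v [0..<length (replicate k RealSort)]))"
      using eqfm_edf p by auto
  next
    fix F assume "F \<subseteq> eqholds L C ` p" "finite F"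
    then obtain F0 where F0: "F0 \<subseteq> p" "finite F0" "F = eqholds L C ` F0" using finite_subset_image by meson
    then have "realizations L C (replicate k RealSort) F0 \<noteq> {}" using con unfolding consistent_def by blast
    then show "\<exists>x\<in>eq_tuples L C (replicate k RealSort). \<forall>Q\<in>F. Q x"
      unfolding F0(3) by (auto simp: realizations_def)
  qed
  then show ?thesis by (auto simp: realizations_def)
qed

text \<open>Partial types are treated because the definition of the rank allows any
  \<open>q\<close>. A realization of \<open>q\<close> also realizes \<open>p\<close>, and by
  \<open>forking_rank_drop\<close> its rank is larger by at least one once the new parameters are
  removed.\<close>

lemma U_ge_realization:
  assumes "U_ge L C (replicate k RealSort) A p n" "A \<subseteq> Ceq L C" "small C A" "p \<subseteq> eqfms_over L C k A"
  shows "\<exists>x\<in>realizations L C (replicate k RealSort) p. n \<le> rk A x"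
  using assms
proof (induction A p n rule: U_ge.induct)
  case (zero p \<alpha> A)
  then have "\<alpha> = 0" by (metis le_zero_eq)
  then show ?case using consistent_realized[OF zero.prems zero.hyps(1)] by blast
next
  case (succ \<beta> \<alpha> a q A p)
  have Aa: "A \<union> set a \<subseteq> Ceq L C" "small C (A \<union> set a)"
    using succ.prems succ.hyps by (auto intro: small_Un_finite)
  moreover have "q \<subseteq> eqfms_over L C k (A \<union> set a)" using succ.hyps by simp
  ultimately obtain x where x: "x \<in> realizations L C (replicate k RealSort) q" "\<beta> \<le> rk (A \<union> set a) x"
    using succ.IH by blast
  then have xr: "length x = k" "set x \<subseteq> U" by (auto simp: realizations_def eq_tuples_reals)
  obtain \<psi> where \<psi>: "\<psi> \<in> q" "thorn_forks_fm L C (replicate k RealSort) \<psi> A"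
    using succ.hyps unfolding thorn_forks_def by blast
  then have "\<psi> \<in> tp L C x (A \<union> set a)" using succ.hyps x xr by (auto simp: tp_def realizations_def)
  from forking_rank_drop[OF _ Aa xr this \<psi>(2)] have "Suc \<beta> \<le> rk A x" using x(2) by simp
  moreover have "x \<in> realizations L C (replicate k RealSort) p" using x succ.hyps by (auto simp: realizations_def)
  ultimately show ?case using succ.hyps by (auto simp: is_succ_nat)
next
  case (limit \<alpha> A p)
  then show ?case using not_is_limit_nat by blast
qed

text \<open>Adjoining a nonalgebraic coordinate of \<open>x\<close> to the parameters gives a
  forking extension, since this coordinate is trivially algebraic over \<open>x\<close>. The
  complete type of \<open>x\<close> over the new set serves as \<open>q\<close>.\<close>

lemma realization_U_ge:
  assumes "x \<in> realizations L C (replicate k RealSort) p" "n \<le> rk A x" "A \<subseteq> Ceq L C" "p \<subseteq> eqfms_over L C k A"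
  shows "U_ge L C (replicate k RealSort) A p n"
  using assms
proof (induction n arbitrary: A p)
  case 0
  then have "consistent L C (replicate k RealSort) p" unfolding consistent_def realizations_def by blast
  then show ?case by (rule U_ge.zero) simp
next
  case (Suc n)
  have xr: "length x = k" "set x \<subseteq> U" using Suc.prems(1) by (auto simp: realizations_def eq_tuples_reals)
  obtain y where y: "y \<in> set x" "y \<notin> acl A" "n \<le> rk (insert y A) x" using rk_pick[OF Suc.prems(2)] by blast
  have yC: "y \<in> Ceq L C" using y(1) xr U_Ceq by blast
  let ?q = "tp L C x (A \<union> set [y])"
  show ?case
  proof (rule U_ge.succ[where a = "[y]" and q = ?q and \<beta> = n])
    show q: "?q \<subseteq> eqfms_over L C (length (replicate k RealSort)) (A \<union> set [y])"
      using xr by (auto simp: tp_def)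
    show "p \<subseteq> ?q" using Suc.prems(1,4) xr by (fastforce simp: tp_def realizations_def eqfms_over_def)
    show "U_ge L C (replicate k RealSort) (A \<union> set [y]) ?q n"
    proof (rule Suc.IH)
      show "x \<in> realizations L C (replicate k RealSort) ?q"
        using Suc.prems(1) by (auto simp: realizations_def tp_def)
    qed (use y yC Suc.prems q in auto)
    show "thorn_forks L C (replicate k RealSort) ?q A"
      by (rule forkingI[OF xr Suc.prems(3), of "[]" y])
        (use y yC Suc.prems acl_refl in auto)
  qed (use yC in \<open>auto simp: is_succ_nat\<close>)
qed

theorem U_rank_ex:
  assumes "A \<subseteq> Ceq L C" "small C A" "p \<subseteq> eqfms_over L C k A" "consistent L C (replicate k RealSort) p"
  shows "\<exists>n. U_rank L C (replicate k RealSort) A p n"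
proof -
  let ?U = "\<lambda>n :: nat. U_ge L C (replicate k RealSort) A p n"
  obtain x where "x \<in> realizations L C (replicate k RealSort) p" using consistent_realized[OF assms] by blast
  then have "?U 0" using realization_U_ge[OF _ _ assms(1,3), of x 0] by simp
  moreover have "n \<le> k" if n: "?U n" for n
  proof -
    obtain x where "x \<in> realizations L C (replicate k RealSort) p" "n \<le> rk A x"
      using U_ge_realization[OF n assms(1-3)] by blast
    then show ?thesis using rk_le_length[of A x] by (auto simp: realizations_def eq_tuples_reals)
  qed
  then have "\<not> ?U (Suc k)" by fastforce
  ultimately obtain n where "?U n" "\<not> ?U (Suc n)"
    by (metis (no_types, opaque_lifting) nat_induct)
  then show ?thesis unfolding U_rank_def by blast
qed

text \<open>All realizations of the complete type have the rank of \<open>x\<close> by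
  \<open>rk_same_tp\<close>, so the bounds from the two preceding rank lemmas meet.\<close>

theorem U_rank_tp:
  assumes "A \<subseteq> Ceq L C" "small C A" "length x = k" "set x \<subseteq> U"
  shows "U_rank L C (replicate k RealSort) A (tp L C x A) (rk A x)"
proof -
  have p: "tp L C x A \<subseteq> eqfms_over L C k A" using assms(3) by (auto simp: tp_def)
  have x: "x \<in> realizations L C (replicate k RealSort) (tp L C x A)"
    using assms by (auto simp: realizations_def tp_def eq_tuples_reals)
  have "\<not> U_ge L C (replicate k RealSort) A (tp L C x A) (Suc (rk A x))"
  proof
    assume "U_ge L C (replicate k RealSort) A (tp L C x A) (Suc (rk A x))"
    from U_ge_realization[OF this assms(1,2) p] obtain y where
      y: "y \<in> realizations L C (replicate k RealSort) (tp L C x A)" "Suc (rk A x) \<le> rk A y" by blast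
    have "same_tp A x y" using realizes_same_tp[OF y(1)] assms(3) by simp
    moreover have "y \<in> eq_tuples L C (replicate k RealSort)" "x \<in> eq_tuples L C (replicate k RealSort)"
      using x y by (auto simp: realizations_def)
    ultimately have "rk A y \<le> rk A x"
      using rk_same_tp[of A "[]" y "[]" x] same_tp_sym by (auto simp: eq_tuples_def)
    then show False using y(2) by simp
  qed
  then show ?thesis unfolding U_rank_def using realization_U_ge[OF x order_refl assms(1) p] by blast
qed

end

section \<open>Dimension of definable sets\<close>

context o_minimal_monster
begin

text \<open>The interval for the last coordinate is chosen with endpoints over which the remaining
  coordinates stay independent, so that neither monotonicity nor cell decomposition is needed.\<close>

lemma interior_of_generic:
  assumes "edf A (\<lambda>v. Q (map v [0..<d]))" "A \<subseteq> Ceq L C" "small C A"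
    and "length y = d" "set y \<subseteq> U" "rk A y = d" "Q y"
  shows "\<exists>l u. length l = d \<and> length u = d \<and> set l \<subseteq> U \<and> set u \<subseteq> U \<and> (\<forall>i<d. lte (l ! i) (u ! i)) \<and>
    (\<forall>x. length x = d \<longrightarrow> set x \<subseteq> U \<longrightarrow> (\<forall>i<d. lte (l ! i) (x ! i) \<and> lte (x ! i) (u ! i)) \<longrightarrow> Q x)"
  using assms
proof (induction d arbitrary: A Q y)
  case 0
  then show ?case by (intro exI[of _ "[]"]) simp
next
  case (Suc d)
  obtain y0 t where y: "y = y0 @ [t]" using Suc.prems(4) by (cases y rule: rev_cases) auto
  have y0: "length y0 = d" "set y0 \<subseteq> U" "t \<in> U" using Suc.prems(4,5) y by auto
  have "rk A y0 + (if t \<in> acl (A \<union> set y0) then 0 else 1) = Suc d"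
    using Suc.prems(6) by (simp add: y rk_append)
  then have rk0: "rk A y0 = d" and t: "t \<notin> acl (A \<union> set y0)"
    using rk_le_length[of A y0] y0(1) by (auto split: if_splits)
  let ?A = "A \<union> set y0"
  have A': "?A \<subseteq> Ceq L C" using Suc.prems(2) y0(2) U_Ceq by blast
  have sA: "small C ?A" by (rule small_Un_finite[OF Suc.prems(3)]) simp
  have eQ: "edf ?A (\<lambda>v. Q (y0 @ [v 0]))"
    using edf_prefix_const1[of ?A Q y0] edf_mono[OF Suc.prems(1), of ?A] y0(1) by simp
  have "Q (y0 @ [t])" using Suc.prems(7) y by simp
  from lft.generic_interval[OF eQ A' y0(3) this t] obtain w where w: "w \<in> U" "lte w t"
    "\<And>z. z \<in> U \<Longrightarrow> lte w z \<Longrightarrow> lte z t \<Longrightarrow> Q (y0 @ [z])" by blast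
  obtain p where p: "p \<in> U" "p \<notin> acl ?A" "lte w p" "lte p t"
    using generic_between[OF A' sA w(1) y0(3) w(2)] by blast
  have pA: "insert p ?A \<subseteq> Ceq L C" "small C (insert p ?A)" using A' p(1) U_Ceq small_insert[OF sA] by auto
  obtain q where q: "q \<in> U" "q \<notin> acl (insert p ?A)" "lte p q" "lte q t"
    using generic_between[OF pA p(1) y0(3) p(4)] by blast
  \<comment> \<open>Over \<open>?B\<close> the first \<open>d\<close> coordinates still have rank
    \<open>d\<close>. The induction hypothesis therefore applies to \<open>Q'\<close>, which demands
    the whole interval between \<open>p\<close> and \<open>q\<close> in the last coordinate.\<close>
  let ?B = "insert q (insert p A)"
  define Q' where "Q' zs \<longleftrightarrow> (\<forall>z\<in>U. lte p z \<longrightarrow> lte z q \<longrightarrow> Q (zs @ [z]))" for zs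
  have pC: "insert p A \<subseteq> Ceq L C" using Suc.prems(2) U_Ceq[OF p(1)] by simp
  have "rk ?B y0 = rk (insert p A) y0"
    by (rule rk_independent[OF pC q(1) y0(2)]) (use q(2) in simp)
  also have "\<dots> = d" using rk_independent[OF Suc.prems(2) p(1) y0(2) p(2)] rk0 by simp
  finally have rkB: "rk ?B y0 = d" .
  have "edf ?B (\<lambda>v. Q' (map v [0..<d]))" unfolding Q'_def
  proof (intro edf_allR edf_imp lft.edf_ls is_args)
    have "edf ?B (\<lambda>v. Q (map (\<lambda>t. t v) (map (\<lambda>i v. v (Suc i)) [0..<d] @ [\<lambda>v. v 0])))"
      by (rule edf_app[OF edf_mono[OF Suc.prems(1)]]) (auto intro: is_args)
    then show "edf ?B (\<lambda>v. Q (map (\<lambda>i. v (Suc i)) [0..<d] @ [v 0]))" by (simp add: comp_def)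
  qed auto
  moreover have "?B \<subseteq> Ceq L C" "small C ?B"
    using pC U_Ceq[OF q(1)] Suc.prems(3) by (auto intro!: small_insert)
  moreover have "Q' y0" using w(3) lft.tr[of w p] lft.tr[of _ q t] w(1) p q y0(3) by (auto simp: Q'_def)
  ultimately obtain l u where lu: "length l = d" "length u = d" "set l \<subseteq> U" "set u \<subseteq> U" "\<And>i. i < d \<Longrightarrow> lte (l ! i) (u ! i)"
    "\<And>x. length x = d \<Longrightarrow> set x \<subseteq> U \<Longrightarrow> (\<forall>i<d. lte (l ! i) (x ! i) \<and> lte (x ! i) (u ! i)) \<Longrightarrow> Q' x"
    using Suc.IH[of ?B Q' y0] y0(1,2) rkB by blast
  have "Q x" if x: "length x = Suc d" "set x \<subseteq> U"
    "\<forall>i<Suc d. lte ((l @ [p]) ! i) (x ! i) \<and> lte (x ! i) ((u @ [q]) ! i)" for x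
  proof -
    obtain x0 z where xz: "x = x0 @ [z]" using x(1) by (cases x rule: rev_cases) auto
    then have x0: "length x0 = d" "set x0 \<subseteq> U" "z \<in> U" using x by auto
    have "lte (l ! i) (x0 ! i) \<and> lte (x0 ! i) (u ! i)" if "i < d" for i
      using x(3)[rule_format, of i] that lu(1,2) x0(1) by (simp add: xz nth_append)
    then have "Q' x0" using lu(6) x0 by blast
    moreover have "lte p z \<and> lte z q" using x(3)[rule_format, of d] lu(1,2) x0(1) by (simp add: xz nth_append)
    ultimately show ?thesis using x0(3) by (simp add: Q'_def xz)
  qed
  moreover have "\<forall>i<Suc d. lte ((l @ [p]) ! i) ((u @ [q]) ! i)"
    using lu(1,2,5) q(3) by (auto simp: nth_append less_Suc_eq)
  ultimately show ?case using lu(1-4) p(1) q(1)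
    by (intro exI[of _ "l @ [p]"] exI[of _ "u @ [q]"]) auto
qed

lemma generic_in_box:
  assumes "A \<subseteq> Ceq L C" "small C A" "length u = length l" "set l \<subseteq> U" "set u \<subseteq> U"
    and "\<And>i. i < length l \<Longrightarrow> lte (l ! i) (u ! i)"
  shows "\<exists>x. length x = length l \<and> set x \<subseteq> U \<and> (\<forall>i<length l. lte (l ! i) (x ! i) \<and> lte (x ! i) (u ! i)) \<and>
    rk A x = length l"
  using assms
proof (induction l arbitrary: u A)
  case Nil
  then show ?case by simp
next
  case (Cons a l)
  then obtain b u' where u: "u = b # u'" by (cases u) auto
  have ab: "a \<in> U" "b \<in> U" "lte a b" using Cons.prems(4,5) Cons.prems(6)[of 0] by (auto simp: u)
  obtain c where c: "c \<in> U" "c \<notin> acl A" "lte a c" "lte c b"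
    using generic_between[OF Cons.prems(1,2) ab] by blast
  have "\<exists>x. length x = length l \<and> set x \<subseteq> U \<and> (\<forall>i<length l. lte (l ! i) (x ! i) \<and> lte (x ! i) (u' ! i)) \<and>
    rk (insert c A) x = length l"
  proof (rule Cons.IH)
    show "lte (l ! i) (u' ! i)" if "i < length l" for i
      using Cons.prems(6)[of "Suc i"] that by (simp add: u)
  qed (use Cons.prems U_Ceq[OF c(1)] small_insert u in auto)
  then obtain x where "length x = length l" "set x \<subseteq> U"
    "\<forall>i<length l. lte (l ! i) (x ! i) \<and> lte (x ! i) (u' ! i)" "rk (insert c A) x = length l" by blast
  then show ?case using c u
    by (intro exI[of _ "c # x"]) (auto simp: nth_Cons split: nat.splits)
qed

text \<open>\<open>I\<close> collects the positions that count in the recursion for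
  \<open>rk\<close>; they form a basis of \<open>x\<close> over \<open>E\<close>.\<close>

lemma rk_basis:
  "\<exists>I\<subseteq>{..<length x}. card I = rk E x \<and> length (nths x I) = card I \<and> rk E (nths x I) = card I"
proof (induction x arbitrary: E)
  case (Cons y x)
  obtain I where I: "I \<subseteq> {..<length x}" "card I = rk (insert y E) x"
    "length (nths x I) = card I" "rk (insert y E) (nths x I) = card I" using Cons.IH by blast
  have fin: "finite I" using I(1) finite_subset by blast
  have c: "card (Suc ` I) = card I" by (simp add: card_image)
  have eq: "{j. Suc j \<in> Suc ` I} = I" "{j. Suc j \<in> insert 0 (Suc ` I)} = I" by auto
  show ?case
  proof (cases "y \<in> acl E")
    case True
    \<comment> \<open>Leaving \<open>y\<close> out of the parameters cannot lower the rank, which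
      already equals the length of the list and so cannot rise either.\<close>
    have "rk E (nths x I) = card I"
      using rk_mono[OF subset_insertI, of y E "nths x I"] rk_le_length[of E "nths x I"] I by linarith
    then show ?thesis using I c True
      by (intro exI[of _ "Suc ` I"]) (auto simp: nths_Cons eq)
  next
    case False
    then show ?thesis using I c fin
      by (intro exI[of _ "insert 0 (Suc ` I)"]) (auto simp: nths_Cons eq)
  qed
qed simp

section \<open>Passage between real formulas and definable predicates\<close>

lemma fms_edf:
  assumes "\<psi> \<in> fms_over L k A"
  shows "\<exists>Q. edf (Rl ` A) (\<lambda>v. Q (map v [0..<k])) \<and>
    (\<forall>x\<in>tuples (univ C) k. Q (map Rl x) \<longleftrightarrow> x \<in> solset C k \<psi>)"
proof -
  obtain \<phi> e where \<psi>: "\<psi> = (\<phi>, e)" "wf_fm L \<phi>" "fv \<phi> \<subseteq> {..<k + length e}" "set e \<subseteq> A"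
    using assms by (auto simp: fms_over_def)
  let ?\<psi> = "(Base \<phi>, map Rl e) :: ('f, 'r, 'a) pfm"
  have "?\<psi> \<in> eqfms_over L C k (Rl ` A)" using \<psi> by (auto simp: eqfms_over_def)
  from eqfm_edf[OF this] have "edf (Rl ` A) (\<lambda>v. eqholds L C ?\<psi> (map v [0..<k]))" .
  moreover have "eqholds L C ?\<psi> (map Rl x) \<longleftrightarrow> x \<in> solset C k \<psi>" if x: "x \<in> tuples (univ C) k" for x
  proof -
    have len: "length x = k" using x by (simp add: tuples_def)
    have *: "(map Rl x @ map Rl e) ! i = (Rl ((x @ e) ! i) :: ('f, 'r, 'a) elt)" if "i \<in> fv \<phi>" for i
      using \<psi>(3) that len by (auto simp: nth_append)
    then have "sat C (\<lambda>i. the_real ((map Rl x @ map Rl e) ! i :: ('f, 'r, 'a) elt)) \<phi> = sat C ((!) (x @ e)) \<phi>"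
      by (intro sat_cong) (simp add: *)
    then show ?thesis using * x by (auto simp: eqholds_def solset_def \<psi>)
  qed
  ultimately show ?thesis by blast
qed

lemma rdf_mono: "rdf A P \<Longrightarrow> A \<subseteq> B \<Longrightarrow> rdf B P"
  unfolding rdf_def by (meson order_trans)

lemma edf_fms:
  assumes "edf (Rl ` A) (\<lambda>v. Q (map v [0..<k]))" "A \<subseteq> univ C"
  shows "\<exists>\<psi>\<in>fms_over L k A. \<forall>x\<in>tuples (univ C) k. x \<in> solset C k \<psi> \<longleftrightarrow> Q (map Rl x)"
proof -
  have "Rl ` A \<subseteq> Ceq L C" using assms(2) by (auto simp: Ceq_def)
  note r = edf_rdf[OF assms(1) this]
  have "repf (Rl a) j = a" if "a \<in> A" for a j
    using repf(3)[of "Rl a" a] that \<open>Rl ` A \<subseteq> Ceq L C\<close> by auto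
  then have "(\<lambda>(x, j). repf x j) ` (Rl ` A \<times> UNIV) \<subseteq> A" by auto
  then have "rdf A (\<lambda>v. Q (map (\<lambda>i. Rl (v i)) [0..<k]))"
    by (rule rdf_mono[OF r])
  then have "\<exists>\<psi>\<in>fms_over L k A. \<forall>v. range v \<subseteq> univ C \<longrightarrow>
      (map v [0..<k] \<in> solset C k \<psi>) = Q (map (\<lambda>i. Rl (v i)) [0..<k])"
  proof (rule rdf_fms)
    fix v w :: "nat \<Rightarrow> 'a" assume "\<forall>i<k. v i = w i"
    then have "map (\<lambda>i. Rl (v i)) [0..<k] = map (\<lambda>i. Rl (w i) :: ('f, 'r, 'a) elt) [0..<k]" by simp
    then show "Q (map (\<lambda>i. Rl (v i)) [0..<k]) = Q (map (\<lambda>i. Rl (w i)) [0..<k])" by (simp only:)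
  qed
  then obtain \<psi> where \<psi>: "\<psi> \<in> fms_over L k A"
    "\<And>v. range v \<subseteq> univ C \<Longrightarrow> (map v [0..<k] \<in> solset C k \<psi>) = Q (map (\<lambda>i. Rl (v i)) [0..<k])"
    by blast
  have "x \<in> solset C k \<psi> \<longleftrightarrow> Q (map Rl x)" if x: "x \<in> tuples (univ C) k" for x
  proof -
    obtain u where u: "u \<in> univ C" using univ_ne by blast
    let ?v = "pre x (\<lambda>_. u)"
    have len: "length x = k" using x by (simp add: tuples_def)
    have "range ?v \<subseteq> univ C" by (rule range_pre) (use x u in \<open>auto simp: tuples_def\<close>)
    from \<psi>(2)[OF this] have "x \<in> solset C k \<psi> \<longleftrightarrow> Q (map (\<lambda>i. Rl (?v i)) [0..<k])" using len by simp
    moreover have "map (\<lambda>i. Rl (?v i) :: ('f, 'r, 'a) elt) [0..<k] = map Rl x"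
      using len by (intro nth_equalityI) auto
    ultimately show ?thesis by (simp only:)
  qed
  then show ?thesis using \<psi>(1) by blast
qed

lemma edf_map_eq: "length xs = length ys \<Longrightarrow> edf E (\<lambda>v. map v xs = map v ys)"
  by (induction xs ys rule: list_induct2) (auto intro: edf_True edf_conj edf_eq0)

lemma real_list: "set x \<subseteq> U \<Longrightarrow> \<exists>y. x = map Rl y \<and> set y \<subseteq> univ C"
proof (induction x)
  case (Cons a x)
  then obtain y b where "x = map Rl y" "set y \<subseteq> univ C" "a = Rl b" "b \<in> univ C" by (auto simp: SU_Real)
  then show ?case by (intro exI[of _ "b # y"]) simp
qed simp

context
  fixes A :: "'a set" and k :: nat and \<psi> :: "('f, 'r) fm \<times> 'a list"
  assumes A: "A \<subseteq> univ C" "small C A" and \<psi>: "\<psi> \<in> fms_over L k A"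
begin

lemma RlA: "Rl ` A \<subseteq> Ceq L C" "small C (Rl ` A :: ('f, 'r, 'a) elt set)"
  using A small_image by (auto simp: Ceq_def)

text \<open>A basis \<open>I\<close> of \<open>x\<close> gives a generic point in the projection
  \<open>Y\<close> of the solution set, and \<open>interior_of_generic\<close> puts a box around
  such a point into \<open>Y\<close>.\<close>

lemma interior_of_rank:
  assumes x: "x \<in> solset C k \<psi>"
  shows "\<exists>I\<subseteq>{..<k}. card I = rk (Rl ` A) (map Rl x) \<and>
    has_interior C lt (rk (Rl ` A) (map Rl x)) ((\<lambda>x. nths x I) ` solset C k \<psi>)"
proof -
  let ?\<sigma> = "replicate k RealSort :: ('f, 'r) esort list"
  let ?x = "map Rl x :: ('f, 'r, 'a) elt list"
  obtain Q where Q: "edf (Rl ` A) (\<lambda>v. Q (map v [0..<k]))"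
    "\<And>x. x \<in> tuples (univ C) k \<Longrightarrow> Q (map Rl x) \<longleftrightarrow> x \<in> solset C k \<psi>"
    using fms_edf[OF \<psi>] by blast
  have xt: "x \<in> tuples (univ C) k" using x by (simp add: solset_def)
  then have xk: "length x = k" "set ?x \<subseteq> U" by (auto simp: tuples_def SU_Real)
  obtain I where I: "I \<subseteq> {..<k}" "card I = rk (Rl ` A) ?x"
    "length (nths ?x I) = card I" "rk (Rl ` A) (nths ?x I) = card I"
    using rk_basis[of ?x "Rl ` A"] unfolding length_map xk(1) by blast
  define d where "d = card I"
  define Y where "Y ys \<longleftrightarrow> (\<exists>xs\<in>eq_tuples L C ?\<sigma>. Q xs \<and> nths xs I = ys)" for ys
  have lenI: "length (nths zs I) = d" if "length zs = k" for zs :: "'z list"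
  proof -
    have "{i. i < k \<and> i \<in> I} = I" using I(1) by auto
    then show ?thesis using that by (simp add: length_nths d_def)
  qed
  have "edf (Rl ` A) (\<lambda>v. \<exists>xs\<in>eq_tuples L C ?\<sigma>. Q xs \<and> nths xs I = map v [0..<d])"
  proof (rule edf_exl)
    have "edf (Rl ` A) (\<lambda>v. Q (map v [0..<k]) \<and> map v (nths [0..<k] I) = map v (map (\<lambda>i. i + k) [0..<d]))"
      by (intro edf_conj Q(1) edf_map_eq) (simp add: lenI)
    then show "edf (Rl ` A) (\<lambda>v. Q (map v [0..<length ?\<sigma>]) \<and> nths (map v [0..<length ?\<sigma>]) I = map (\<lambda>i. v (i + length ?\<sigma>)) [0..<d])"
      by (simp add: nths_map comp_def)
  qed (simp add: list_all_iff)
  then have eY: "edf (Rl ` A) (\<lambda>v. Y (map v [0..<d]))" by (simp add: Y_def)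
  have "?x \<in> eq_tuples L C ?\<sigma>" using xk by (simp add: eq_tuples_reals)
  then have "Y (nths ?x I)" using Q(2)[OF xt] x by (auto simp: Y_def)
  moreover have "set (nths ?x I) \<subseteq> U" using xk(2) set_nths_subset[of "?x" I] by blast
  ultimately obtain l u where lu: "length l = d" "length u = d" "set l \<subseteq> U" "set u \<subseteq> U"
    "\<And>i. i < d \<Longrightarrow> lte (l ! i) (u ! i)"
    "\<And>x. length x = d \<Longrightarrow> set x \<subseteq> U \<Longrightarrow> (\<forall>i<d. lte (l ! i) (x ! i) \<and> lte (x ! i) (u ! i)) \<Longrightarrow> Y x"
    using interior_of_generic[OF eY RlA, of "nths ?x I"] I(3,4) unfolding d_def by blast
  obtain l' u' where l': "l = map Rl l'" "set l' \<subseteq> univ C" and u': "u = map Rl u'" "set u' \<subseteq> univ C"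
    using real_list[OF lu(3)] real_list[OF lu(4)] by blast
  have "has_interior C lt d ((\<lambda>x. nths x I) ` solset C k \<psi>)"
    unfolding has_interior_def
  proof (rule bexI[of _ l'], rule bexI[of _ u'], intro conjI allI impI subsetI)
    show "l' \<in> tuples (univ C) d" "u' \<in> tuples (univ C) d"
      using l' u' lu(1,2) by (auto simp: tuples_def)
    show "less_in C lt (l' ! i) (u' ! i)" if "i < d" for i
      using lu(5)[OF that] that lu(1,2) by (simp add: l' u')
    fix z assume z: "z \<in> {x \<in> tuples (univ C) d. \<forall>i<d. less_in C lt (l' ! i) (x ! i) \<and> less_in C lt (x ! i) (u' ! i)}"
    have "Y (map Rl z)"
      by (rule lu(6)) (use z lu(1,2) in \<open>auto simp: tuples_def SU_Real l' u'\<close>)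
    then obtain xs where xs: "xs \<in> eq_tuples L C ?\<sigma>" "Q xs" "nths xs I = map Rl z" unfolding Y_def by blast
    then obtain w where w: "xs = map Rl w" "set w \<subseteq> univ C" "length w = k"
      using real_list[of xs] by (auto simp: eq_tuples_reals)
    then have "w \<in> solset C k \<psi>" using Q(2)[of w] xs(2) by (auto simp: tuples_def)
    moreover have "map Rl (nths w I) = (map Rl z :: ('f, 'r, 'a) elt list)" using xs(3) by (simp add: w nths_map)
    then have "nths w I = z" by (rule map_injective) (auto intro: injI)
    ultimately show "z \<in> (\<lambda>x. nths x I) ` solset C k \<psi>" by blast
  qed
  then show ?thesis using I(1,2) d_def by auto
qed

lemma finite_odim_set: "finite {d. \<exists>I\<subseteq>{..<k}. card I = d \<and> P I d}"
proof (rule finite_subset)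
  show "{d. \<exists>I\<subseteq>{..<k}. card I = d \<and> P I d} \<subseteq> card ` Pow {..<k}" by blast
qed simp

lemma rank_le_odim: "x \<in> solset C k \<psi> \<Longrightarrow> rk (Rl ` A) (map Rl x) \<le> odim C lt k (solset C k \<psi>)"
  unfolding odim_def using interior_of_rank by (intro Max_ge finite_odim_set) blast

text \<open>By saturation the box in the best projection contains a generic point, and a preimage of
  it has at least the rank of its projection by \<open>rk_nths\<close>.\<close>

lemma odim_attained:
  assumes "solset C k \<psi> \<noteq> {}"
  shows "\<exists>x\<in>solset C k \<psi>. rk (Rl ` A) (map Rl x) = odim C lt k (solset C k \<psi>)"
proof -
  let ?S = "{d. \<exists>I\<subseteq>{..<k}. card I = d \<and> has_interior C lt d ((\<lambda>x. nths x I) ` solset C k \<psi>)}"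
  let ?d = "odim C lt k (solset C k \<psi>)"
  have "?S \<noteq> {}" using assms interior_of_rank by blast
  then have "?d \<in> ?S" unfolding odim_def by (intro Max_in finite_odim_set)
  then obtain I l u where I: "I \<subseteq> {..<k}" "card I = ?d" and l: "l \<in> tuples (univ C) ?d" and u: "u \<in> tuples (univ C) ?d"
    and lu: "\<And>i. i < ?d \<Longrightarrow> less_in C lt (l ! i) (u ! i)"
    and box: "{x \<in> tuples (univ C) ?d. \<forall>i<?d. less_in C lt (l ! i) (x ! i) \<and> less_in C lt (x ! i) (u ! i)}
      \<subseteq> (\<lambda>x. nths x I) ` solset C k \<psi>"
    unfolding has_interior_def by blast
  have len: "length l = ?d" "length u = ?d" using l u by (auto simp: tuples_def)
  let ?l = "map Rl l :: ('f, 'r, 'a) elt list" and ?u = "map Rl u :: ('f, 'r, 'a) elt list"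
  have "\<exists>x. length x = length ?l \<and> set x \<subseteq> U \<and>
      (\<forall>i<length ?l. lte (?l ! i) (x ! i) \<and> lte (x ! i) (?u ! i)) \<and>
      rk (Rl ` A) x = length ?l"
    by (rule generic_in_box[OF RlA]) (use l u lu in \<open>auto simp: tuples_def SU_Real\<close>)
  then obtain z where z: "length z = ?d" "set z \<subseteq> U"
      "\<And>i. i < ?d \<Longrightarrow> lte (?l ! i) (z ! i) \<and> lte (z ! i) (?u ! i)" "rk (Rl ` A) z = ?d"
    using len by auto
  obtain w where w: "z = map Rl w" "set w \<subseteq> univ C" using real_list[OF z(2)] by blast
  have "less_in C lt (l ! i) (w ! i) \<and> less_in C lt (w ! i) (u ! i)" if "i < ?d" for i
    using z(3)[OF that] z(1) that len by (simp add: w)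
  then have "w \<in> (\<lambda>x. nths x I) ` solset C k \<psi>"
    using box w z(1) by (auto simp: tuples_def subset_iff)
  then obtain x where x: "x \<in> solset C k \<psi>" "w = nths x I" by blast
  then have "set (map Rl x) \<subseteq> U" by (auto simp: solset_def tuples_def SU_Real)
  from rk_nths[OF RlA(1) this, of I] have "?d \<le> rk (Rl ` A) (map Rl x)"
    using z(4) by (simp add: w x(2) nths_map)
  then show ?thesis using x(1) rank_le_odim[OF x(1)] by (auto intro: le_antisym)
qed

end

text \<open>The formula collects, for each coordinate of \<open>x\<close> that is algebraic over the
  preceding ones, a condition that forces algebraicity at every tuple satisfying it. Coordinates
  that count contribute no condition, so other solutions cannot exceed the rank of
  \<open>x\<close>.\<close>

lemma rank_locus:
  assumes "set x \<subseteq> Ceq L C"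
  shows "\<exists>Q. edf E (\<lambda>v. Q (map v [0..<length x])) \<and> Q x \<and>
    (\<forall>y. map sort_of y = map sort_of x \<longrightarrow> set y \<subseteq> Ceq L C \<longrightarrow> Q y \<longrightarrow> rk E y \<le> rk E x)"
  using assms
proof (induction x rule: rev_induct)
  case Nil
  then show ?case by (intro exI[of _ "\<lambda>_. True"]) (auto simp: edf_True)
next
  case (snoc b x)
  let ?n = "length x"
  obtain Q where Q: "edf E (\<lambda>v. Q (map v [0..<?n]))" "Q x"
    "\<And>y. map sort_of y = map sort_of x \<Longrightarrow> set y \<subseteq> Ceq L C \<Longrightarrow> Q y \<Longrightarrow> rk E y \<le> rk E x"
    using snoc.IH snoc.prems by auto
  have take: "take ?n (map v [0..<Suc ?n]) = map v [0..<?n]" for v :: "nat \<Rightarrow> ('f, 'r, 'a) elt"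
    by (simp add: take_map)
  have eQ: "edf E (\<lambda>v. Q (take ?n (map v [0..<Suc ?n])))" unfolding take by (rule Q(1))
  have split: "\<exists>y0 c. y = y0 @ [c] \<and> map sort_of y0 = map sort_of x \<and> sort_of c = sort_of b"
    if "map sort_of y = map sort_of (x @ [b])" for y :: "('f, 'r, 'a) elt list"
    using that by (cases y rule: rev_cases) auto
  show ?case
  proof (cases "b \<in> acl (E \<union> set x)")
    case False
    show ?thesis
    proof (intro exI[of _ "\<lambda>xs. Q (take ?n xs)"] conjI allI impI)
      show "edf E (\<lambda>v. Q (take ?n (map v [0..<length (x @ [b])])))" using eQ by simp
      show "Q (take ?n (x @ [b]))" using Q(2) by simp
      fix y assume y: "map sort_of y = map sort_of (x @ [b])" "set y \<subseteq> Ceq L C" "Q (take ?n y)"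
      obtain y0 c where yc: "y = y0 @ [c]" "map sort_of y0 = map sort_of x" using split[OF y(1)] by blast
      then have "length y0 = ?n" by (metis length_map)
      then have "rk E y0 \<le> rk E x" using Q(3)[OF yc(2)] y yc(1) by simp
      then show "rk E y \<le> rk E (x @ [b])" using False by (simp add: yc(1) rk_append)
    qed
  next
    case True
    obtain R N where R: "edf E (\<lambda>v. R (map v [0..<Suc ?n]))" "R (x @ [b])"
      "\<And>y z. length y = ?n \<Longrightarrow> R (y @ [z]) \<Longrightarrow> at_most N {w \<in> SU (sort_of b). R (y @ [w])}"
      using acl_listD[OF True refl] by blast
    show ?thesis
    proof (intro exI[of _ "\<lambda>xs. Q (take ?n xs) \<and> R xs"] conjI allI impI)
      show "edf E (\<lambda>v. Q (take ?n (map v [0..<length (x @ [b])])) \<and> R (map v [0..<length (x @ [b])]))"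
        using edf_conj[OF eQ R(1)] by simp
      show "Q (take ?n (x @ [b]))" using Q(2) by simp
      show "R (x @ [b])" by (rule R(2))
      fix y assume y: "map sort_of y = map sort_of (x @ [b])" "set y \<subseteq> Ceq L C" "Q (take ?n y) \<and> R y"
      obtain y0 c where yc: "y = y0 @ [c]" "map sort_of y0 = map sort_of x" "sort_of c = sort_of b"
        using split[OF y(1)] by blast
      then have len: "length y0 = ?n" by (metis length_map)
      then have "rk E y0 \<le> rk E x" using Q(3)[OF yc(2)] y yc(1) by simp
      moreover have "c \<in> acl (E \<union> set y0)"
      proof (rule aclI[where Q = "\<lambda>w. R (y0 @ [w])"])
        show "edf (E \<union> set y0) (\<lambda>v. R (y0 @ [v 0]))"
          by (rule edf_prefix_const1) (use edf_mono[OF R(1), of "E \<union> set y0"] len in auto)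
        show "finite {w \<in> SU (sort_of c). R (y0 @ [w])}"
          using R(3)[OF len, of c] y(3) by (simp add: yc at_most_def)
      qed (use y yc in auto)
      ultimately show "rk E y \<le> rk E (x @ [b])" using True by (simp add: yc(1) rk_append)
    qed
  qed
qed

text \<open>The set from \<open>rank_locus\<close> contains no point of larger rank than
  \<open>a\<close>, and its dimension is the rank of one of its points. Conversely, every definable
  set through \<open>a\<close> has at least the rank of \<open>a\<close> as its dimension.\<close>

theorem odim_tuple_eq_rk:
  assumes A: "A \<subseteq> univ C" "small C A" and a: "set a \<subseteq> univ C"
  shows "odim_tuple L C lt a A = rk (Rl ` A) (map Rl a)"
  unfolding odim_tuple_def
proof (rule Least_equality)
  let ?k = "length a" and ?r = "rk (Rl ` A) (map Rl a)"
  have at: "a \<in> tuples (univ C) ?k" using a by (simp add: tuples_def)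
  have "set (map Rl a) \<subseteq> Ceq L C" using a by (auto simp: Ceq_def)
  then obtain Q where Q: "edf (Rl ` A) (\<lambda>v. Q (map v [0..<?k]))" "Q (map Rl a)"
    "\<And>y. map sort_of y = map sort_of (map Rl a) \<Longrightarrow> set y \<subseteq> Ceq L C \<Longrightarrow> Q y \<Longrightarrow> rk (Rl ` A) y \<le> ?r"
    using rank_locus[of "map Rl a" "Rl ` A"] by auto
  obtain \<psi> where \<psi>: "\<psi> \<in> fms_over L ?k A" "\<And>x. x \<in> tuples (univ C) ?k \<Longrightarrow> x \<in> solset C ?k \<psi> \<longleftrightarrow> Q (map Rl x)"
    using edf_fms[OF Q(1) A(1)] by blast
  have aX: "a \<in> solset C ?k \<psi>" using \<psi>(2)[OF at] Q(2) by simp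
  obtain x where x: "x \<in> solset C ?k \<psi>" "rk (Rl ` A) (map Rl x) = odim C lt ?k (solset C ?k \<psi>)"
    using odim_attained[OF A \<psi>(1)] aX by blast
  have xt: "x \<in> tuples (univ C) ?k" using x(1) by (simp add: solset_def)
  have "map sort_of (map Rl x :: ('f, 'r, 'a) elt list) = map sort_of (map Rl a)"
    using xt by (intro nth_equalityI) (auto simp: tuples_def)
  moreover have "set (map Rl x) \<subseteq> Ceq L C" using xt by (auto simp: tuples_def Ceq_def)
  ultimately have "rk (Rl ` A) (map Rl x) \<le> ?r" using Q(3) \<psi>(2)[OF xt] x(1) by blast
  then have "odim C lt ?k (solset C ?k \<psi>) = ?r"
    using x(2) rank_le_odim[OF A \<psi>(1) aX] by simp
  then show "\<exists>X. definable_over L C A ?k X \<and> a \<in> X \<and> odim C lt ?k X = ?r"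
    using \<psi>(1) aX unfolding definable_over_def by blast
next
  fix d assume "\<exists>X. definable_over L C A (length a) X \<and> a \<in> X \<and> odim C lt (length a) X = d"
  then show "rk (Rl ` A) (map Rl a) \<le> d"
    unfolding definable_over_def using rank_le_odim[OF A] by blast
qed

end

section \<open>Elementary substructures\<close>

lemma elem_sub_fdf:
  assumes "elem_sub L M C" "fdf L {M, C} P" "range v \<subseteq> univ M"
  shows "P M v = P C v"
proof -
  obtain \<phi> where "wf_fm L \<phi>" "\<And>N v. N \<in> {M, C} \<Longrightarrow> range v \<subseteq> univ N \<Longrightarrow> P N v = sat N v \<phi>"
    using assms(2) unfolding fdf_def by blast
  moreover have "range v \<subseteq> univ C" using assms(1,3) by (auto simp: elem_sub_def)
  ultimately show ?thesis using assms(1,3) by (simp add: elem_sub_def)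
qed

lemma fdf_map_eq: "length xs = length ys \<Longrightarrow> fdf L K (\<lambda>N v. map v xs = map v ys)"
  by (induction xs ys rule: list_induct2) (auto intro: fdf_True fdf_conj fdf_eq)

lemma fdf_less:
  assumes "lt \<in> rsyms L" "rarity L lt = 2"
  shows "fdf L K (\<lambda>N v. less_in N lt (v i) (v j))"
  using fdf_sat[of L "Pred lt [Var i, Var j]" K] assms by (simp add: less_in_def)

text \<open>Interior of a projection is first-order, uniformly in the parameters and in the
  structure; this lets the dimension pass from \<open>M\<close> to \<open>C\<close>.\<close>

lemma fdf_has_interior:
  assumes lt: "lt \<in> rsyms L" "rarity L lt = 2" and \<phi>: "wf_fm L \<phi>" "fv \<phi> \<subseteq> {..<k + n}"
    and I: "I \<subseteq> {..<k}" "card I = d"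
  shows "fdf L K (\<lambda>N v. has_interior N lt d ((\<lambda>x. nths x I) ` solset N k (\<phi>, map v [0..<n])))"
proof -
  let ?P = "\<lambda>N v l u. (\<forall>i<d. less_in N lt (l ! i) (u ! i)) \<and>
      (\<forall>x\<in>tuples (univ N) d. (\<forall>i<d. less_in N lt (l ! i) (x ! i) \<and> less_in N lt (x ! i) (u ! i)) \<longrightarrow>
        (\<exists>y\<in>tuples (univ N) k. nths y I = x \<and> sat N ((!) (y @ map v [0..<n])) \<phi>))"
  have *: "has_interior N lt d ((\<lambda>x. nths x I) ` solset N k (\<phi>, map v [0..<n])) =
      (\<exists>l\<in>tuples (univ N) d. \<exists>u\<in>tuples (univ N) d. ?P N v l u)"
    for N :: "('b, 'a, 'c) struc" and v :: "nat \<Rightarrow> 'c"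
    unfolding has_interior_def solset_def by (auto simp: subset_iff image_iff) (metis | blast)+
  show ?thesis unfolding *
  proof (intro fdf_exl fdf_conj fdf_alll fdf_imp fdf_ball)
    show "fdf L K (\<lambda>N v. less_in N lt (map (\<lambda>i. v (i + d)) [0..<d] ! i) (map v [0..<d] ! i))" if "i < d" for i
      by (rule fdf_cong[OF fdf_less[OF lt, of _ "i + d" i]]) (use that in simp)
    show "fdf L K (\<lambda>N v. less_in N lt (map (\<lambda>i. v (i + d + d)) [0..<d] ! i) (map v [0..<d] ! i))" if "i < d" for i
      by (rule fdf_cong[OF fdf_less[OF lt, of _ "i + d + d" i]]) (use that in simp)
    show "fdf L K (\<lambda>N v. less_in N lt (map v [0..<d] ! i) (map (\<lambda>i. v (i + d)) [0..<d] ! i))" if "i < d" for i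
      by (rule fdf_cong[OF fdf_less[OF lt, of _ i "i + d"]]) (use that in simp)
    have "{i. i < k \<and> i \<in> I} = I" using I(1) by auto
    then have "length (nths [0..<k] I) = d" using I(2) by (simp add: length_nths)
    then have "fdf L K (\<lambda>N v. map v (nths [0..<k] I) = map v (map (\<lambda>i. i + k) [0..<d]))"
      by (intro fdf_map_eq) simp
    then show "fdf L K (\<lambda>N v. nths (map v [0..<k]) I = map (\<lambda>i. v (i + k)) [0..<d])"
      by (simp add: nths_map comp_def)
    \<comment> \<open>Behind the point \<open>y\<close> of length \<open>k\<close>, the bound tuples
      \<open>x\<close>, \<open>u\<close> and \<open>l\<close> of length \<open>d\<close> precede the
      parameters.\<close>
    let ?g = "\<lambda>i. if i < k then i else i - k + d + d + d + k"
    show "fdf L K (\<lambda>N v. sat N ((!) (map v [0..<k] @ map (\<lambda>i. v (i + d + d + d + k)) [0..<n])) \<phi>)"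
    proof (rule fdf_cong[OF fdf_ren[OF fdf_sat[OF \<phi>(1)], of _ ?g]], rule sat_cong)
      fix N and v :: "nat \<Rightarrow> 'c" and i
      assume "i \<in> fv \<phi>"
      then have "i < k + n" using \<phi>(2) by auto
      then show "v (?g i) = (map v [0..<k] @ map (\<lambda>i. v (i + d + d + d + k)) [0..<n]) ! i"
        by (auto simp: nth_append)
    qed
  qed
qed

lemma has_interior_elem_sub:
  assumes MC: "elem_sub L M C" and lt: "lt \<in> rsyms L" "rarity L lt = 2"
    and \<psi>: "\<psi> \<in> fms_over L k (univ M)" and I: "I \<subseteq> {..<k}" "card I = d"
  shows "has_interior M lt d ((\<lambda>x. nths x I) ` solset M k \<psi>) = has_interior C lt d ((\<lambda>x. nths x I) ` solset C k \<psi>)"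
proof -
  obtain \<phi> e where e: "\<psi> = (\<phi>, e)" "wf_fm L \<phi>" "fv \<phi> \<subseteq> {..<k + length e}" "set e \<subseteq> univ M"
    using \<psi> by (auto simp: fms_over_def)
  obtain u where u: "u \<in> univ M" using MC by (auto simp: elem_sub_def is_struc_def)
  have "range (pre e (\<lambda>_. u)) \<subseteq> univ M" by (rule range_pre) (use e u in auto)
  from elem_sub_fdf[OF MC fdf_has_interior[OF lt e(2,3) I] this] show ?thesis by (simp add: e(1))
qed

lemma odim_elem_sub:
  assumes "elem_sub L M C" "lt \<in> rsyms L" "rarity L lt = 2" "\<psi> \<in> fms_over L k (univ M)"
  shows "odim M lt k (solset M k \<psi>) = odim C lt k (solset C k \<psi>)"
proof -
  have "{d. \<exists>I\<subseteq>{..<k}. card I = d \<and> has_interior M lt d ((\<lambda>x. nths x I) ` solset M k \<psi>)} =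
      {d. \<exists>I\<subseteq>{..<k}. card I = d \<and> has_interior C lt d ((\<lambda>x. nths x I) ` solset C k \<psi>)}"
    using has_interior_elem_sub[OF assms] by blast
  then show ?thesis unfolding odim_def by simp
qed

text \<open>In dimension \<open>0\<close> the only box is \<open>{[]}\<close>, so nonemptiness is a
  case of interior and transfers with it.\<close>

lemma solset_nonempty_iff: "solset N k \<psi> \<noteq> {} \<longleftrightarrow> has_interior N lt 0 ((\<lambda>x. nths x {}) ` solset N k \<psi>)"
  by (auto simp: has_interior_def)

lemma solset_nonempty_elem_sub:
  assumes "elem_sub L M C" "lt \<in> rsyms L" "rarity L lt = 2" "\<psi> \<in> fms_over L k (univ M)" "solset M k \<psi> \<noteq> {}"
  shows "solset C k \<psi> \<noteq> {}"
  using has_interior_elem_sub[OF assms(1-4), of "{}" 0] assms(5)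
  unfolding solset_nonempty_iff[of _ _ _ lt] by simp

text \<open>The rank is taken over points of the monster while the dimension is computed in
  \<open>M\<close>; \<open>odim_elem_sub\<close> identifies the dimensions in the two structures,
  and \<open>rk\<close> links rank and dimension inside \<open>C\<close>.\<close>

theorem mainTheorem4:
  fixes L :: "('f, 'r) lang" and T :: "('f, 'r) fm set" and lt :: 'r
    and C M :: "('f, 'r, 'a) struc"
  assumes "complete_theory TYPE('a) L T"
    and "o_minimal_theory TYPE('a) L lt T"
    and "monster L T C"
    and "is_model L T M" and "elem_sub L M C" and "small C (univ M)"
  shows
    "(\<forall>k A p. A \<subseteq> univ C \<longrightarrow> small C A \<longrightarrow> p \<subseteq> eqfms_over L C k (Rl ` A) \<longrightarrow>
        consistent L C (replicate k RealSort) p \<longrightarrow>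
        (\<exists>n. U_rank L C (replicate k RealSort) (Rl ` A) p n)) \<and>
     (\<forall>k B \<psi>. finite B \<longrightarrow> B \<subseteq> univ M \<longrightarrow> \<psi> \<in> fms_over L k B \<longrightarrow> solset M k \<psi> \<noteq> {} \<longrightarrow>
        U_rank_set L C k B (solset C k \<psi>) (odim M lt k (solset M k \<psi>))) \<and>
     (\<forall>a b A. set a \<subseteq> univ C \<longrightarrow> set b \<subseteq> univ C \<longrightarrow> A \<subseteq> univ C \<longrightarrow> small C A \<longrightarrow>
        (\<not> thorn_forks L C (replicate (length a) RealSort)
             (tp L C (map Rl a) (Rl ` (A \<union> set b))) (Rl ` A) \<longleftrightarrow>
         odim_tuple L C lt a (A \<union> set b) = odim_tuple L C lt a A))"
proof -
  have om: "o_minimal L lt C" and big: "|{\<phi>. wf_fm L \<phi>}| <o |univ C|" and sat: "saturated L C"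
    using assms(2,3) by (auto simp: o_minimal_theory_def monster_def)
  then interpret o_minimal_monster L C lt
    by unfold_locales (auto simp: o_minimal_def)
  have lt: "lt \<in> rsyms L" "rarity L lt = 2" using om by (auto simp: o_minimal_def)
  have R: "Rl ` A \<subseteq> Ceq L C" "small C (Rl ` A :: ('f, 'r, 'a) elt set)" if "A \<subseteq> univ C" "small C A" for A
    using that small_image by (auto simp: Ceq_def)
  have "\<exists>n. U_rank L C (replicate k RealSort) (Rl ` A) p n"
    if "A \<subseteq> univ C" "small C A" "p \<subseteq> eqfms_over L C k (Rl ` A)" "consistent L C (replicate k RealSort) p" for k A p
    by (rule U_rank_ex[OF R[OF that(1,2)] that(3,4)])
  moreover have "U_rank_set L C k B (solset C k \<psi>) (odim M lt k (solset M k \<psi>))"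
    if B: "finite B" "B \<subseteq> univ M" and \<psi>: "\<psi> \<in> fms_over L k B" "solset M k \<psi> \<noteq> {}" for k B \<psi>
  proof -
    have BC: "B \<subseteq> univ C" "small C B" using B assms(5) small_finite by (auto simp: elem_sub_def)
    have \<psi>M: "\<psi> \<in> fms_over L k (univ M)" using \<psi>(1) B(2) by (auto simp: fms_over_def)
    have ne: "solset C k \<psi> \<noteq> {}" by (rule solset_nonempty_elem_sub[OF assms(5) lt \<psi>M \<psi>(2)])
    have "U_rank L C (replicate k RealSort) (Rl ` B) (tp L C (map Rl x) (Rl ` B)) (rk (Rl ` B) (map Rl x))"
      if "x \<in> solset C k \<psi>" for x
      by (rule U_rank_tp[OF R[OF BC]]) (use that in \<open>auto simp: solset_def tuples_def SU_Real\<close>)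
    then show ?thesis
      unfolding U_rank_set_def odim_elem_sub[OF assms(5) lt \<psi>M]
      using odim_attained[OF BC \<psi>(1) ne] rank_le_odim[OF BC \<psi>(1)] by metis
  qed
  moreover have "\<not> thorn_forks L C (replicate (length a) RealSort) (tp L C (map Rl a) (Rl ` (A \<union> set b))) (Rl ` A) \<longleftrightarrow>
      odim_tuple L C lt a (A \<union> set b) = odim_tuple L C lt a A"
    if a: "set a \<subseteq> univ C" and b: "set b \<subseteq> univ C" and A: "A \<subseteq> univ C" "small C A" for a b A
  proof -
    have Ab: "A \<union> set b \<subseteq> univ C" "small C (A \<union> set b)" using A b small_Un_finite by auto
    have eq: "Rl ` (A \<union> set b) = Rl ` A \<union> set (map Rl b)" by auto
    have "thorn_forks L C (replicate (length a) RealSort) (tp L C (map Rl a) (Rl ` (A \<union> set b))) (Rl ` A) \<longleftrightarrow>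
        rk (Rl ` (A \<union> set b)) (map Rl a) < rk (Rl ` A) (map Rl a)"
      unfolding eq by (rule thorn_forks_iff[OF R[OF A]]) (use a b in \<open>auto simp: SU_Real\<close>)
    moreover have "rk (Rl ` (A \<union> set b)) (map Rl a) \<le> rk (Rl ` A) (map Rl a)" by (rule rk_mono) auto
    ultimately show ?thesis using odim_tuple_eq_rk[OF A a] odim_tuple_eq_rk[OF Ab a] by auto
  qed
  ultimately show ?thesis by blast
qed

end
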